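(* Let $(M^n,g)$ be a complete, properly immersed translating soliton in $\mathbb{R}^{n+k}$ with mean curvature vector $\vec H$, and assume that $\sup_M|\vec H|^2<1$. Then there exist numbers $a_0>1$ and $\epsilon>0$ such that for all $a>a_0$, with $u(X)=\exp(aS(X))$ on $M$, one has $$\int_{M_R}u\,dm\ \ge\ \exp\big(\epsilon(R-R_0)\big)\int_{M_{R_0}}u\,dm\qquad\text{for all } R\ge R_0>0,$$ where $M_R=B_R(0)\cap M$.
   Context: Let $W\in\mathbb{R}^{n+k}$ be a fixed unit vector. For an immersed $n$-dimensional submanifold $M\subset\mathbb{R}^{n+k}$ with induced metric $g$, a local orthonormal tangent frame $\{e_i\}$ and a local orthonormal normal frame $\{\nu_\alpha\}_{1\le\alpha\le k}$, put $h_{\alpha ij}=\langle D_{e_i}\nu_\alpha,e_j\rangle$ (with $D$ the directional derivative of $\mathbb{R}^{n+k}$) and $H_\alpha=\sum_j h_{\alpha jj}$; the mean curvature vector is $\vec H=-\sum_\alpha H_\alpha\nu_\alpha$. $M$ is a translating soliton (with respect to $W$) if $H_\alpha=\langle\nu_\alpha,W\rangle$ on $M$ for all $1\le\alpha\le k$. $X$ denotes the position vector, $S(X)=\langle X,W\rangle$, and $dm=\exp(-S(X))\,dv_g$ where $dv_g$ is the Riemannian volume measure of $(M,g)$. $B_R(0)$ is the Euclidean ball of radius $R$ centered at the origin of $\mathbb{R}^{n+k}$; for an immersion, $B_R(0)\cap M$ means the set of points of $M$ whose position vector lies in $B_R(0)$. *)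

theory Defs
  imports "HOL-Analysis.Analysis"
begin

section \<open>Smooth maps between Euclidean spaces\<close>

primrec Ck_on :: "nat \<Rightarrow> 'a::real_normed_vector set \<Rightarrow> ('a \<Rightarrow> 'b::real_normed_vector) \<Rightarrow> bool" where
  "Ck_on 0 S f \<longleftrightarrow> continuous_on S f"
| "Ck_on (Suc r) S f \<longleftrightarrow>
     (\<forall>x\<in>S. f differentiable (at x)) \<and> (\<forall>v. Ck_on r S (\<lambda>x. frechet_derivative f (at x) v))"

text \<open>Only used for open \<^term>\<open>S\<close>.\<close>

definition smooth_on :: "'a::real_normed_vector set \<Rightarrow> ('a \<Rightarrow> 'b::real_normed_vector) \<Rightarrow> bool" where
  "smooth_on S f \<longleftrightarrow> (\<forall>r. Ck_on r S f)"


section \<open>Smooth manifolds\<close>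

text \<open>
  The manifold is the whole type \<^typ>\<open>'m\<close>, taken to be Hausdorff and second countable. A chart is a
  pair of its domain and its coordinate map; the values of the coordinate map outside the
  domain are irrelevant. The dimension is the cardinality of \<^typ>\<open>'n\<close>. Atlases are not required to
  be maximal.
\<close>

type_synonym ('m, 'n) chart = "'m set \<times> ('m \<Rightarrow> real^'n)"

definition chart_inv :: "('m, 'n) chart \<Rightarrow> real^'n \<Rightarrow> 'm" where
  "chart_inv c = inv_into (fst c) (snd c)"

definition smooth_atlas ::
  "('m::{t2_space, second_countable_topology}, 'n::finite) chart set \<Rightarrow> bool" where
  "smooth_atlas A \<longleftrightarrow>
     (\<Union>c\<in>A. fst c) = UNIV \<and>
     (\<forall>c\<in>A. open (fst c) \<and> open (snd c ` fst c) \<and>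
            homeomorphism (fst c) (snd c ` fst c) (snd c) (chart_inv c)) \<and>
     (\<forall>c\<in>A. \<forall>d\<in>A. smooth_on (snd c ` (fst c \<inter> fst d)) (snd d \<circ> chart_inv c))"

definition smooth_map_on ::
  "('m::topological_space, 'n::finite) chart set \<Rightarrow> 'm set \<Rightarrow> ('m \<Rightarrow> 'v::real_normed_vector) \<Rightarrow> bool" where
  "smooth_map_on A N f \<longleftrightarrow> (\<forall>c\<in>A. smooth_on (snd c ` (fst c \<inter> N)) (f \<circ> chart_inv c))"

text \<open>The differential of \<^term>\<open>f\<close> at \<^term>\<open>p\<close>, expressed in the chart \<^term>\<open>c\<close>.\<close>

definition chart_diff ::
  "('m, 'n::finite) chart \<Rightarrow> ('m \<Rightarrow> 'v::real_normed_vector) \<Rightarrow> 'm \<Rightarrow> real^'n \<Rightarrow> 'v" where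
  "chart_diff c f p = frechet_derivative (f \<circ> chart_inv c) (at (snd c p))"


section \<open>Immersed submanifolds\<close>

definition immersion ::
  "('m::topological_space, 'n::finite) chart set \<Rightarrow> ('m \<Rightarrow> 'v::euclidean_space) \<Rightarrow> bool" where
  "immersion A X \<longleftrightarrow>
     smooth_map_on A UNIV X \<and> (\<forall>c\<in>A. \<forall>p\<in>fst c. inj (chart_diff c X p))"

definition proper :: "('m::topological_space \<Rightarrow> 'v::topological_space) \<Rightarrow> bool" where
  "proper X \<longleftrightarrow> (\<forall>K. compact K \<longrightarrow> compact (X -` K))"

text \<open>
  Tangent spaces are regarded as subspaces of the ambient space, via the differential of the
  immersion. The induced metric is then the restriction of the ambient inner product.
\<close>

definition tangent_space ::
  "('m, 'n::finite) chart set \<Rightarrow> ('m \<Rightarrow> 'v::euclidean_space) \<Rightarrow> 'm \<Rightarrow> 'v set" where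
  "tangent_space A X p = (\<Union>c\<in>{c\<in>A. p \<in> fst c}. range (chart_diff c X p))"

definition normal_space ::
  "('m, 'n::finite) chart set \<Rightarrow> ('m \<Rightarrow> 'v::euclidean_space) \<Rightarrow> 'm \<Rightarrow> 'v set" where
  "normal_space A X p = (tangent_space A X p)\<^sup>\<bottom>"

definition metric_matrix ::
  "('m \<Rightarrow> 'v::euclidean_space) \<Rightarrow> ('m, 'n::finite) chart \<Rightarrow> 'm \<Rightarrow> real^'n^'n" where
  "metric_matrix X c p = (\<chi> i j. chart_diff c X p (axis i 1) \<bullet> chart_diff c X p (axis j 1))"

text \<open>
  The directional derivative of \<^term>\<open>f\<close> at \<^term>\<open>p\<close> along the tangent vector \<^term>\<open>w\<close> of the ambient space;
  by the chain rule it does not depend on the chart.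
\<close>

definition dir_deriv ::
  "('m, 'n::finite) chart set \<Rightarrow> ('m \<Rightarrow> 'v::euclidean_space) \<Rightarrow> ('m \<Rightarrow> 'v) \<Rightarrow> 'm \<Rightarrow> 'v \<Rightarrow> 'v" where
  "dir_deriv A X f p w =
     (THE d. \<exists>c\<in>A. p \<in> fst c \<and> (\<exists>v. chart_diff c X p v = w \<and> chart_diff c f p v = d))"


subsection \<open>Riemannian distance, completeness and volume\<close>

definition piecewise_C1_curve ::
  "('m::topological_space, 'n::finite) chart set \<Rightarrow> (real \<Rightarrow> 'm) \<Rightarrow> bool" where
  "piecewise_C1_curve A \<gamma> \<longleftrightarrow>
     path \<gamma> \<and>
     (\<exists>F. finite F \<and>
        (\<forall>c\<in>A. (snd c \<circ> \<gamma>) C1_differentiable_on {t \<in> {0<..<1} - F. \<gamma> t \<in> fst c}))"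

text \<open>
  The speed of \<^term>\<open>\<gamma>\<close> with respect to the induced metric is the Euclidean speed of its image
  under the immersion. Points in different components have distance \<^term>\<open>\<infinity>::ennreal\<close>.
\<close>

definition riem_length :: "('m \<Rightarrow> 'v::euclidean_space) \<Rightarrow> (real \<Rightarrow> 'm) \<Rightarrow> ennreal" where
  "riem_length X \<gamma> = (\<integral>\<^sup>+t\<in>{0..1}. ennreal (norm (vector_derivative (X \<circ> \<gamma>) (at t))) \<partial>lborel)"

definition riem_dist ::
  "('m::topological_space, 'n::finite) chart set \<Rightarrow> ('m \<Rightarrow> 'v::euclidean_space) \<Rightarrow> 'm \<Rightarrow> 'm \<Rightarrow> ennreal" where
  "riem_dist A X p q =
     (INF \<gamma>\<in>{\<gamma>. piecewise_C1_curve A \<gamma> \<and> pathstart \<gamma> = p \<and> pathfinish \<gamma> = q}. riem_length X \<gamma>)"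

definition riem_complete ::
  "('m::topological_space, 'n::finite) chart set \<Rightarrow> ('m \<Rightarrow> 'v::euclidean_space) \<Rightarrow> bool" where
  "riem_complete A X \<longleftrightarrow>
     (\<forall>x :: nat \<Rightarrow> 'm.
        (\<forall>e>0. \<exists>K. \<forall>i\<ge>K. \<forall>j\<ge>K. riem_dist A X (x i) (x j) < e) \<longrightarrow>
        (\<exists>p. (\<lambda>i. riem_dist A X (x i) p) \<longlonglongrightarrow> 0))"

text \<open>
  The Riemannian volume measure is the unique Borel measure given in every chart by the
  density \<open>sqrt (det g)\<close> with respect to Lebesgue measure.
\<close>

definition riem_volume ::
  "('m::topological_space, 'n::finite) chart set \<Rightarrow> ('m \<Rightarrow> 'v::euclidean_space) \<Rightarrow> 'm measure" where
  "riem_volume A X =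
     (THE \<mu>. sets \<mu> = sets borel \<and>
        (\<forall>c\<in>A. \<forall>B\<in>sets borel. B \<subseteq> fst c \<longrightarrow>
           emeasure \<mu> B =
             (\<integral>\<^sup>+x\<in>snd c ` B. ennreal (sqrt (det (metric_matrix X c (chart_inv c x)))) \<partial>lborel)))"


subsection \<open>Mean curvature and translating solitons\<close>

definition tangent_frame ::
  "('m::topological_space, 'n::finite) chart set \<Rightarrow> ('m \<Rightarrow> real^('n + 'k::finite)) \<Rightarrow>
   'm set \<Rightarrow> ('n \<Rightarrow> 'm \<Rightarrow> real^('n + 'k)) \<Rightarrow> bool" where
  "tangent_frame A X N e \<longleftrightarrow>
     (\<forall>i. smooth_map_on A N (e i)) \<and>
     (\<forall>p\<in>N. (\<forall>i. e i p \<in> tangent_space A X p) \<and>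
            (\<forall>i j. e i p \<bullet> e j p = (if i = j then 1 else 0)))"

definition normal_frame ::
  "('m::topological_space, 'n::finite) chart set \<Rightarrow> ('m \<Rightarrow> real^('n + 'k::finite)) \<Rightarrow>
   'm set \<Rightarrow> ('k \<Rightarrow> 'm \<Rightarrow> real^('n + 'k)) \<Rightarrow> bool" where
  "normal_frame A X N \<nu> \<longleftrightarrow>
     (\<forall>\<alpha>. smooth_map_on A N (\<nu> \<alpha>)) \<and>
     (\<forall>p\<in>N. (\<forall>\<alpha>. \<nu> \<alpha> p \<in> normal_space A X p) \<and>
            (\<forall>\<alpha> \<beta>. \<nu> \<alpha> p \<bullet> \<nu> \<beta> p = (if \<alpha> = \<beta> then 1 else 0)))"

definition local_frames ::
  "('m::topological_space, 'n::finite) chart set \<Rightarrow> ('m \<Rightarrow> real^('n + 'k::finite)) \<Rightarrow>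
   'm set \<Rightarrow> ('n \<Rightarrow> 'm \<Rightarrow> real^('n + 'k)) \<Rightarrow> ('k \<Rightarrow> 'm \<Rightarrow> real^('n + 'k)) \<Rightarrow> bool" where
  "local_frames A X N e \<nu> \<longleftrightarrow> open N \<and> tangent_frame A X N e \<and> normal_frame A X N \<nu>"

definition second_ff ::
  "('m, 'n::finite) chart set \<Rightarrow> ('m \<Rightarrow> real^('n + 'k::finite)) \<Rightarrow>
   ('n \<Rightarrow> 'm \<Rightarrow> real^('n + 'k)) \<Rightarrow> ('k \<Rightarrow> 'm \<Rightarrow> real^('n + 'k)) \<Rightarrow>
   'k \<Rightarrow> 'n \<Rightarrow> 'n \<Rightarrow> 'm \<Rightarrow> real" where
  "second_ff A X e \<nu> \<alpha> i j p = dir_deriv A X (\<nu> \<alpha>) p (e i p) \<bullet> e j p"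

definition mean_curvature ::
  "('m, 'n::finite) chart set \<Rightarrow> ('m \<Rightarrow> real^('n + 'k::finite)) \<Rightarrow>
   ('n \<Rightarrow> 'm \<Rightarrow> real^('n + 'k)) \<Rightarrow> ('k \<Rightarrow> 'm \<Rightarrow> real^('n + 'k)) \<Rightarrow>
   'k \<Rightarrow> 'm \<Rightarrow> real" where
  "mean_curvature A X e \<nu> \<alpha> p = (\<Sum>j\<in>UNIV. second_ff A X e \<nu> \<alpha> j j p)"

text \<open>Local frames exist around every point, and the sum below is the same for all of them.\<close>

definition mean_curvature_vector ::
  "('m::topological_space, 'n::finite) chart set \<Rightarrow> ('m \<Rightarrow> real^('n + 'k::finite)) \<Rightarrow>
   'm \<Rightarrow> real^('n + 'k)" where
  "mean_curvature_vector A X p =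
     (THE v. \<forall>N e \<nu>. local_frames A X N e \<nu> \<and> p \<in> N \<longrightarrow>
        v = - (\<Sum>\<alpha>\<in>UNIV. mean_curvature A X e \<nu> \<alpha> p *\<^sub>R \<nu> \<alpha> p))"

definition translating_soliton ::
  "('m::topological_space, 'n::finite) chart set \<Rightarrow> ('m \<Rightarrow> real^('n + 'k::finite)) \<Rightarrow>
   real^('n + 'k) \<Rightarrow> bool" where
  "translating_soliton A X W \<longleftrightarrow>
     (\<forall>N e \<nu>. local_frames A X N e \<nu> \<longrightarrow>
        (\<forall>p\<in>N. \<forall>\<alpha>. mean_curvature A X e \<nu> \<alpha> p = \<nu> \<alpha> p \<bullet> W))"

definition soliton_measure ::
  "('m::topological_space, 'n::finite) chart set \<Rightarrow> ('m \<Rightarrow> 'v::euclidean_space) \<Rightarrow> 'v \<Rightarrow> 'm measure" where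
  "soliton_measure A X W = density (riem_volume A X) (\<lambda>p. ennreal (exp (- (X p \<bullet> W))))"

end

theory Submission
  imports Defs
begin

text \<open>
  For a translating soliton the mean curvature vector is minus the normal part of \<^term>\<open>W\<close>, so the tangential
  part \<open>T\<close> of \<^term>\<open>W\<close>, which is the gradient of \<open>S\<close>, satisfies \<open>div T = - |W - T|\<^sup>2\<close> and
  \<open>|T|\<^sup>2 = 1 - |H|\<^sup>2 \<ge> \<delta> > 0\<close>. Applying the divergence theorem to \<open>f T\<close>, where
  \<open>f = \<phi> exp ((a - 1) S)\<close> and \<open>\<phi>\<close> is a cutoff function of \<open>|X|\<close> decreasing from \<open>1\<close> at \<open>s\<close> to \<open>0\<close>
  at \<open>s + h\<close>, gives \<open>(a \<delta> - 1) G(s) \<le> (4 / h) (G(s + h) - G(s))\<close> for \<open>G(R) = \<integral>\<^bsub>M\<^sub>R\<^esub> u dm\<close>. For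
  \<open>a \<delta> \<ge> 5\<close> this says \<open>G(s + h) \<ge> (1 + h) G(s)\<close>; iterating it with steps \<open>h = (R - R\<^sub>0) / n\<close> and
  letting \<open>n\<close> tend to infinity yields the exponential growth with \<open>\<epsilon> = 1\<close>.
\<close>


section \<open>Calculus of \<open>C\<^sup>k\<close> maps\<close>

text \<open>\<open>G\<close> is monotone, but its derivative would involve integrals over level sets
  of |X|. The argument therefore compares \<open>s\<close> with \<open>s + h\<close> directly, and
  the cutoff bound 4 / h has to be uniform in \<open>s\<close>; it comes from the maximal slope 2 of
  the spline. The threshold 5 makes a \<delta> - 1 at least 4, so that both factors 4 cancel and the
  rate is exactly 1. Properness makes preimages of closed balls compact, so \<open>f\<close> has
  compact support and \<open>G\<close> is finite. The cutoff is only C^1, which suffices because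
  \<open>f T\<close> is differentiated once. The soliton equation is stated for local frames, while
  integration takes place in charts. Hence \<open>T\<close> is written without frames, by Cramer's
  rule, and adapted orthonormal frames are built only to bring the soliton equation into a chart.
  The divergence theorem itself rests on one fact about R^n: a directional derivative of a compactly
  supported C^1 function integrates to zero. Bump functions split \<open>f\<close> into pieces that
  each live in one chart, where this fact applies.\<close>

lemma Ck_on_cong:
  assumes "open S" "\<And>x. x \<in> S \<Longrightarrow> f x = g x"
  shows "Ck_on r S f = Ck_on r S g"
  using assms(2)
proof (induction r arbitrary: f g)
  case 0
  then show ?case by (auto intro: continuous_on_cong)
next
  case (Suc r)
  \<comment> \<open>The implication is shown for arbitrary \<open>u\<close> and \<open>v\<close>, so
    both directions of the equivalence are instances of it.\<close>
  have imp: "Ck_on (Suc r) S v" if eq: "\<And>x. x \<in> S \<Longrightarrow> u x = v x" and u: "Ck_on (Suc r) S u"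
    for u v :: "'a \<Rightarrow> 'b"
  proof -
    have d: "v differentiable at x" if x: "x \<in> S" for x
    proof -
      obtain D where "(u has_derivative D) (at x)"
        using u x by (auto simp: differentiable_def)
      then have "(v has_derivative D) (at x)"
        by (rule has_derivative_transform_within_open[OF _ assms(1) x]) (rule eq)
      then show ?thesis by (auto simp: differentiable_def)
    qed
    have "frechet_derivative u (at x) w = frechet_derivative v (at x) w" if "x \<in> S" for x w
      using frechet_derivative_transform_within_open[of u x S v] u that eq assms(1) by auto
    then have "Ck_on r S (\<lambda>x. frechet_derivative v (at x) w)" for w
      using Suc.IH[of "\<lambda>x. frechet_derivative u (at x) w" "\<lambda>x. frechet_derivative v (at x) w"] u
      by auto
    with d show ?thesis by auto
  qed
  show ?case
    using imp[of f g] imp[of g f] Suc.prems by (auto simp del: Ck_on.simps)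
qed

lemma Ck_on_subset: "Ck_on r S f \<Longrightarrow> T \<subseteq> S \<Longrightarrow> Ck_on r T f"
  by (induction r arbitrary: f) (auto intro: continuous_on_subset)

lemma Ck_on_Suc_imp: "Ck_on (Suc r) S f \<Longrightarrow> Ck_on r S f"
proof (induction r arbitrary: f)
  case 0
  then show ?case
    by (auto intro!: continuous_at_imp_continuous_on differentiable_imp_continuous_within)
next
  case (Suc r)
  then show ?case by (metis Ck_on.simps(2))
qed

lemma Ck_on_mono: "Ck_on r S f \<Longrightarrow> q \<le> r \<Longrightarrow> Ck_on q S f"
  by (induction r) (auto simp: le_Suc_eq dest: Ck_on_Suc_imp simp del: Ck_on.simps)

lemma Ck_on_imp_continuous_on: "Ck_on r S f \<Longrightarrow> continuous_on S f"
  using Ck_on_mono[of r S f 0] by simp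

text \<open>Every clause of \<open>Ck_on\<close> concerns the behaviour at single points, so it can
  be checked in a neighbourhood of each. This glues functions that are defined by cases, such as
  extensions by zero.\<close>

lemma Ck_on_local:
  assumes "\<And>x. x \<in> S \<Longrightarrow> \<exists>T. open T \<and> x \<in> T \<and> Ck_on r T f"
  shows "Ck_on r S f"
  using assms
proof (induction r arbitrary: f)
  case 0
  have "isCont f x" if x: "x \<in> S" for x
    using 0[OF x] by (auto simp: continuous_on_eq_continuous_at)
  then show ?case by (simp add: continuous_at_imp_continuous_on)
next
  case (Suc r)
  then show ?case by (metis Ck_on.simps(2))
qed

text \<open>Uniqueness of derivatives identifies an explicitly given \<open>f'\<close> with
  \<open>frechet_derivative\<close> on the open set \<open>S\<close>, so regularity proofs can work
  with closed formulas.\<close>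

lemma Ck_on_SucI:
  assumes "open S" "\<And>x. x \<in> S \<Longrightarrow> (f has_derivative f' x) (at x)"
    and "\<And>v. Ck_on r S (\<lambda>x. f' x v)"
  shows "Ck_on (Suc r) S f"
proof -
  have "frechet_derivative f (at x) = f' x" if "x \<in> S" for x
    using assms(2)[OF that] by (metis frechet_derivative_at)
  then have "Ck_on r S (\<lambda>x. frechet_derivative f (at x) v)" for v
    using Ck_on_cong[OF assms(1), of "\<lambda>x. frechet_derivative f (at x) v" "\<lambda>x. f' x v" r] assms(3)
    by auto
  with assms(2) show ?thesis by (auto simp: differentiable_def)
qed

lemma Ck_on_Suc_has_derivative:
  "Ck_on (Suc r) S f \<Longrightarrow> x \<in> S \<Longrightarrow> (f has_derivative frechet_derivative f (at x)) (at x)"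
  by (simp add: frechet_derivative_works[symmetric])

section \<open>Closure of C^k maps under algebraic operations and composition\<close>

lemma Ck_on_const [simp]: "Ck_on r S (\<lambda>x. c)"
  by (induction r arbitrary: c) auto

lemma Ck_on_ident [simp]: "Ck_on r S (\<lambda>x. x)"
  by (cases r) auto

lemma Ck_on_bounded_linear:
  assumes "bounded_linear L" "open S"
  shows "Ck_on r S f \<Longrightarrow> Ck_on r S (\<lambda>x. L (f x))"
proof (induction r arbitrary: f)
  case 0
  then show ?case
    using assms by (auto intro: bounded_linear.continuous_on)
next
  case (Suc r)
  show ?case
  proof (rule Ck_on_SucI[OF assms(2)])
    show "((\<lambda>x. L (f x)) has_derivative (\<lambda>v. L (frechet_derivative f (at x) v))) (at x)"
      if "x \<in> S" for x
      using bounded_linear.has_derivative[OF assms(1) Ck_on_Suc_has_derivative[OF Suc.prems that]] .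
  qed (use Suc in auto)
qed

lemma Ck_on_add:
  assumes "open S"
  shows "Ck_on r S f \<Longrightarrow> Ck_on r S g \<Longrightarrow> Ck_on r S (\<lambda>x. f x + g x)"
proof (induction r arbitrary: f g)
  case 0
  then show ?case by (auto intro: continuous_intros)
next
  case (Suc r)
  show ?case
  proof (rule Ck_on_SucI[OF assms])
    show "((\<lambda>x. f x + g x) has_derivative
        (\<lambda>v. frechet_derivative f (at x) v + frechet_derivative g (at x) v)) (at x)" if "x \<in> S" for x
      using that Suc.prems by (intro has_derivative_add Ck_on_Suc_has_derivative)
  qed (use Suc in auto)
qed

lemma Ck_on_bilinear:
  assumes b: "bounded_bilinear B" and "open S"
  shows "Ck_on r S f \<Longrightarrow> Ck_on r S g \<Longrightarrow> Ck_on r S (\<lambda>x. B (f x) (g x))"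
proof (induction r arbitrary: f g)
  case 0
  then show ?case by (auto intro: bounded_bilinear.continuous_on[OF b])
next
  case (Suc r)
  show ?case
  proof (rule Ck_on_SucI[OF assms(2)])
    show "((\<lambda>x. B (f x) (g x)) has_derivative
        (\<lambda>v. B (f x) (frechet_derivative g (at x) v) + B (frechet_derivative f (at x) v) (g x)))
        (at x)" if "x \<in> S" for x
      using that Suc.prems by (intro bounded_bilinear.FDERIV[OF b] Ck_on_Suc_has_derivative)
    show "Ck_on r S (\<lambda>x. B (f x) (frechet_derivative g (at x) v)
        + B (frechet_derivative f (at x) v) (g x))" for v
    proof (intro Ck_on_add[OF assms(2)] Suc.IH)
      show "Ck_on r S f" "Ck_on r S g"
        using Suc.prems Ck_on_Suc_imp by blast+
    qed (use Suc in auto)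
  qed
qed

lemmas Ck_on_scaleR = Ck_on_bilinear[OF bounded_bilinear_scaleR]
lemmas Ck_on_mult = Ck_on_bilinear[OF bounded_bilinear_mult]
lemmas Ck_on_inner = Ck_on_bilinear[OF bounded_bilinear_inner]
lemmas Ck_on_minus = Ck_on_bounded_linear[OF bounded_linear_minus[OF bounded_linear_ident]]

lemma Ck_on_diff:
  assumes "open S" "Ck_on r S f" "Ck_on r S g"
  shows "Ck_on r S (\<lambda>x. f x - g x)"
  using Ck_on_add[OF assms(1,2) Ck_on_minus[OF assms(1,3)]] by simp

lemma Ck_on_sum:
  assumes "open S" "\<And>i. i \<in> I \<Longrightarrow> Ck_on r S (f i)"
  shows "Ck_on r S (\<lambda>x. \<Sum>i\<in>I. f i x)"
  using assms(2)
  by (induction I rule: infinite_finite_induct) (auto intro: Ck_on_add[OF assms(1)])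

lemma Ck_on_prod:
  fixes f :: "'i \<Rightarrow> 'a::real_normed_vector \<Rightarrow> real"
  assumes "open S" "\<And>i. i \<in> I \<Longrightarrow> Ck_on r S (f i)"
  shows "Ck_on r S (\<lambda>x. \<Prod>i\<in>I. f i x)"
  using assms(2)
  by (induction I rule: infinite_finite_induct) (auto intro: Ck_on_mult[OF assms(1)])

lemma Ck_on_det:
  fixes a :: "'n::finite \<Rightarrow> 'n \<Rightarrow> 'a::real_normed_vector \<Rightarrow> real"
  assumes "open S" "\<And>i j. Ck_on r S (a i j)"
  shows "Ck_on r S (\<lambda>x. det (\<chi> i j. a i j x))"
  unfolding det_def
  by (auto intro!: Ck_on_sum Ck_on_mult Ck_on_prod assms)

lemma Ck_on_compose:
  fixes f :: "'a::real_normed_vector \<Rightarrow> 'b::euclidean_space"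
    and g :: "'b \<Rightarrow> 'c::real_normed_vector"
  assumes S: "open S" and T: "open T" and im: "\<And>x. x \<in> S \<Longrightarrow> f x \<in> T"
  shows "Ck_on r S f \<Longrightarrow> Ck_on r T g \<Longrightarrow> Ck_on r S (\<lambda>x. g (f x))"
proof (induction r arbitrary: g)
  case 0
  then show ?case
    using im by (auto intro: continuous_on_compose2)
next
  case (Suc r)
  let ?f' = "\<lambda>x. frechet_derivative f (at x)" and ?g' = "\<lambda>y. frechet_derivative g (at y)"
  show ?case
  proof (rule Ck_on_SucI[OF S])
    fix x assume x: "x \<in> S"
    have lin: "linear (?g' (f x))"
      using Suc.prems(2) im[OF x] by (auto intro: linear_frechet_derivative)
    have "((\<lambda>x. g (f x)) has_derivative (\<lambda>v. ?g' (f x) (?f' x v))) (at x)"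
      using Ck_on_Suc_has_derivative[OF Suc.prems(1) x] Ck_on_Suc_has_derivative[OF Suc.prems(2) im[OF x]]
      by (rule has_derivative_compose)
    \<comment> \<open>In the chain rule the direction fed into \<open>?g'\<close> varies with
      \<open>x\<close>, whereas \<open>Ck_on\<close> speaks of fixed directions. Expanding in
      \<open>Basis\<close> leaves only fixed directions \<open>b\<close>, to which the induction
      hypothesis applies.\<close>
    moreover have "?g' (f x) (?f' x v) = (\<Sum>b\<in>Basis. (?f' x v \<bullet> b) *\<^sub>R ?g' (f x) b)" for v
    proof -
      have "?g' (f x) (?f' x v) = ?g' (f x) (\<Sum>b\<in>Basis. (?f' x v \<bullet> b) *\<^sub>R b)"
        by (simp add: euclidean_representation)
      then show ?thesis
        using lin by (simp add: linear_sum linear_cmul)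
    qed
    ultimately show "((\<lambda>x. g (f x)) has_derivative
        (\<lambda>v. \<Sum>b\<in>Basis. (?f' x v \<bullet> b) *\<^sub>R ?g' (f x) b)) (at x)"
      by simp
  next
    fix v
    show "Ck_on r S (\<lambda>x. \<Sum>b\<in>Basis. (?f' x v \<bullet> b) *\<^sub>R ?g' (f x) b)"
    proof (intro Ck_on_sum[OF S] Ck_on_scaleR[OF S] Ck_on_inner[OF S])
      show "Ck_on r S (\<lambda>x. ?g' (f x) b)" for b
        using Suc.IH[of "\<lambda>y. ?g' y b"] Suc.prems Ck_on_Suc_imp by auto
    qed (use Suc.prems in auto)
  qed
qed

section \<open>Real functions: inverse, square root, exponential, and quotients\<close>

lemma Ck_on_SucI_real:
  fixes f :: "real \<Rightarrow> real"
  assumes "open S" "\<And>x. x \<in> S \<Longrightarrow> (f has_real_derivative f' x) (at x)" "Ck_on r S f'"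
  shows "Ck_on (Suc r) S f"
  using assms by (intro Ck_on_SucI[where f' = "\<lambda>x v. f' x * v"])
    (auto simp: has_field_derivative_def intro!: Ck_on_mult)

text \<open>The derivative is a polynomial in the function itself, so the induction hypothesis
  already gives its regularity.\<close>

lemma Ck_on_inverse_real: "Ck_on r (- {0}) (inverse :: real \<Rightarrow> real)"
proof (induction r)
  case 0
  then show ?case by (auto intro!: continuous_intros)
next
  case (Suc r)
  show ?case
  proof (rule Ck_on_SucI_real[where f' = "\<lambda>x. - (inverse x * inverse x)"])
    show "(inverse has_real_derivative - (inverse x * inverse x)) (at x)" if "x \<in> - {0}" for x :: real
      using DERIV_inverse[of x UNIV] that by (simp add: power2_eq_square)
    show "Ck_on r (- {0}) (\<lambda>x::real. - (inverse x * inverse x))"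
      by (intro Ck_on_minus Ck_on_mult Suc) auto
  qed auto
qed

lemma Ck_on_sqrt: "Ck_on r {0<..} sqrt"
proof (induction r)
  case 0
  then show ?case by (auto intro!: continuous_intros)
next
  case (Suc r)
  show ?case
  proof (rule Ck_on_SucI_real[where f' = "\<lambda>x. inverse (sqrt x) * (1 / 2)"])
    show "(sqrt has_real_derivative inverse (sqrt x) * (1 / 2)) (at x)" if "x \<in> {0<..}" for x
      using DERIV_real_sqrt[of x] that by simp
    have "Ck_on r {0<..} (\<lambda>x. inverse (sqrt x))"
      by (rule Ck_on_compose[where T="- {0}", OF _ _ _ Suc Ck_on_inverse_real]) auto
    then show "Ck_on r {0<..} (\<lambda>x. inverse (sqrt x) * (1 / 2))"
      by (intro Ck_on_mult) auto
  qed auto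
qed

lemma Ck_on_exp: "Ck_on r UNIV (exp :: real \<Rightarrow> real)"
proof (induction r)
  case 0
  then show ?case by (auto intro: continuous_on_exp)
next
  case (Suc r)
  then show ?case by (intro Ck_on_SucI_real[where f' = exp]) auto
qed

lemma Ck_on_divide:
  fixes f g :: "'a::real_normed_vector \<Rightarrow> real"
  assumes "open S" "Ck_on r S f" "Ck_on r S g" "\<And>x. x \<in> S \<Longrightarrow> g x \<noteq> 0"
  shows "Ck_on r S (\<lambda>x. f x / g x)"
proof -
  have "Ck_on r S (\<lambda>x. inverse (g x))"
    by (rule Ck_on_compose[where T="- {0}", OF assms(1) _ _ assms(3) Ck_on_inverse_real]) (use assms in auto)
  with assms show ?thesis
    unfolding divide_inverse by (intro Ck_on_mult)
qed

lemma Ck_on_sqrt_compose: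
  assumes "open S" "Ck_on r S f" "\<And>x. x \<in> S \<Longrightarrow> f x > 0"
  shows "Ck_on r S (\<lambda>x. sqrt (f x))"
  by (rule Ck_on_compose[where T="{0<..}", OF assms(1) _ _ assms(2) Ck_on_sqrt]) (use assms in auto)

lemma Ck_on_partial:
  assumes "Ck_on (Suc r) S f"
  shows "Ck_on r S (\<lambda>x. frechet_derivative f (at x) v)"
  using assms by simp

lemma smooth_onD: "smooth_on S f \<Longrightarrow> Ck_on r S f"
  by (simp add: smooth_on_def)

section \<open>Second derivatives and determinants\<close>

lemma has_real_derivative_along_line:
  fixes f :: "'a::real_normed_vector \<Rightarrow> real"
  assumes "(f has_derivative f') (at (p + s *\<^sub>R u))"
  shows "((\<lambda>s. f (p + s *\<^sub>R u)) has_real_derivative f' u) (at s)"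
proof -
  have 1: "((\<lambda>s. p + s *\<^sub>R u) has_derivative (\<lambda>s. s *\<^sub>R u)) (at s)"
    by (auto intro!: derivative_eq_intros)
  have "((\<lambda>s. f (p + s *\<^sub>R u)) has_derivative (\<lambda>s. f' (s *\<^sub>R u))) (at s)"
    by (rule has_derivative_compose[OF 1 assms])
  moreover have "f' (s *\<^sub>R u) = f' u * s" for s
    using linear_cmul[OF has_derivative_linear[OF assms]] by simp
  ultimately show ?thesis
    by (simp add: has_field_derivative_def)
qed

text \<open>The mean value theorem is used twice: in direction \<open>u\<close> for the increment of
  \<open>f\<close> across \<open>t *\<^sub>R v\<close>, then in direction \<open>v\<close> for the
  resulting difference of first derivatives.\<close>

lemma second_difference_eq:
  fixes f :: "'a::real_normed_vector \<Rightarrow> real"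
  assumes t: "0 < t" and sub: "ball x r \<subseteq> S" and tr: "t * (norm u + norm v) < r"
    and D: "\<And>y. y \<in> S \<Longrightarrow> (f has_derivative D y) (at y)"
    and DD: "\<And>y. y \<in> S \<Longrightarrow> ((\<lambda>y. D y u) has_derivative E y) (at y)"
  shows "\<exists>p. dist x p \<le> t * (norm u + norm v) \<and>
    f (x + t *\<^sub>R u + t *\<^sub>R v) - f (x + t *\<^sub>R u) - f (x + t *\<^sub>R v) + f x = t * t * E p v"
proof -
  have dist_w: "dist x (x + w) = norm w" for w
    by (simp add: dist_norm)
  have dst: "dist x (x + s1 *\<^sub>R u + s2 *\<^sub>R v) \<le> t * (norm u + norm v)"
    if "0 \<le> s1" "s1 \<le> t" "0 \<le> s2" "s2 \<le> t" for s1 s2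
  proof -
    have "dist x (x + s1 *\<^sub>R u + s2 *\<^sub>R v) = norm (s1 *\<^sub>R u + s2 *\<^sub>R v)"
      using dist_w[of "s1 *\<^sub>R u + s2 *\<^sub>R v"] by (simp add: add.assoc)
    also have "\<dots> \<le> s1 * norm u + s2 * norm v"
      using norm_triangle_ineq[of "s1 *\<^sub>R u" "s2 *\<^sub>R v"] that by simp
    also have "\<dots> \<le> t * norm u + t * norm v"
      using that by (intro add_mono mult_right_mono) auto
    finally show ?thesis by (simp add: algebra_simps)
  qed
  have inS: "x + s1 *\<^sub>R u + s2 *\<^sub>R v \<in> S" if "0 \<le> s1" "s1 \<le> t" "0 \<le> s2" "s2 \<le> t" for s1 s2
    using dst[OF that] tr sub by force
  let ?g = "\<lambda>s. f (x + t *\<^sub>R v + s *\<^sub>R u) - f (x + s *\<^sub>R u)"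
  have g': "(?g has_real_derivative D (x + t *\<^sub>R v + s *\<^sub>R u) u - D (x + s *\<^sub>R u) u) (at s)"
    if "0 \<le> s" "s \<le> t" for s
  proof -
    have "x + t *\<^sub>R v + s *\<^sub>R u \<in> S" "x + s *\<^sub>R u \<in> S"
      using inS[of s t] inS[of s 0] that t by (auto simp: algebra_simps)
    from this[THEN D, THEN has_real_derivative_along_line] show ?thesis
      by (rule DERIV_diff)
  qed
  obtain s where s: "0 < s" "s < t"
    and gs: "?g t - ?g 0 = (t - 0) * (D (x + t *\<^sub>R v + s *\<^sub>R u) u - D (x + s *\<^sub>R u) u)"
    using MVT2[of 0 t ?g "\<lambda>s. D (x + t *\<^sub>R v + s *\<^sub>R u) u - D (x + s *\<^sub>R u) u"] g' t by auto
  let ?k = "\<lambda>r. D (x + s *\<^sub>R u + r *\<^sub>R v) u"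
  have k': "(?k has_real_derivative E (x + s *\<^sub>R u + r *\<^sub>R v) v) (at r)" if "0 \<le> r" "r \<le> t" for r
    using that s inS[of s r] by (intro has_real_derivative_along_line[of "\<lambda>y. D y u"] DD) auto
  obtain q where q: "0 < q" "q < t"
    and kq: "?k t - ?k 0 = (t - 0) * E (x + s *\<^sub>R u + q *\<^sub>R v) v"
    using MVT2[of 0 t ?k "\<lambda>r. E (x + s *\<^sub>R u + r *\<^sub>R v) v"] k' t by auto
  have "f (x + t *\<^sub>R u + t *\<^sub>R v) - f (x + t *\<^sub>R u) - f (x + t *\<^sub>R v) + f x
      = t * t * E (x + s *\<^sub>R u + q *\<^sub>R v) v"
    using gs kq by (simp add: algebra_simps)
  with dst[of s q] s q show ?thesis by auto
qed

text \<open>The second difference is symmetric in \<open>u\<close> and \<open>v\<close>, so the two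
  mixed derivatives agree at a pair of points \<open>p\<close>, \<open>q\<close> near
  \<open>x\<close>; continuity of both at \<open>x\<close> then forces equality there.\<close>

lemma mixed_partials_commute_real:
  fixes f :: "'a::real_normed_vector \<Rightarrow> real"
  assumes "open S" "Ck_on 2 S f" "x \<in> S"
  shows "frechet_derivative (\<lambda>y. frechet_derivative f (at y) u) (at x) v
       = frechet_derivative (\<lambda>y. frechet_derivative f (at y) v) (at x) u"
    (is "?E u v x = ?E v u x")
proof -
  have C2: "Ck_on (Suc (Suc 0)) S f"
    using assms(2) by (simp only: numeral_2_eq_2)
  have D: "(f has_derivative frechet_derivative f (at y)) (at y)" if "y \<in> S" for y
    by (rule Ck_on_Suc_has_derivative[OF C2 that])
  have C1: "Ck_on (Suc 0) S (\<lambda>y. frechet_derivative f (at y) w)" for w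
    by (rule Ck_on_partial[OF C2])
  have DD: "((\<lambda>y. frechet_derivative f (at y) w) has_derivative
      frechet_derivative (\<lambda>y. frechet_derivative f (at y) w) (at y)) (at y)" if "y \<in> S" for y w
    by (rule Ck_on_Suc_has_derivative[OF C1 that])
  have cont: "isCont (?E w z) x" for w z
    using Ck_on_partial[OF C1[of w], of z] assms(1,3) by (simp add: continuous_on_eq_continuous_at)
  obtain r where r: "r > 0" "ball x r \<subseteq> S"
    using assms(1,3) openE by blast
  have "\<bar>?E u v x - ?E v u x\<bar> \<le> e" if e: "e > 0" for e
  proof -
    have "\<exists>d>0. \<forall>p. dist x p < d \<longrightarrow> \<bar>?E w z p - ?E w z x\<bar> < e / 2" for w z
      using cont[of w z] e unfolding continuous_at_eps_delta
      by (metis dist_commute dist_real_def half_gt_zero)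
    then obtain d1 d2 where d: "d1 > 0" "d2 > 0"
      and d1: "\<And>p. dist x p < d1 \<Longrightarrow> \<bar>?E u v p - ?E u v x\<bar> < e / 2"
      and d2: "\<And>p. dist x p < d2 \<Longrightarrow> \<bar>?E v u p - ?E v u x\<bar> < e / 2"
      by metis
    define m where "m = min r (min d1 d2)"
    \<comment> \<open>The summand 1 avoids division by zero and makes
      \<open>t * (norm u + norm v)\<close> strictly smaller than \<open>m\<close>.\<close>
    define t where "t = m / (norm u + norm v + 1)"
    have m: "m > 0" using r d by (simp add: m_def)
    have np: "norm u + norm v + 1 > 0"
      using norm_ge_zero[of u] norm_ge_zero[of v] by linarith
    have t: "t > 0" using m np by (simp add: t_def)
    have "t * (norm u + norm v) < t * (norm u + norm v + 1)"
      using t by simp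
    also have "\<dots> = m" using np by (simp add: t_def)
    finally have tm: "t * (norm u + norm v) < m" .
    then have tr: "t * (norm u + norm v) < r" by (simp add: m_def)
    obtain p where p: "dist x p \<le> t * (norm u + norm v)"
      "f (x + t *\<^sub>R u + t *\<^sub>R v) - f (x + t *\<^sub>R u) - f (x + t *\<^sub>R v) + f x = t * t * ?E u v p"
      using second_difference_eq[OF t r(2) tr D DD] by blast
    obtain q where q: "dist x q \<le> t * (norm v + norm u)"
      "f (x + t *\<^sub>R v + t *\<^sub>R u) - f (x + t *\<^sub>R v) - f (x + t *\<^sub>R u) + f x = t * t * ?E v u q"
      using second_difference_eq[OF t r(2) _ D DD, of v u] tr by (auto simp: add.commute)
    have "t * t * ?E u v p = t * t * ?E v u q"
      using p(2) q(2) by (simp add: algebra_simps)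
    then have eq: "?E u v p = ?E v u q" using t by simp
    have "dist x p < d1" "dist x q < d2"
      using p(1) q(1) tm by (auto simp: m_def add.commute)
    from d1[OF this(1)] d2[OF this(2)] eq show ?thesis by linarith
  qed
  then have "\<bar>?E u v x - ?E v u x\<bar> \<le> 0" by (rule field_le_epsilon) simp
  then show ?thesis by simp
qed

lemma mixed_partials_commute:
  fixes f :: "'a::real_normed_vector \<Rightarrow> 'b::euclidean_space"
  assumes "open S" "Ck_on 2 S f" "x \<in> S"
  shows "frechet_derivative (\<lambda>y. frechet_derivative f (at y) u) (at x) v
       = frechet_derivative (\<lambda>y. frechet_derivative f (at y) v) (at x) u"
proof (rule euclidean_eqI)
  fix b :: 'b
  have C2: "Ck_on (Suc (Suc 0)) S f"
    using assms(2) by (simp only: numeral_2_eq_2)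
  have 1: "frechet_derivative (\<lambda>y. g y \<bullet> b) (at y) = (\<lambda>w. frechet_derivative g (at y) w \<bullet> b)"
    if "(g has_derivative frechet_derivative g (at y)) (at y)" for g :: "'a \<Rightarrow> 'b" and y
    using has_derivative_inner_left[OF that, of b] frechet_derivative_at by (metis (no_types))
  have 2: "frechet_derivative (\<lambda>y. frechet_derivative (\<lambda>y. f y \<bullet> b) (at y) u) (at x) v
      = frechet_derivative (\<lambda>y. frechet_derivative f (at y) u) (at x) v \<bullet> b" for u v
  proof -
    have C1: "Ck_on (Suc 0) S (\<lambda>y. frechet_derivative f (at y) u)"
      by (rule Ck_on_partial[OF C2])
    have "frechet_derivative (\<lambda>y. frechet_derivative f (at y) u \<bullet> b) (at x)
        = frechet_derivative (\<lambda>y. frechet_derivative (\<lambda>y. f y \<bullet> b) (at y) u) (at x)"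
    proof (rule frechet_derivative_transform_within_open[OF _ assms(1,3)])
      show "(\<lambda>y. frechet_derivative f (at y) u \<bullet> b) differentiable at x"
        using has_derivative_inner_left[OF Ck_on_Suc_has_derivative[OF C1 assms(3)]]
        by (auto simp: differentiable_def)
      show "frechet_derivative f (at y) u \<bullet> b = frechet_derivative (\<lambda>y. f y \<bullet> b) (at y) u"
        if "y \<in> S" for y
        using 1[OF Ck_on_Suc_has_derivative[OF C2 that]] by simp
    qed
    then show ?thesis
      using 1[OF Ck_on_Suc_has_derivative[OF C1 assms(3)]] by (metis (no_types))
  qed
  have "Ck_on 2 S (\<lambda>y. f y \<bullet> b)"
    by (rule Ck_on_bounded_linear[OF bounded_linear_inner_left assms(1,2)])
  from mixed_partials_commute_real[OF assms(1) this assms(3), of u v]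
  show "frechet_derivative (\<lambda>y. frechet_derivative f (at y) u) (at x) v \<bullet> b
      = frechet_derivative (\<lambda>y. frechet_derivative f (at y) v) (at x) u \<bullet> b"
    unfolding 2 .
qed

text \<open>A permutation other than the identity moves at least two points. Even after the product
  rule has removed one factor, an off-diagonal entry of the identity matrix remains, so only the
  identity permutation contributes.\<close>

lemma has_derivative_det_at_1:
  fixes A :: "'a::real_normed_vector \<Rightarrow> real^'n^'n"
  assumes "\<And>i j. ((\<lambda>x. A x $ i $ j) has_derivative (\<lambda>v. A' v $ i $ j)) (at x)"
    and 1: "A x = mat 1"
  shows "((\<lambda>x. det (A x)) has_derivative (\<lambda>v. trace (A' v))) (at x)"
proof -
  let ?P = "{p. p permutes (UNIV :: 'n set)}"
  have "((\<lambda>x. det (A x)) has_derivative (\<lambda>v. \<Sum>p\<in>?P. of_int (sign p) *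
      (\<Sum>i\<in>UNIV. A' v $ i $ p i * (\<Prod>j\<in>UNIV - {i}. A x $ j $ p j)))) (at x)"
    unfolding det_def
    by (intro has_derivative_sum has_derivative_mult_right has_derivative_prod assms)
  moreover have "(\<Sum>p\<in>?P. of_int (sign p) *
      (\<Sum>i\<in>UNIV. A' v $ i $ p i * (\<Prod>j\<in>UNIV - {i}. A x $ j $ p j))) = trace (A' v)" for v
  proof -
    have 0: "(\<Prod>j\<in>UNIV - {i}. A x $ j $ p j) = 0" if p: "p permutes UNIV" "p \<noteq> id" for p :: "'n \<Rightarrow> 'n" and i
    proof -
      obtain k where k: "p k \<noteq> k" using p(2) by (auto simp: fun_eq_iff)
      then have "p (p k) \<noteq> p k" using permutes_inj[OF p(1)] by (metis injD)
      with k obtain l where l: "l \<noteq> i" "p l \<noteq> l" by metis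
      then have "A x $ l $ p l = 0" using 1 by (auto simp: mat_def)
      with l(1) show ?thesis by (intro prod_zero) auto
    qed
    have "(\<Sum>p\<in>?P. of_int (sign p) *
        (\<Sum>i\<in>UNIV. A' v $ i $ p i * (\<Prod>j\<in>UNIV - {i}. A x $ j $ p j)))
      = (\<Sum>p\<in>{id}. of_int (sign p) *
        (\<Sum>i\<in>UNIV. A' v $ i $ p i * (\<Prod>j\<in>UNIV - {i}. A x $ j $ p j)))"
      by (intro sum.mono_neutral_right) (auto simp: finite_permutations permutes_id 0 simp del: prod_zero_iff)
    then show ?thesis
      by (simp add: trace_def 1 mat_def)
  qed
  ultimately show ?thesis by simp
qed

text \<open>Jacobi's formula. Since \<open>B\<close> inverts \<open>A x\<close>,
  \<open>det (A y) = det (A x) * det (B ** A y)\<close>, which moves the base point to the identity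
  matrix.\<close>

lemma has_derivative_det:
  fixes A :: "'a::real_normed_vector \<Rightarrow> real^'n^'n"
  assumes A': "\<And>i j. ((\<lambda>x. A x $ i $ j) has_derivative (\<lambda>v. A' v $ i $ j)) (at x)"
    and B: "B ** A x = mat 1"
  shows "((\<lambda>x. det (A x)) has_derivative (\<lambda>v. det (A x) * trace (B ** A' v))) (at x)"
proof -
  have "((\<lambda>y. det (B ** A y)) has_derivative (\<lambda>v. trace (B ** A' v))) (at x)"
  proof (rule has_derivative_det_at_1[where A = "\<lambda>y. B ** A y"])
    show "((\<lambda>y. (B ** A y) $ i $ j) has_derivative (\<lambda>v. (B ** A' v) $ i $ j)) (at x)" for i j
      unfolding matrix_matrix_mult_def
      by (auto intro!: has_derivative_sum has_derivative_mult_right A')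
  qed (rule B)
  then have "((\<lambda>y. det (A x) * det (B ** A y)) has_derivative (\<lambda>v. det (A x) * trace (B ** A' v))) (at x)"
    by (rule has_derivative_mult_right)
  moreover have "det (A x) * det (B ** A y) = det (A y)" for y
  proof -
    have "det B * det (A x) = 1" using B by (metis det_I det_mul)
    then show ?thesis by (simp add: det_mul mult.assoc[symmetric] mult.commute)
  qed
  ultimately show ?thesis by simp
qed

section \<open>Change of variables\<close>

text \<open>
  The change of variables theorem of the library requires a wellordered index type. It is transported
  to arbitrary finite index types along this wellordered copy.
\<close>

typedef 'n wellordered = "UNIV :: 'n set" by simp

instance wellordered :: (finite) finite
proof
  have "(UNIV :: 'a wellordered set) = range Abs_wellordered"
    by (metis Rep_wellordered_inverse surj_def)
  then show "finite (UNIV :: 'a wellordered set)"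
    by (metis finite finite_imageI)
qed

text \<open>Any injection into the naturals serves: the order is only a carrier for the class
  \<open>wellorder\<close>, and no result depends on which one is chosen.\<close>

definition wo_index :: "'n::finite wellordered \<Rightarrow> nat" where
  "wo_index = (SOME f. inj f)"

lemma inj_wo_index: "inj (wo_index :: 'n::finite wellordered \<Rightarrow> nat)"
proof -
  have "\<exists>f :: 'n wellordered \<Rightarrow> nat. inj f"
    using finite_imp_inj_to_nat_seg[OF finite[of "UNIV :: 'n wellordered set"]] by blast
  then show ?thesis unfolding wo_index_def by (rule someI_ex)
qed

instantiation wellordered :: (finite) wellorder
begin

definition less_eq_wellordered :: "'a wellordered \<Rightarrow> 'a wellordered \<Rightarrow> bool" where
  "x \<le> y \<longleftrightarrow> wo_index x \<le> wo_index y"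

definition less_wellordered :: "'a wellordered \<Rightarrow> 'a wellordered \<Rightarrow> bool" where
  "x < y \<longleftrightarrow> wo_index x < wo_index y"

instance
proof
  fix P :: "'a wellordered \<Rightarrow> bool" and a
  assume step: "\<And>x. (\<And>y. y < x \<Longrightarrow> P y) \<Longrightarrow> P x"
  show "P a"
  proof (induction a rule: measure_induct_rule[of wo_index])
    case (less x)
    show ?case by (rule step, rule less) (simp add: less_wellordered_def)
  qed
next
  fix x y :: "'a wellordered"
  assume "x \<le> y" "y \<le> x"
  then have "wo_index x = wo_index y" by (simp add: less_eq_wellordered_def)
  then show "x = y" by (rule injD[OF inj_wo_index])
qed (auto simp: less_eq_wellordered_def less_wellordered_def)

end

lemma has_integral_iff_nn_integral:
  fixes f :: "'a::euclidean_space \<Rightarrow> real"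
  assumes "f \<in> borel_measurable borel" "\<And>x. 0 \<le> f x" "0 \<le> r"
  shows "(f has_integral r) UNIV \<longleftrightarrow> (\<integral>\<^sup>+x. ennreal (f x) \<partial>lborel) = ennreal r"
  by (rule iffI) (fact nn_integral_has_integral_lborel[OF assms(1,2)]
      nn_integral_has_integral[OF assms(1,2) _ assms(3)])+

text \<open>The gauge integral version of the theorem speaks only of finite values \<open>m\<close>.
  Two extended nonnegative numbers that equal the same finite values coincide, infinity included, so
  it suffices to compare \<open>?L = ennreal m\<close> with \<open>?R = ennreal m\<close> for all
  \<open>m\<close>.\<close>

lemma emeasure_image_wellordered:
  fixes T :: "real^'n::{finite,wellorder} \<Rightarrow> real^'n::_"
  assumes S: "S \<in> sets borel" and TS: "T ` S \<in> sets borel"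
    and T': "\<And>x. x \<in> S \<Longrightarrow> (T has_derivative T' x) (at x)"
    and inj: "inj_on T S"
    and J: "(\<lambda>x. indicator S x * \<bar>det (matrix (T' x))\<bar>) \<in> borel_measurable borel"
  shows "emeasure lborel (T ` S) = (\<integral>\<^sup>+x. ennreal (indicator S x * \<bar>det (matrix (T' x))\<bar>) \<partial>lborel)"
    (is "?L = ?R")
proof -
  have T'': "(T has_derivative T' x) (at x within S)" if "x \<in> S" for x
    using T'[OF that] by (rule has_derivative_at_withinI)
  have Sl: "S \<in> sets lebesgue" using S by simp
  note 1 = has_measure_differentiable_image[OF Sl T'' inj]
  have 2: "((\<lambda>x. \<bar>det (matrix (T' x))\<bar>) has_integral m) S \<longleftrightarrow> ?R = ennreal m" if "0 \<le> m" for m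
  proof -
    have eq: "(\<lambda>x. if x \<in> S then \<bar>det (matrix (T' x))\<bar> else 0) = (\<lambda>x. indicator S x * \<bar>det (matrix (T' x))\<bar>)"
      by (auto simp: indicator_def)
    have "((\<lambda>x. \<bar>det (matrix (T' x))\<bar>) has_integral m) S \<longleftrightarrow>
        ((\<lambda>x. indicator S x * \<bar>det (matrix (T' x))\<bar>) has_integral m) UNIV"
      using has_integral_restrict_UNIV[of S "\<lambda>x. \<bar>det (matrix (T' x))\<bar>" m] unfolding eq by simp
    also have "\<dots> \<longleftrightarrow> ?R = ennreal m"
      by (rule has_integral_iff_nn_integral[OF J _ that]) simp
    finally show ?thesis .
  qed
  have 3: "T ` S \<in> lmeasurable \<and> measure lebesgue (T ` S) = m \<longleftrightarrow> ?L = ennreal m" if "0 \<le> m" for m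
  proof -
    have L: "emeasure lebesgue (T ` S) = ?L" using TS by simp
    have TSl: "T ` S \<in> sets lebesgue" using TS by simp
    show ?thesis
    proof
      assume "T ` S \<in> lmeasurable \<and> measure lebesgue (T ` S) = m"
      then show "?L = ennreal m" using emeasure_eq_measure2 L by metis
    next
      assume m: "?L = ennreal m"
      then have "T ` S \<in> lmeasurable" using TSl L by (intro fmeasurableI) auto
      moreover have "measure lebesgue (T ` S) = m" using L m that by (simp add: measure_def)
      ultimately show "T ` S \<in> lmeasurable \<and> measure lebesgue (T ` S) = m" ..
    qed
  qed
  have eq: "?L = ennreal m \<longleftrightarrow> ?R = ennreal m" if "0 \<le> m" for m
    using 1[of m] 2[OF that] 3[OF that] by simp
  show ?thesis
  proof (cases "?L = top")
    case True
    then show ?thesis using eq by (cases ?R rule: ennreal_cases) auto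
  next
    case False
    then obtain m where m: "0 \<le> m" "?L = ennreal m" by (cases ?L rule: ennreal_cases) auto
    then have "?R = ennreal m" using eq by blast
    with m(2) show ?thesis by simp
  qed
qed

section \<open>Relabelling the coordinates of R^n\<close>

definition reindex_vec :: "('b \<Rightarrow> 'a) \<Rightarrow> real^'a \<Rightarrow> real^'b" where
  "reindex_vec f x = (\<chi> i. x $ f i)"

lemma reindex_vec_nth [simp]: "reindex_vec f x $ i = x $ f i"
  by (simp add: reindex_vec_def)

lemma linear_reindex_vec: "linear (reindex_vec f :: real^'a \<Rightarrow> real^'b)"
  by (rule linearI) (simp_all add: vec_eq_iff)

lemma bounded_linear_reindex_vec: "bounded_linear (reindex_vec f :: real^'a::finite \<Rightarrow> real^'b::finite)"
  using linear_reindex_vec linear_conv_bounded_linear by blast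

lemma borel_measurable_reindex_vec [measurable]:
  "(reindex_vec f :: real^'a::finite \<Rightarrow> real^'b::finite) \<in> borel_measurable borel"
  by (intro borel_measurable_continuous_onI linear_continuous_on bounded_linear_reindex_vec)

lemma Basis_cart_eq_range_axis: "(Basis :: (real^'n::finite) set) = range (\<lambda>i. axis i 1)"
  by (auto simp: Basis_vec_def)

lemma prod_Basis_cart:
  "(\<Prod>b\<in>(Basis :: (real^'n::finite) set). f b) = (\<Prod>i\<in>UNIV. f (axis i 1))"
proof -
  have "inj (\<lambda>i :: 'n. axis i (1::real))"
    by (auto simp: inj_on_def axis_eq_axis)
  then show ?thesis
    unfolding Basis_cart_eq_range_axis by (simp add: prod.reindex)
qed

text \<open>Relabelling axes maps boxes to boxes with the same side lengths, and Lebesgue measure is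
  determined by its values on boxes.\<close>

lemma lborel_distr_reindex_vec:
  fixes f :: "'b::finite \<Rightarrow> 'a::finite"
  assumes "bij f"
  shows "distr lborel borel (reindex_vec f) = lborel"
proof (rule lborel_eqI[symmetric])
  fix l u :: "real^'b"
  assume le: "\<And>b. b \<in> Basis \<Longrightarrow> l \<bullet> b \<le> u \<bullet> b"
  let ?g = "reindex_vec (inv f) :: real^'b \<Rightarrow> real^'a"
  have lu: "l $ i \<le> u $ i" for i
    using le[of "axis i 1"] by (simp add: inner_axis axis_in_Basis_iff)
  have fg: "f (inv f j) = j" "inv f (f i) = i" for i j
    using assms by (simp_all add: bij_is_surj surj_f_inv_f bij_is_inj inv_f_f)
  have eq: "reindex_vec f -` box l u = box (?g l) (?g u)"
  proof (intro set_eqI iffI)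
    fix x assume x: "x \<in> reindex_vec f -` box l u"
    have "l $ inv f j < x $ j \<and> x $ j < u $ inv f j" for j
      using x[unfolded vimage_eq mem_box_cart, rule_format, of "inv f j"] by (simp add: fg)
    then show "x \<in> box (?g l) (?g u)" by (simp add: mem_box_cart)
  next
    fix x assume x: "x \<in> box (?g l) (?g u)"
    have "l $ i < x $ f i \<and> x $ f i < u $ i" for i
      using x[unfolded mem_box_cart, rule_format, of "f i"] by (simp add: fg)
    then show "x \<in> reindex_vec f -` box l u" by (simp add: mem_box_cart)
  qed
  have "emeasure (distr lborel borel (reindex_vec f)) (box l u) = emeasure lborel (box (?g l) (?g u))"
    by (subst emeasure_distr) (auto simp: eq)
  also have "\<dots> = (\<Prod>b\<in>Basis. (?g u - ?g l) \<bullet> b)"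
    using lu by (subst emeasure_lborel_box_eq) (auto simp: Basis_vec_def inner_axis)
  also have "(\<Prod>b\<in>Basis. (?g u - ?g l) \<bullet> b) = (\<Prod>i\<in>UNIV. u $ inv f i - l $ inv f i)"
    by (simp add: prod_Basis_cart inner_axis)
  also have "\<dots> = (\<Prod>i\<in>UNIV. u $ i - l $ i)"
    using prod.reindex_bij_betw[OF bij_imp_bij_inv[OF assms], of "\<lambda>i. u $ i - l $ i"] by simp
  finally show "emeasure (distr lborel borel (reindex_vec f)) (box l u) = ennreal (\<Prod>b\<in>Basis. (u - l) \<bullet> b)"
    by (simp add: prod_Basis_cart inner_axis)
qed simp

text \<open>Conjugation by \<open>f\<close> is a sign-preserving bijection between the permutations
  of the two index types, so the Leibniz expansions agree term by term.\<close>

lemma det_reindex: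
  fixes A :: "real^'a::finite^'a"
  assumes f: "bij (f :: 'b::finite \<Rightarrow> 'a)"
  shows "det (\<chi> i j. A $ f i $ f j) = det A"
proof -
  let ?m = "\<lambda>p x. f (p (inv f x))"
  have bij: "bij_betw ?m {p. p permutes (UNIV :: 'b set)} {p. p permutes (UNIV :: 'a set)}"
    using bij_betw_permutations[OF f] by simp
  have sgn: "sign (?m p) = sign p" if p: "p permutes UNIV" for p
  proof -
    have "map_permutation UNIV f p = ?m p"
      unfolding map_permutation_def using bij_is_surj[OF f] by (simp add: restrict_id_def fun_eq_iff)
    with sign_map_permutation[OF bij_is_inj[OF f] p] show ?thesis by simp
  qed
  have "det A = (\<Sum>p\<in>{p. p permutes (UNIV :: 'b set)}. of_int (sign (?m p)) * (\<Prod>i\<in>UNIV. A $ i $ ?m p i))"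
    unfolding det_def by (rule sum.reindex_bij_betw[OF bij, symmetric])
  also have "\<dots> = (\<Sum>p\<in>{p. p permutes (UNIV :: 'b set)}. of_int (sign p) * (\<Prod>i\<in>UNIV. A $ f i $ f (p i)))"
  proof (rule sum.cong[OF refl])
    fix p :: "'b \<Rightarrow> 'b" assume "p \<in> {p. p permutes UNIV}"
    then have p: "p permutes UNIV" by simp
    have "(\<Prod>i\<in>UNIV. A $ i $ ?m p i) = (\<Prod>i\<in>UNIV. A $ f i $ ?m p (f i))"
      by (rule prod.reindex_bij_betw[OF f, symmetric])
    also have "\<dots> = (\<Prod>i\<in>UNIV. A $ f i $ f (p i))"
      using bij_is_inj[OF f] by (simp add: inv_f_f)
    finally show "of_int (sign (?m p)) * (\<Prod>i\<in>UNIV. A $ i $ ?m p i)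
        = of_int (sign p) * (\<Prod>i\<in>UNIV. A $ f i $ f (p i))"
      using sgn[OF p] by simp
  qed
  finally show ?thesis by (simp add: det_def)
qed

text \<open>Conjugating \<open>T\<close> by the relabelling \<open>?P\<close>, with inverse
  \<open>?Q\<close>, moves it to the wellordered index type. Both relabellings preserve Lebesgue
  measure, and the conjugated Jacobian matrix is the old one reindexed, hence has the same
  determinant.\<close>

theorem emeasure_image_eq_nn_integral_det:
  fixes T :: "real^'n::finite \<Rightarrow> real^'n"
  assumes S: "S \<in> sets borel" and TS: "T ` S \<in> sets borel"
    and T': "\<And>x. x \<in> S \<Longrightarrow> (T has_derivative T' x) (at x)"
    and inj: "inj_on T S"
    and J: "(\<lambda>x. indicator S x * \<bar>det (matrix (T' x))\<bar>) \<in> borel_measurable borel"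
  shows "emeasure lborel (T ` S) = (\<integral>\<^sup>+x. ennreal (indicator S x * \<bar>det (matrix (T' x))\<bar>) \<partial>lborel)"
proof -
  let ?f = "Rep_wellordered :: 'n wellordered \<Rightarrow> 'n"
  have f: "bij ?f"
    by (metis bijI' Rep_wellordered_inject Abs_wellordered_inverse UNIV_I)
  let ?P = "reindex_vec ?f" and ?Q = "reindex_vec (inv ?f)"
  have fg: "?f (inv ?f j) = j" "inv ?f (?f i) = i" for i j
    using f by (simp_all add: bij_is_surj surj_f_inv_f bij_is_inj inv_f_f)
  have PQ: "?P (?Q y) = y" "?Q (?P x) = x" for x y
    by (simp_all add: vec_eq_iff fg)
  have imP: "?P ` A = ?Q -` A" for A
  proof (intro set_eqI iffI)
    fix y assume "y \<in> ?P ` A"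
    then show "y \<in> ?Q -` A" by (auto simp: PQ)
  next
    fix y assume "y \<in> ?Q -` A"
    then show "y \<in> ?P ` A" by (intro image_eqI[of _ _ "?Q y"]) (simp_all add: PQ)
  qed
  have Pm: "?P ` A \<in> sets borel" if "A \<in> sets borel" for A
    unfolding imP using measurable_sets[OF borel_measurable_reindex_vec that] by simp
  have lbQ: "distr lborel borel ?Q = lborel"
    by (rule lborel_distr_reindex_vec[OF bij_imp_bij_inv[OF f]])
  have emP: "emeasure lborel (?P ` A) = emeasure lborel A" if A: "A \<in> sets borel" for A
  proof -
    have "emeasure (distr lborel borel ?Q) A = emeasure lborel (?Q -` A)"
      using A by (subst emeasure_distr) auto
    then show ?thesis by (simp add: imP lbQ)
  qed
  define U where "U = (\<lambda>y. ?P (T (?Q y)))"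
  define U' where "U' = (\<lambda>y v. ?P (T' (?Q y) (?Q v)))"
  have det: "det (matrix (U' y)) = det (matrix (T' (?Q y)))" for y
  proof -
    have Qa: "?Q (axis i 1) = axis (?f i) 1" for i :: "'n wellordered"
      by (auto simp: vec_eq_iff axis_def fg)
    have "matrix (U' y) = (\<chi> i j. matrix (T' (?Q y)) $ ?f i $ ?f j)"
      by (simp add: matrix_def U'_def Qa)
    then show ?thesis by (simp add: det_reindex[OF f])
  qed
  have ind: "indicator (?P ` S) y = (indicator S (?Q y) :: real)" for y
    by (simp add: imP indicator_def)
  have "U ` (?P ` S) = ?P ` (T ` S)"
    unfolding U_def by (simp add: image_image PQ)
  moreover have "emeasure lborel (U ` (?P ` S)) =
      (\<integral>\<^sup>+y. ennreal (indicator (?P ` S) y * \<bar>det (matrix (U' y))\<bar>) \<partial>lborel)"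
  proof (rule emeasure_image_wellordered)
    show "?P ` S \<in> sets borel" by (rule Pm[OF S])
    show "U ` (?P ` S) \<in> sets borel"
      using Pm[OF TS] by (simp add: U_def image_image PQ)
    show "(U has_derivative U' y) (at y)" if "y \<in> ?P ` S" for y
    proof -
      have "?Q y \<in> S" using that by (auto simp: PQ)
      have 1: "((\<lambda>y. T (?Q y)) has_derivative (\<lambda>v. T' (?Q y) (?Q v))) (at y)"
        by (rule has_derivative_compose[OF bounded_linear_imp_has_derivative[OF bounded_linear_reindex_vec] T'])
          fact
      show ?thesis
        unfolding U_def U'_def
        by (rule has_derivative_compose[OF 1 bounded_linear_imp_has_derivative[OF bounded_linear_reindex_vec]])
    qed
    show "inj_on U (?P ` S)"
      unfolding U_def using inj by (auto simp: inj_on_def PQ) (metis PQ(2))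
    show "(\<lambda>y. indicator (?P ` S) y * \<bar>det (matrix (U' y))\<bar>) \<in> borel_measurable borel"
      unfolding ind det
      using measurable_compose[OF borel_measurable_reindex_vec J, of "inv ?f"] by simp
  qed
  ultimately have "emeasure lborel (T ` S) =
      (\<integral>\<^sup>+y. ennreal (indicator S (?Q y) * \<bar>det (matrix (T' (?Q y)))\<bar>) \<partial>lborel)"
    by (simp add: emP[OF TS] ind det)
  also have "\<dots> = (\<integral>\<^sup>+x. ennreal (indicator S x * \<bar>det (matrix (T' x))\<bar>) \<partial>distr lborel borel ?Q)"
    using J by (subst nn_integral_distr) auto
  finally show ?thesis unfolding lbQ .
qed

section \<open>Divergence theorem and linear algebra\<close>

lemma integral_lborel_translation:
  fixes F :: "'a::euclidean_space \<Rightarrow> real"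
  assumes "F \<in> borel_measurable borel"
  shows "integral\<^sup>L lborel (\<lambda>x. F (x + c)) = integral\<^sup>L lborel F"
proof -
  have "integral\<^sup>L lborel F = integral\<^sup>L (distr lborel borel ((+) c)) F"
    by (simp add: lborel_distr_plus)
  also have "\<dots> = integral\<^sup>L lborel (\<lambda>x. F (c + x))"
    using assms by (intro integral_distr) auto
  finally show ?thesis by (simp add: add.commute)
qed

lemma integrable_lborel_translation:
  fixes F :: "'a::euclidean_space \<Rightarrow> real"
  assumes "integrable lborel F"
  shows "integrable lborel (\<lambda>x. F (x + c))"
proof -
  have "integrable (distr lborel borel ((+) c)) F"
    using assms by (simp add: lborel_distr_plus)
  then have "integrable lborel (\<lambda>x. F (c + x))"
    by (rule integrable_distr[rotated]) simp
  then show ?thesis by (simp add: add.commute)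
qed

lemma integrable_compact_support:
  fixes F :: "'a::euclidean_space \<Rightarrow> real"
  assumes "continuous_on UNIV F" "compact K" "\<And>x. x \<notin> K \<Longrightarrow> F x = 0"
  shows "integrable lborel F"
proof -
  have "integrable lborel (\<lambda>x. indicator K x *\<^sub>R F x)"
    using assms by (intro borel_integrable_compact) (auto intro: continuous_on_subset)
  also have "(\<lambda>x. indicator K x *\<^sub>R F x) = F"
    using assms(3) by (auto simp: fun_eq_iff indicator_eq_1_iff)
  finally show ?thesis .
qed

lemma frechet_derivative_eq_0_outside:
  fixes F :: "'a::real_normed_vector \<Rightarrow> 'b::real_normed_vector"
  assumes "closed K" "\<And>x. x \<notin> K \<Longrightarrow> F x = 0" "x \<notin> K"
  shows "frechet_derivative F (at x) v = 0"
proof -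
  have "frechet_derivative (\<lambda>x. 0 :: 'b) (at x) = frechet_derivative F (at x)"
    by (rule frechet_derivative_transform_within_open[of _ x "- K"]) (use assms in auto)
  then show ?thesis by (simp add: fun_eq_iff)
qed

text \<open>By translation invariance every difference quotient of \<open>F\<close> in direction
  \<open>v\<close> has integral zero. The quotients converge to the derivative and are dominated by
  a constant on a fixed ball, so the limit has integral zero as well.\<close>

lemma integral_directional_derivative_eq_0:
  fixes F :: "'a::euclidean_space \<Rightarrow> real"
  assumes F: "Ck_on 1 UNIV F" and K: "compact K" and supp: "\<And>x. x \<notin> K \<Longrightarrow> F x = 0"
  shows "integral\<^sup>L lborel (\<lambda>x. frechet_derivative F (at x) v) = 0"
proof -
  let ?D = "\<lambda>x. frechet_derivative F (at x) v"
  have F1: "Ck_on (Suc 0) UNIV F" using F by (simp only: One_nat_def)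
  have contF: "continuous_on UNIV F"
    using F by (rule Ck_on_imp_continuous_on)
  then have mF: "F \<in> borel_measurable borel"
    by (rule borel_measurable_continuous_onI)
  have contD: "continuous_on UNIV ?D" using Ck_on_partial[OF F1, of v] by simp
  have D0: "?D x = 0" if "x \<notin> K" for x
    by (rule frechet_derivative_eq_0_outside[OF compact_imp_closed[OF K] supp that])
  obtain r where r: "r > 0" "K \<subseteq> cball 0 r"
    using compact_imp_bounded[OF K] bounded_subset_ballD ball_subset_cball by (metis subset_trans)
  have "bounded (?D ` K)"
    by (intro compact_imp_bounded compact_continuous_image K) (rule continuous_on_subset[OF contD], simp)
  then obtain C0 where "\<And>x. x \<in> K \<Longrightarrow> \<bar>?D x\<bar> \<le> C0"
    by (auto simp: bounded_iff)
  define C where "C = max C0 0"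
  have C: "\<bar>?D x\<bar> \<le> C" for x
    by (cases "x \<in> K") (use \<open>\<And>x. x \<in> K \<Longrightarrow> \<bar>?D x\<bar> \<le> C0\<close> D0 in \<open>force simp: C_def\<close>)+
  define t where "t = (\<lambda>n. inverse (real (Suc n)))"
  have t: "t n > 0" "t n \<le> 1" for n by (auto simp: t_def inverse_le_1_iff)
  have t0: "t \<longlonglongrightarrow> 0" unfolding t_def by (rule LIMSEQ_inverse_real_of_nat)
  define q where "q = (\<lambda>n x. (F (x + t n *\<^sub>R v) - F x) / t n)"
  have line: "((\<lambda>s. F (x + s *\<^sub>R v)) has_real_derivative ?D (x + s *\<^sub>R v)) (at s)" for x s
    using Ck_on_Suc_has_derivative[OF F1] by (intro has_real_derivative_along_line) auto
  have qb: "\<bar>q n x\<bar> \<le> C" for n x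
  proof -
    obtain s where "F (x + t n *\<^sub>R v) - F (x + 0 *\<^sub>R v) = (t n - 0) * ?D (x + s *\<^sub>R v)"
      using MVT2[of 0 "t n" "\<lambda>s. F (x + s *\<^sub>R v)" "\<lambda>s. ?D (x + s *\<^sub>R v)"] line t by blast
    then have "q n x = ?D (x + s *\<^sub>R v)" using t[of n] by (simp add: q_def)
    with C show ?thesis by simp
  qed
  \<comment> \<open>Because \<open>t n \<le> 1\<close>, neither \<open>x\<close> nor the shifted
    point meets \<open>K\<close> once \<open>x\<close> is outside this ball, so one ball dominates
    all quotients.\<close>
  let ?B = "cball 0 (r + norm v) :: 'a set"
  have q0: "q n x = 0" if "x \<notin> ?B" for n x
  proof -
    have x: "norm x > r + norm v" using that by simp
    have "norm (t n *\<^sub>R v) \<le> norm v"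
      using t[of n] mult_right_mono[of "t n" 1 "norm v"] by simp
    then have "norm (x + t n *\<^sub>R v) > r"
      using x norm_triangle_ineq4[of "x + t n *\<^sub>R v" "t n *\<^sub>R v"] by simp
    then have "x + t n *\<^sub>R v \<notin> K" using r by auto
    moreover have "x \<notin> cball 0 r" using x norm_ge_zero[of v] by (simp, linarith)
    then have "x \<notin> K" using r(2) by blast
    ultimately show ?thesis by (simp add: q_def supp)
  qed
  have intF: "integrable lborel F" by (rule integrable_compact_support[OF contF K supp])
  have q_int0: "integral\<^sup>L lborel (q n) = 0" for n
    unfolding q_def
    using intF integrable_lborel_translation[OF intF, of "t n *\<^sub>R v"] integral_lborel_translation[OF mF, of "t n *\<^sub>R v"]
    by simp
  have "(\<lambda>n. integral\<^sup>L lborel (q n)) \<longlonglongrightarrow> integral\<^sup>L lborel ?D"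
  proof (rule integral_dominated_convergence)
    show "?D \<in> borel_measurable lborel"
      using borel_measurable_continuous_onI[OF contD] by simp
    show "q n \<in> borel_measurable lborel" for n
      unfolding q_def using mF by measurable
    show "integrable lborel (\<lambda>x. C * indicator ?B x)"
      using emeasure_lborel_cball_finite[of "0::'a" "r + norm v"]
      by (intro integrable_mult_right integrable_real_indicator) auto
    show "AE x in lborel. norm (q n x) \<le> C * indicator ?B x" for n
      using qb[of n] q0[of _ n] by (intro AE_I2) (auto simp: indicator_def)
    show "AE x in lborel. (\<lambda>n. q n x) \<longlonglongrightarrow> ?D x"
    proof (rule AE_I2)
      fix x
      have "((\<lambda>h. (F (x + h *\<^sub>R v) - F x) / h) \<longlongrightarrow> ?D x) (at 0)"
        using line[of x 0] by (simp add: DERIV_def)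
      moreover have "filterlim t (at 0) sequentially"
        unfolding filterlim_at using t0 t(1) by (auto intro: always_eventually simp: less_imp_neq[symmetric])
      ultimately show "(\<lambda>n. q n x) \<longlonglongrightarrow> ?D x"
        unfolding q_def by (rule filterlim_compose)
    qed
  qed
  then show ?thesis
    unfolding q_int0 using LIMSEQ_unique[OF tendsto_const] by metis
qed

section \<open>Orthonormal systems and positive definite matrices\<close>

lemma orthonormal_independent:
  fixes b :: "'i::finite \<Rightarrow> 'v::euclidean_space"
  assumes on: "\<And>i j. b i \<bullet> b j = (if i = j then 1 else 0)"
  shows "independent (range b)" "card (range b) = CARD('i)"
proof -
  have inj: "inj b"
    by (rule injI) (metis on zero_neq_one)
  then show "card (range b) = CARD('i)" by (rule card_image)
  have "pairwise orthogonal (range b)"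
    using on by (auto simp: pairwise_def orthogonal_def)
  moreover have "0 \<notin> range b"
    using on by (metis imageE inner_zero_left zero_neq_one)
  ultimately show "independent (range b)"
    by (rule pairwise_orthogonal_independent)
qed

lemma orthonormal_expansion:
  fixes b :: "'i::finite \<Rightarrow> 'v::euclidean_space"
  assumes on: "\<And>i j. b i \<bullet> b j = (if i = j then 1 else 0)" and card: "CARD('i) = DIM('v)"
  shows "u = (\<Sum>i\<in>UNIV. (b i \<bullet> u) *\<^sub>R b i)"
proof -
  have "independent (range b)" "card (range b) = DIM('v)"
    using orthonormal_independent[OF on] card by simp_all
  then have span: "span (range b) = UNIV"
    by (metis card_eq_dim dim_UNIV finite_imageI finite top_greatest span_UNIV subset_antisym span_mono subset_UNIV)
  let ?r = "u - (\<Sum>i\<in>UNIV. (b i \<bullet> u) *\<^sub>R b i)"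
  have "orthogonal ?r w" if "w \<in> range b" for w
  proof -
    obtain j where w: "w = b j" using \<open>w \<in> range b\<close> by auto
    have "(\<Sum>i\<in>UNIV. (b i \<bullet> u) *\<^sub>R b i) \<bullet> b j = b j \<bullet> u"
      by (simp add: inner_sum_left on if_distrib cong: if_cong)
    then show ?thesis by (simp add: w orthogonal_def inner_diff_left inner_commute[of u "b j"])
  qed
  then have "orthogonal ?r ?r"
    using orthogonal_to_span[of ?r "range b" ?r] span by (metis UNIV_I orthogonal_commute)
  then show ?thesis by (simp add: orthogonal_self)
qed

text \<open>Every matrix on the segment from the identity to \<open>A\<close> has a positive
  quadratic form and hence is nonsingular. By the intermediate value theorem the determinant keeps
  the sign it has at the identity.\<close>

lemma det_pos_if_positive_definite:
  fixes A :: "real^'n^'n"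
  assumes pos: "\<And>c. c \<noteq> 0 \<Longrightarrow> c \<bullet> (A *v c) > 0"
  shows "det A > 0"
proof (rule ccontr)
  assume neg: "\<not> det A > 0"
  define M where "M = (\<lambda>t. (1 - t) *\<^sub>R mat 1 + t *\<^sub>R A)"
  have "continuous_on {0..1} (\<lambda>t. det (M t))"
    unfolding M_def det_def by (auto intro!: continuous_intros)
  then obtain t where t: "0 \<le> t" "t \<le> 1" "det (M t) = 0"
    using IVT2'[of "\<lambda>t. det (M t)" 1 0 0] neg by (auto simp: M_def)
  then obtain c where c: "c \<noteq> 0" "M t *v c = 0"
    by (metis invertible_def invertible_det_nz matrix_left_invertible_ker matrix_left_right_inverse)
  have "c \<bullet> (M t *v c) = (1 - t) * (c \<bullet> c) + t * (c \<bullet> (A *v c))"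
    by (simp add: M_def matrix_vector_mult_add_rdistrib scaleR_matrix_vector_assoc[symmetric] inner_add_right)
  moreover have "c \<bullet> c > 0" using c by simp
  moreover have "t * (c \<bullet> (A *v c)) > 0" if "t > 0"
    using pos[OF c(1)] that by simp
  moreover have "(1 - t) * (c \<bullet> c) \<ge> 0"
    using t by simp
  ultimately show False
    using c(2) t(1) by (cases "t = 0") auto
qed

section \<open>Immersed coordinate patches\<close>

abbreviation partial :: "(real^'n::finite \<Rightarrow> 'v::real_normed_vector) \<Rightarrow> 'n \<Rightarrow> real^'n \<Rightarrow> 'v" where
  "partial Y i x \<equiv> frechet_derivative Y (at x) (axis i 1)"

definition gram :: "(real^'n::finite \<Rightarrow> 'v::euclidean_space) \<Rightarrow> real^'n \<Rightarrow> real^'n^'n" where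
  "gram Y x = (\<chi> i j. partial Y i x \<bullet> partial Y j x)"

text \<open>By Cramer's rule, these are the coordinates of the tangential part of \<^term>\<open>W\<close>.\<close>

definition tcoord :: "(real^'n::finite \<Rightarrow> 'v::euclidean_space) \<Rightarrow> 'v \<Rightarrow> real^'n \<Rightarrow> real^'n" where
  "tcoord Y W x = (\<chi> k. det (\<chi> i j. if j = k then partial Y i x \<bullet> W else gram Y x $ i $ j) / det (gram Y x))"

definition tpart :: "(real^'n::finite \<Rightarrow> 'v::euclidean_space) \<Rightarrow> 'v \<Rightarrow> real^'n \<Rightarrow> 'v" where
  "tpart Y W x = frechet_derivative Y (at x) (tcoord Y W x)"

text \<open>The trace over the tangent space of the derivative of \<open>\<xi>\<close>. The field
  need not be tangent, so the definition also applies to normal and to constant fields.\<close>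

definition surface_div :: "(real^'n::finite \<Rightarrow> 'v::euclidean_space) \<Rightarrow> (real^'n \<Rightarrow> 'v) \<Rightarrow> real^'n \<Rightarrow> real" where
  "surface_div Y \<xi> x = (\<Sum>i\<in>UNIV. \<Sum>j\<in>UNIV. matrix_inv (gram Y x) $ i $ j * (partial \<xi> j x \<bullet> partial Y i x))"

lemma linear_eq_sum_axis:
  fixes L :: "real^'n::finite \<Rightarrow> 'v::real_vector"
  assumes "linear L"
  shows "L v = (\<Sum>k\<in>UNIV. v $ k *\<^sub>R L (axis k 1))"
proof -
  have "L v = L (\<Sum>k\<in>UNIV. v $ k *\<^sub>R axis k 1)"
    using basis_expansion[of v] by (simp add: scalar_mult_eq_scaleR)
  then show ?thesis
    using assms by (simp add: linear_sum linear_cmul)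
qed

lemma sum_rotate:
  fixes f :: "'a \<Rightarrow> 'b \<Rightarrow> 'c \<Rightarrow> 'd::comm_monoid_add"
  shows "(\<Sum>i\<in>A. \<Sum>j\<in>B. \<Sum>k\<in>C. f i j k) = (\<Sum>k\<in>C. \<Sum>i\<in>A. \<Sum>j\<in>B. f i j k)"
proof -
  have "(\<Sum>i\<in>A. \<Sum>j\<in>B. \<Sum>k\<in>C. f i j k) = (\<Sum>i\<in>A. \<Sum>k\<in>C. \<Sum>j\<in>B. f i j k)"
    by (rule sum.cong[OF refl], rule sum.swap)
  then show ?thesis by (simp add: sum.swap[of _ C A])
qed

locale immersed_patch =
  fixes Y :: "real^'n::finite \<Rightarrow> 'v::euclidean_space" and U :: "(real^'n) set"
  assumes open_U: "open U" and smooth: "smooth_on U Y"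
    and inj: "\<And>x. x \<in> U \<Longrightarrow> inj (frechet_derivative Y (at x))"
begin

lemma Ck_Y: "Ck_on r U Y"
  using smooth by (rule smooth_onD)

lemma Ck_partial: "Ck_on r U (partial Y i)"
  using Ck_Y[of "Suc r"] by (rule Ck_on_partial)

lemma has_derivative_Y: "x \<in> U \<Longrightarrow> (Y has_derivative frechet_derivative Y (at x)) (at x)"
  using Ck_on_Suc_has_derivative[OF Ck_Y[of "Suc 0"]] .

lemma linear_D: "x \<in> U \<Longrightarrow> linear (frechet_derivative Y (at x))"
  using has_derivative_Y has_derivative_linear by blast

lemma gram_vec:
  assumes "x \<in> U"
  shows "(gram Y x *v c) $ i = partial Y i x \<bullet> frechet_derivative Y (at x) c"
  by (subst linear_eq_sum_axis[OF linear_D[OF assms], of c])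
    (simp add: gram_def matrix_vector_mult_def inner_sum_right mult.commute)

lemma inner_gram:
  assumes "x \<in> U"
  shows "c \<bullet> (gram Y x *v d) = frechet_derivative Y (at x) c \<bullet> frechet_derivative Y (at x) d"
  by (subst linear_eq_sum_axis[OF linear_D[OF assms], of c])
    (simp add: inner_vec_def[of c] gram_vec[OF assms] inner_sum_left)

lemma det_gram_pos:
  assumes x: "x \<in> U"
  shows "det (gram Y x) > 0"
proof (rule det_pos_if_positive_definite)
  fix c :: "real^'n" assume "c \<noteq> 0"
  then have "frechet_derivative Y (at x) c \<noteq> 0"
    using inj[OF x] linear_0[OF linear_D[OF x]] by (metis injD)
  then show "c \<bullet> (gram Y x *v c) > 0"
    by (simp add: inner_gram[OF x])
qed

lemma gram_symmetric: "gram Y x $ i $ j = gram Y x $ j $ i"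
  by (simp add: gram_def inner_commute)

lemma gram_inv:
  assumes "x \<in> U"
  shows "matrix_inv (gram Y x) ** gram Y x = mat 1" "gram Y x ** matrix_inv (gram Y x) = mat 1"
proof -
  have "invertible (gram Y x)"
    using det_gram_pos[OF assms] by (simp add: invertible_det_nz)
  then have "gram Y x ** matrix_inv (gram Y x) = mat 1 \<and> matrix_inv (gram Y x) ** gram Y x = mat 1"
    unfolding invertible_def matrix_inv_def by (rule someI_ex)
  then show "matrix_inv (gram Y x) ** gram Y x = mat 1" "gram Y x ** matrix_inv (gram Y x) = mat 1"
    by blast+
qed

lemma gram_inv_symmetric:
  assumes "x \<in> U"
  shows "matrix_inv (gram Y x) $ i $ j = matrix_inv (gram Y x) $ j $ i"
proof -
  let ?g = "gram Y x" and ?G = "matrix_inv (gram Y x)"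
  have "transpose ?g = ?g"
    by (simp add: transpose_def vec_eq_iff gram_symmetric)
  then have "transpose ?G ** ?g = mat 1"
    using gram_inv(2)[OF assms] by (metis matrix_transpose_mul transpose_mat)
  then have "transpose ?G = ?G"
    using gram_inv(2)[OF assms] by (metis matrix_mul_assoc matrix_mul_lid matrix_mul_rid)
  then have "transpose ?G $ i $ j = ?G $ i $ j" by simp
  then show ?thesis by (simp add: transpose_def)
qed

lemma gram_tcoord:
  assumes "x \<in> U"
  shows "gram Y x *v tcoord Y W x = (\<chi> i. partial Y i x \<bullet> W)"
proof -
  have eq: "(\<chi> i j. if j = k then (\<chi> i. partial Y i x \<bullet> W) $ i else gram Y x $ i $ j)
      = (\<chi> i j. if j = k then partial Y i x \<bullet> W else gram Y x $ i $ j)" for k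
    by (simp add: vec_eq_iff)
  have "det (gram Y x) \<noteq> 0" using det_gram_pos[OF assms] by simp
  then show ?thesis
    unfolding tcoord_def by (subst cramer) (simp_all only: eq not_False_eq_True)
qed

lemma partial_inner_tpart: "x \<in> U \<Longrightarrow> partial Y i x \<bullet> tpart Y W x = partial Y i x \<bullet> W"
  using gram_vec[of x "tcoord Y W x" i] gram_tcoord[of x W] by (simp add: tpart_def)

text \<open>As \<open>tpart\<close> lies in the range of the differential by construction, this
  property identifies it as the orthogonal projection of \<open>W\<close> onto the tangent
  space.\<close>

lemma inner_tpart:
  assumes "x \<in> U"
  shows "frechet_derivative Y (at x) c \<bullet> tpart Y W x = frechet_derivative Y (at x) c \<bullet> W"
  by (subst (1 2) linear_eq_sum_axis[OF linear_D[OF assms], of c])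
    (simp add: inner_sum_left partial_inner_tpart[OF assms])

lemma Ck_gram: "Ck_on r U (\<lambda>x. gram Y x $ i $ j)"
  unfolding gram_def by (simp add: Ck_on_inner open_U Ck_partial)

lemma Ck_det_gram: "Ck_on r U (\<lambda>x. det (gram Y x))"
proof -
  have "Ck_on r U (\<lambda>x. det (\<chi> i j. gram Y x $ i $ j))"
    by (intro Ck_on_det Ck_gram open_U)
  then show ?thesis by simp
qed

lemma Ck_sqrt_det_gram: "Ck_on r U (\<lambda>x. sqrt (det (gram Y x)))"
  by (intro Ck_on_sqrt_compose open_U Ck_det_gram det_gram_pos)

text \<open>Here Cramer's rule pays off: each coordinate is a quotient of determinants of smooth
  entries with a nonvanishing denominator.\<close>

lemma Ck_tcoord: "Ck_on r U (\<lambda>x. tcoord Y W x $ k)"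
proof -
  have "Ck_on r U (\<lambda>x. if j = k then partial Y i x \<bullet> W else gram Y x $ i $ j)" for i j
    by (cases "j = k") (simp_all add: Ck_gram Ck_on_inner open_U Ck_partial)
  then show ?thesis
    unfolding tcoord_def
    by (simp, intro Ck_on_divide Ck_on_det Ck_det_gram open_U) (auto dest: det_gram_pos)
qed

lemma tpart_eq: "x \<in> U \<Longrightarrow> tpart Y W x = (\<Sum>k\<in>UNIV. tcoord Y W x $ k *\<^sub>R partial Y k x)"
  unfolding tpart_def by (rule linear_eq_sum_axis[OF linear_D])

lemma Ck_tpart: "Ck_on r U (tpart Y W)"
proof -
  have "Ck_on r U (\<lambda>x. \<Sum>k\<in>UNIV. tcoord Y W x $ k *\<^sub>R partial Y k x)"
    by (intro Ck_on_sum Ck_on_scaleR open_U Ck_tcoord Ck_partial)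
  then show ?thesis
    using Ck_on_cong[OF open_U, of "tpart Y W" "\<lambda>x. \<Sum>k\<in>UNIV. tcoord Y W x $ k *\<^sub>R partial Y k x"] tpart_eq
    by simp
qed

lemma partial_commute: "x \<in> U \<Longrightarrow> partial (partial Y j) i x = partial (partial Y i) j x"
  using mixed_partials_commute[OF open_U Ck_Y[of 2]] by blast

lemma partial_partial: "x \<in> U \<Longrightarrow> (partial Y i has_derivative frechet_derivative (partial Y i) (at x)) (at x)"
  using Ck_on_Suc_has_derivative[OF Ck_partial[of "Suc 0"]] .

text \<open>Jacobi's formula applied to the Gram matrix. The product rule gives two terms for each
  entry, which contribute equally to the trace because the inverse is symmetric; their factor 2
  cancels the 1 / 2 from the square root.\<close>

lemma partial_volume_density:
  assumes x: "x \<in> U"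
  shows "((\<lambda>x. sqrt (det (gram Y x))) has_derivative
      (\<lambda>v. sqrt (det (gram Y x)) * (\<Sum>i\<in>UNIV. \<Sum>j\<in>UNIV.
         matrix_inv (gram Y x) $ i $ j * (frechet_derivative (partial Y j) (at x) v \<bullet> partial Y i x)))) (at x)"
proof -
  let ?G = "matrix_inv (gram Y x)"
  let ?d = "\<lambda>v i j. frechet_derivative (partial Y i) (at x) v \<bullet> partial Y j x"
  define g' where "g' = (\<lambda>v. \<chi> i j. partial Y i x \<bullet> frechet_derivative (partial Y j) (at x) v + ?d v i j)"
  have "((\<lambda>x. gram Y x $ i $ j) has_derivative (\<lambda>v. g' v $ i $ j)) (at x)" for i j
    using has_derivative_inner[OF partial_partial[OF x, of i] partial_partial[OF x, of j]]
    by (simp add: gram_def g'_def)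
  then have 1: "((\<lambda>x. det (gram Y x)) has_derivative (\<lambda>v. det (gram Y x) * trace (?G ** g' v))) (at x)"
    by (rule has_derivative_det) (rule gram_inv(1)[OF x])
  have 2: "((\<lambda>x. sqrt (det (gram Y x))) has_derivative
      (\<lambda>v. (det (gram Y x) * trace (?G ** g' v)) * (inverse (sqrt (det (gram Y x))) / 2))) (at x)"
    using has_derivative_compose[OF 1 DERIV_real_sqrt[OF det_gram_pos[OF x], unfolded has_field_derivative_def]]
    by (simp add: mult_ac)
  have "trace (?G ** g' v) = 2 * (\<Sum>i\<in>UNIV. \<Sum>j\<in>UNIV. ?G $ i $ j * ?d v j i)" for v
  proof -
    have "trace (?G ** g' v) = (\<Sum>i\<in>UNIV. \<Sum>j\<in>UNIV. ?G $ i $ j * ?d v i j) + (\<Sum>i\<in>UNIV. \<Sum>j\<in>UNIV. ?G $ i $ j * ?d v j i)"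
      by (simp add: trace_def matrix_matrix_mult_def g'_def inner_commute[of "partial Y _ x"]
          ring_distribs sum.distrib)
    also have "(\<Sum>i\<in>UNIV. \<Sum>j\<in>UNIV. ?G $ i $ j * ?d v i j) = (\<Sum>i\<in>UNIV. \<Sum>j\<in>UNIV. ?G $ i $ j * ?d v j i)"
      by (subst sum.swap) (simp add: gram_inv_symmetric[OF x])
    finally show ?thesis by simp
  qed
  moreover have "det (gram Y x) * inverse (sqrt (det (gram Y x))) = sqrt (det (gram Y x))"
    using det_gram_pos[OF x] by (simp add: real_div_sqrt flip: divide_inverse)
  ultimately have "(det (gram Y x) * trace (?G ** g' v)) * (inverse (sqrt (det (gram Y x))) / 2)
      = sqrt (det (gram Y x)) * (\<Sum>i\<in>UNIV. \<Sum>j\<in>UNIV. ?G $ i $ j * ?d v j i)" for v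
    by (simp add: mult_ac)
  with 2 show ?thesis by simp
qed

text \<open>The classical coordinate formula for the divergence. Each side, divided by the density,
  is the sum of a Christoffel-type term in the second derivatives of \<open>Y\<close> and the trace
  of the derivative of the coordinates \<open>?V\<close>; symmetry of the second derivatives matches
  the former.\<close>

lemma divergence_tangential:
  assumes x: "x \<in> U"
  shows "(\<Sum>k\<in>UNIV. partial (\<lambda>x. tcoord Y W x $ k * sqrt (det (gram Y x))) k x)
    = sqrt (det (gram Y x)) * surface_div Y (tpart Y W) x"
proof -
  let ?g = "gram Y x" and ?G = "matrix_inv (gram Y x)" and ?s = "sqrt (det (gram Y x))"
  let ?V = "tcoord Y W"
  have V': "((\<lambda>x. ?V x $ k) has_derivative frechet_derivative (\<lambda>x. ?V x $ k) (at x)) (at x)" for k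
    using Ck_on_Suc_has_derivative[OF Ck_tcoord[of "Suc 0"] x] .
  let ?dV = "\<lambda>k j. partial (\<lambda>x. ?V x $ k) j x"
  have "partial (\<lambda>x. ?V x $ k * sqrt (det (gram Y x))) k x
      = ?V x $ k * (?s * (\<Sum>i\<in>UNIV. \<Sum>j\<in>UNIV. ?G $ i $ j * (partial (partial Y j) k x \<bullet> partial Y i x)))
        + ?dV k k * ?s" for k
    using frechet_derivative_at[OF has_derivative_mult[OF V'[of k] partial_volume_density[OF x]], symmetric]
    by (simp add: fun_eq_iff)
  then have L: "(\<Sum>k\<in>UNIV. partial (\<lambda>x. ?V x $ k * sqrt (det (gram Y x))) k x)
      = ?s * ((\<Sum>k\<in>UNIV. ?V x $ k * (\<Sum>i\<in>UNIV. \<Sum>j\<in>UNIV. ?G $ i $ j * (partial (partial Y j) k x \<bullet> partial Y i x)))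
        + (\<Sum>k\<in>UNIV. ?dV k k))"
    by (simp add: sum.distrib sum_distrib_left ring_distribs mult_ac)
  have "((\<lambda>x. \<Sum>k\<in>UNIV. ?V x $ k *\<^sub>R partial Y k x) has_derivative
     (\<lambda>v. \<Sum>k\<in>UNIV. ?V x $ k *\<^sub>R frechet_derivative (partial Y k) (at x) v
        + frechet_derivative (\<lambda>x. ?V x $ k) (at x) v *\<^sub>R partial Y k x)) (at x)"
    by (intro has_derivative_sum has_derivative_scaleR V' partial_partial[OF x])
  then have T: "(tpart Y W has_derivative
     (\<lambda>v. \<Sum>k\<in>UNIV. ?V x $ k *\<^sub>R frechet_derivative (partial Y k) (at x) v
        + frechet_derivative (\<lambda>x. ?V x $ k) (at x) v *\<^sub>R partial Y k x)) (at x)"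
    by (rule has_derivative_transform_within_open[OF _ open_U x]) (simp add: tpart_eq)
  then have T': "partial (tpart Y W) j x
      = (\<Sum>k\<in>UNIV. ?V x $ k *\<^sub>R partial (partial Y k) j x + ?dV k j *\<^sub>R partial Y k x)" for j
    using frechet_derivative_at[OF T, symmetric] by simp
  have "surface_div Y (tpart Y W) x
      = (\<Sum>i\<in>UNIV. \<Sum>j\<in>UNIV. \<Sum>k\<in>UNIV. ?V x $ k * (?G $ i $ j * (partial (partial Y j) k x \<bullet> partial Y i x)))
      + (\<Sum>i\<in>UNIV. \<Sum>j\<in>UNIV. \<Sum>k\<in>UNIV. ?dV k j * (?g $ k $ i * ?G $ i $ j))"
    unfolding surface_div_def T'
    by (simp add: inner_sum_left inner_add_left sum_distrib_left ring_distribs sum.distrib gram_def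
        partial_commute[OF x] mult_ac)
  \<comment> \<open>Summing over \<open>i\<close> first contracts the metric with its inverse, which
    leaves only the diagonal terms \<open>?dV k k\<close>.\<close>
  also have "(\<Sum>i\<in>UNIV. \<Sum>j\<in>UNIV. \<Sum>k\<in>UNIV. ?dV k j * (?g $ k $ i * ?G $ i $ j))
      = (\<Sum>k\<in>UNIV. \<Sum>j\<in>UNIV. ?dV k j * (\<Sum>i\<in>UNIV. ?g $ k $ i * ?G $ i $ j))"
    unfolding sum_distrib_left by (subst sum_rotate) (intro sum.cong refl sum.swap)
  also have "\<dots> = (\<Sum>k\<in>UNIV. \<Sum>j\<in>UNIV. ?dV k j * (?g ** ?G) $ k $ j)"
    by (simp add: matrix_matrix_mult_def)
  also have "\<dots> = (\<Sum>k\<in>UNIV. ?dV k k)"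
    by (simp add: gram_inv(2)[OF x] mat_def if_distrib cong: if_cong)
  also have "(\<Sum>i\<in>UNIV. \<Sum>j\<in>UNIV. \<Sum>k\<in>UNIV. ?V x $ k * (?G $ i $ j * (partial (partial Y j) k x \<bullet> partial Y i x)))
      = (\<Sum>k\<in>UNIV. ?V x $ k * (\<Sum>i\<in>UNIV. \<Sum>j\<in>UNIV. ?G $ i $ j * (partial (partial Y j) k x \<bullet> partial Y i x)))"
    by (subst sum_rotate) (simp add: sum_distrib_left)
  finally show ?thesis using L by simp
qed

text \<open>With the vectors \<open>a i\<close> as the rows of \<open>B\<close>, orthonormality
  reads \<open>B ** (?g ** transpose B) = mat 1\<close>. Hence the inverse metric is
  \<open>transpose B ** B\<close>, and contracting with it is the same as summing over the
  orthonormal basis.\<close>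

lemma surface_div_eq_trace:
  fixes a :: "'n \<Rightarrow> real^'n"
  assumes x: "x \<in> U"
    and on: "\<And>i j. frechet_derivative Y (at x) (a i) \<bullet> frechet_derivative Y (at x) (a j) = (if i = j then 1 else 0)"
    and \<xi>: "\<xi> differentiable (at x)"
  shows "surface_div Y \<xi> x = (\<Sum>i\<in>UNIV. frechet_derivative \<xi> (at x) (a i) \<bullet> frechet_derivative Y (at x) (a i))"
proof -
  let ?g = "gram Y x" and ?G = "matrix_inv (gram Y x)"
  define B where "B = (\<chi> i j. a i $ j)"
  have "(B ** (?g ** transpose B)) $ i $ j = a i \<bullet> (?g *v a j)" for i j
    by (simp add: matrix_matrix_mult_def B_def transpose_def inner_vec_def matrix_vector_mult_def)
  then have "B ** (?g ** transpose B) = mat 1"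
    by (simp add: vec_eq_iff inner_gram[OF x] on mat_def)
  then have "(?g ** transpose B) ** B = mat 1"
    by (rule matrix_left_right_inverse[THEN iffD1])
  then have "?g ** (transpose B ** B) = mat 1"
    by (simp add: matrix_mul_assoc)
  then have G: "?G = transpose B ** B"
    using gram_inv(1)[OF x] by (metis matrix_mul_assoc matrix_mul_lid matrix_mul_rid)
  have "frechet_derivative \<xi> (at x) (a i) \<bullet> frechet_derivative Y (at x) (a i)
      = (\<Sum>l\<in>UNIV. \<Sum>j\<in>UNIV. a i $ l * a i $ j * (partial \<xi> j x \<bullet> partial Y l x))" for i
    by (subst linear_eq_sum_axis[OF linear_frechet_derivative[OF \<xi>], of "a i"],
        subst linear_eq_sum_axis[OF linear_D[OF x], of "a i"])
      (simp add: inner_sum_left inner_sum_right sum_distrib_left mult_ac)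
  then have "(\<Sum>i\<in>UNIV. frechet_derivative \<xi> (at x) (a i) \<bullet> frechet_derivative Y (at x) (a i))
      = (\<Sum>i\<in>UNIV. \<Sum>l\<in>UNIV. \<Sum>j\<in>UNIV. a i $ l * a i $ j * (partial \<xi> j x \<bullet> partial Y l x))"
    by simp
  also have "\<dots> = (\<Sum>l\<in>UNIV. \<Sum>j\<in>UNIV. \<Sum>i\<in>UNIV. a i $ l * a i $ j * (partial \<xi> j x \<bullet> partial Y l x))"
    by (rule sum_rotate[symmetric])
  also have "\<dots> = surface_div Y \<xi> x"
    unfolding surface_div_def G
    by (simp add: matrix_matrix_mult_def B_def transpose_def sum_distrib_right)
  finally show ?thesis by simp
qed

text \<open>
  The constant field \<^term>\<open>W\<close> has surface divergence \<open>0\<close>, so its tangential and normal parts have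
  opposite divergences.
\<close>

lemma surface_div_tpart:
  fixes a :: "'n \<Rightarrow> real^'n" and \<nu> :: "'k::finite \<Rightarrow> real^'n \<Rightarrow> 'v"
  assumes N: "open N" "x \<in> N" "N \<subseteq> U"
    and on: "\<And>i j. frechet_derivative Y (at x) (a i) \<bullet> frechet_derivative Y (at x) (a j) = (if i = j then 1 else 0)"
    and \<nu>: "\<And>\<alpha>. \<nu> \<alpha> differentiable (at x)" "\<And>\<alpha> i. \<nu> \<alpha> x \<bullet> partial Y i x = 0"
    and dec: "\<And>y. y \<in> N \<Longrightarrow> W - tpart Y W y = (\<Sum>\<alpha>\<in>UNIV. (\<nu> \<alpha> y \<bullet> W) *\<^sub>R \<nu> \<alpha> y)"
  shows "surface_div Y (tpart Y W) x = - (\<Sum>\<alpha>\<in>UNIV. (\<nu> \<alpha> x \<bullet> W) *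
      (\<Sum>i\<in>UNIV. frechet_derivative (\<nu> \<alpha>) (at x) (a i) \<bullet> frechet_derivative Y (at x) (a i)))"
proof -
  have x: "x \<in> U" using N by auto
  have \<nu>': "(\<nu> \<alpha> has_derivative frechet_derivative (\<nu> \<alpha>) (at x)) (at x)" for \<alpha>
    using \<nu>(1) by (simp add: frechet_derivative_works[symmetric])
  have T: "((\<lambda>y. W - (\<Sum>\<alpha>\<in>UNIV. (\<nu> \<alpha> y \<bullet> W) *\<^sub>R \<nu> \<alpha> y)) has_derivative
      (\<lambda>v. - (\<Sum>\<alpha>\<in>UNIV. (\<nu> \<alpha> x \<bullet> W) *\<^sub>R frechet_derivative (\<nu> \<alpha>) (at x) v
        + (frechet_derivative (\<nu> \<alpha>) (at x) v \<bullet> W) *\<^sub>R \<nu> \<alpha> x))) (at x)"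
    by (auto intro!: derivative_eq_intros \<nu>' simp: sum_negf)
  have "W - (\<Sum>\<alpha>\<in>UNIV. (\<nu> \<alpha> y \<bullet> W) *\<^sub>R \<nu> \<alpha> y) = tpart Y W y" if "y \<in> N" for y
    using dec[OF that] by (simp add: algebra_simps)
  then have T': "(tpart Y W has_derivative
      (\<lambda>v. - (\<Sum>\<alpha>\<in>UNIV. (\<nu> \<alpha> x \<bullet> W) *\<^sub>R frechet_derivative (\<nu> \<alpha>) (at x) v
        + (frechet_derivative (\<nu> \<alpha>) (at x) v \<bullet> W) *\<^sub>R \<nu> \<alpha> x))) (at x)"
    by (rule has_derivative_transform_within_open[OF T N(1,2)])
  \<comment> \<open>Because of this, the derivatives of the coefficients
    \<open>\<nu> \<alpha> y \<bullet> W\<close> drop out: they multiply normal vectors, which are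
    then paired with tangent vectors.\<close>
  have perp: "\<nu> \<alpha> x \<bullet> frechet_derivative Y (at x) v = 0" for \<alpha> v
    by (subst linear_eq_sum_axis[OF linear_D[OF x], of v]) (simp add: inner_sum_right \<nu>(2))
  have "frechet_derivative (tpart Y W) (at x) v \<bullet> frechet_derivative Y (at x) v
      = - (\<Sum>\<alpha>\<in>UNIV. (\<nu> \<alpha> x \<bullet> W) * (frechet_derivative (\<nu> \<alpha>) (at x) v \<bullet> frechet_derivative Y (at x) v))" for v
    unfolding frechet_derivative_at[OF T', symmetric]
    by (simp add: inner_sum_left inner_add_left perp)
  then have "surface_div Y (tpart Y W) x = (\<Sum>i\<in>UNIV. - (\<Sum>\<alpha>\<in>UNIV. (\<nu> \<alpha> x \<bullet> W) *
      (frechet_derivative (\<nu> \<alpha>) (at x) (a i) \<bullet> frechet_derivative Y (at x) (a i))))"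
    using surface_div_eq_trace[OF x on differentiableI[OF T']] by simp
  also have "\<dots> = - (\<Sum>i\<in>UNIV. \<Sum>\<alpha>\<in>UNIV. (\<nu> \<alpha> x \<bullet> W) *
      (frechet_derivative (\<nu> \<alpha>) (at x) (a i) \<bullet> frechet_derivative Y (at x) (a i)))"
    by (simp add: sum_negf)
  also have "\<dots> = - (\<Sum>\<alpha>\<in>UNIV. \<Sum>i\<in>UNIV. (\<nu> \<alpha> x \<bullet> W) *
      (frechet_derivative (\<nu> \<alpha>) (at x) (a i) \<bullet> frechet_derivative Y (at x) (a i)))"
    by (subst sum.swap) simp
  finally show ?thesis by (simp add: sum_distrib_left)
qed

end

section \<open>Adapted orthonormal frames\<close>

lemma smooth_on_subset: "smooth_on V f \<Longrightarrow> V' \<subseteq> V \<Longrightarrow> smooth_on V' f"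
  unfolding smooth_on_def using Ck_on_subset by blast

text \<open>Subtracting from \<open>v\<close> its projection onto the frame leaves a field that is
  nonzero at \<open>p\<close>, hence nearby, and can be normalised smoothly there. Independence is
  thus needed at the single point \<open>p\<close> only.\<close>

lemma gram_schmidt_step:
  fixes f :: "'i \<Rightarrow> 'a::real_normed_vector \<Rightarrow> 'v::euclidean_space"
  assumes I: "finite I" and V: "open V" "p \<in> V"
    and f: "\<And>i. i \<in> I \<Longrightarrow> smooth_on V (f i)" and v: "smooth_on V v"
    and on: "\<And>i j q. i \<in> I \<Longrightarrow> j \<in> I \<Longrightarrow> q \<in> V \<Longrightarrow> f i q \<bullet> f j q = (if i = j then 1 else 0)"
    and ind: "v p \<notin> span ((\<lambda>i. f i p) ` I)"
  obtains V' g where "open V'" "p \<in> V'" "V' \<subseteq> V" "smooth_on V' g"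
    "\<And>q. q \<in> V' \<Longrightarrow> g q \<bullet> g q = 1"
    "\<And>i q. i \<in> I \<Longrightarrow> q \<in> V' \<Longrightarrow> f i q \<bullet> g q = 0"
    "\<And>q. q \<in> V' \<Longrightarrow> g q \<in> span (insert (v q) ((\<lambda>i. f i q) ` I))"
proof -
  define w where "w = (\<lambda>q. v q - (\<Sum>i\<in>I. (f i q \<bullet> v q) *\<^sub>R f i q))"
  have w: "Ck_on r V w" for r
    unfolding w_def using f v V(1)
    by (intro Ck_on_diff Ck_on_sum Ck_on_scaleR Ck_on_inner) (auto intro: smooth_onD)
  have sum_span: "(\<Sum>i\<in>I. (f i q \<bullet> v q) *\<^sub>R f i q) \<in> span ((\<lambda>i. f i q) ` I)" for q
    by (intro span_sum span_scale span_base) auto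
  \<comment> \<open>The neighbourhood shrinks to the set where the residual \<open>w\<close> does
    not vanish.\<close>
  define V' where "V' = V \<inter> (\<lambda>q. w q \<bullet> w q) -` {0<..}"
  have "continuous_on V (\<lambda>q. w q \<bullet> w q)"
    using Ck_on_imp_continuous_on[OF w] by (intro continuous_on_inner)
  then have oV': "open V'"
    unfolding V'_def by (rule continuous_open_preimage[OF _ V(1) open_greaterThan])
  have "w p \<noteq> 0"
    using ind sum_span[of p] by (auto simp: w_def)
  then have pV': "p \<in> V'" using V by (simp add: V'_def)
  have VV: "V' \<subseteq> V" by (auto simp: V'_def)
  define g where "g = (\<lambda>q. (1 / sqrt (w q \<bullet> w q)) *\<^sub>R w q)"
  have "Ck_on r V' g" for r
    unfolding g_def
    by (intro Ck_on_scaleR Ck_on_divide Ck_on_sqrt_compose Ck_on_inner oV' Ck_on_subset[OF w VV] Ck_on_const)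
      (auto simp: V'_def)
  then have sg: "smooth_on V' g" by (simp add: smooth_on_def)
  have unit: "g q \<bullet> g q = 1" if "q \<in> V'" for q
    using that by (simp add: g_def V'_def flip: power2_eq_square)
  have orth: "f i q \<bullet> g q = 0" if "i \<in> I" "q \<in> V'" for i q
  proof -
    have "f i q \<bullet> (\<Sum>j\<in>I. (f j q \<bullet> v q) *\<^sub>R f j q) = (\<Sum>j\<in>I. if i = j then f j q \<bullet> v q else 0)"
      using that VV by (auto simp: inner_sum_right on intro!: sum.cong)
    then have "f i q \<bullet> w q = 0"
      using that I by (simp add: w_def inner_diff_right)
    then show ?thesis by (simp add: g_def)
  qed
  have "g q \<in> span (insert (v q) ((\<lambda>i. f i q) ` I))" for q
    unfolding g_def w_def
    using sum_span[of q] span_mono[of "(\<lambda>i. f i q) ` I" "insert (v q) ((\<lambda>i. f i q) ` I)"]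
    by (intro span_scale span_diff) (auto intro: span_base)
  from that[OF oV' pV' VV sg unit orth this] show ?thesis .
qed

text \<open>A dimension count yields a vector outside the span of the current frame at
  \<open>p\<close>. The constant field with this value is admissible for the Gram-Schmidt step, and
  the fields indexed by \<open>I\<close> are kept unchanged.\<close>

lemma extend_orthonormal_frame:
  fixes f :: "'i \<Rightarrow> 'a::real_normed_vector \<Rightarrow> 'v::euclidean_space"
  assumes "finite J" "finite I" "I \<inter> J = {}" "card I + card J \<le> DIM('v)" and V: "open V" "p \<in> V"
    and f: "\<And>i. i \<in> I \<Longrightarrow> smooth_on V (f i)"
    and on: "\<And>i j q. i \<in> I \<Longrightarrow> j \<in> I \<Longrightarrow> q \<in> V \<Longrightarrow> f i q \<bullet> f j q = (if i = j then 1 else 0)"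
  shows "\<exists>V' f'. open V' \<and> p \<in> V' \<and> V' \<subseteq> V \<and> (\<forall>i\<in>I. f' i = f i) \<and> (\<forall>i\<in>I \<union> J. smooth_on V' (f' i)) \<and>
    (\<forall>i\<in>I \<union> J. \<forall>j\<in>I \<union> J. \<forall>q\<in>V'. f' i q \<bullet> f' j q = (if i = j then 1 else 0))"
  using assms(1,3,4)
proof (induction J rule: finite_induct)
  case empty
  then show ?case using V f on by (intro exI[of _ V] exI[of _ f]) auto
next
  case (insert k J)
  have "I \<inter> J = {}" "card I + card J \<le> DIM('v)" using insert by auto
  from insert.IH[OF this] obtain V1 f1 where H: "open V1 \<and> p \<in> V1 \<and> V1 \<subseteq> V \<and> (\<forall>i\<in>I. f1 i = f i) \<and>
    (\<forall>i\<in>I \<union> J. smooth_on V1 (f1 i)) \<and>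
    (\<forall>i\<in>I \<union> J. \<forall>j\<in>I \<union> J. \<forall>q\<in>V1. f1 i q \<bullet> f1 j q = (if i = j then 1 else 0))"
    by (elim exE) (rule that)
  have 1: "open V1" "p \<in> V1" "V1 \<subseteq> V" "\<And>i. i \<in> I \<Longrightarrow> f1 i = f i"
    "\<And>i. i \<in> I \<union> J \<Longrightarrow> smooth_on V1 (f1 i)"
    "\<And>i j q. i \<in> I \<union> J \<Longrightarrow> j \<in> I \<union> J \<Longrightarrow> q \<in> V1 \<Longrightarrow> f1 i q \<bullet> f1 j q = (if i = j then 1 else 0)"
    using H by blast+
  have k: "k \<notin> I \<union> J" using insert by auto
  have fin: "finite (I \<union> J)" using insert assms(2) by simp
  have "card (I \<union> J) < DIM('v)"
    using insert assms(2) by (simp add: card_Un_disjoint)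
  then have "dim (span ((\<lambda>i. f1 i p) ` (I \<union> J))) < DIM('v)"
    using dim_le_card'[of "(\<lambda>i. f1 i p) ` (I \<union> J)"] card_image_le[OF fin, of "\<lambda>i. f1 i p"] fin
    by (simp add: dim_span)
  then obtain v where v: "v \<notin> span ((\<lambda>i. f1 i p) ` (I \<union> J))"
    using dim_UNIV[where 'a='v] by (metis UNIV_eq_I less_irrefl)
  have sv: "smooth_on V1 (\<lambda>q. v)" by (simp add: smooth_on_def)
  obtain V' g where g: "open V'" "p \<in> V'" "V' \<subseteq> V1" "smooth_on V' g"
    "\<And>q. q \<in> V' \<Longrightarrow> g q \<bullet> g q = 1" "\<And>i q. i \<in> I \<union> J \<Longrightarrow> q \<in> V' \<Longrightarrow> f1 i q \<bullet> g q = 0"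
    by (rule gram_schmidt_step[OF fin 1(1,2,5) sv 1(6) v]) blast+
  have g': "g q \<bullet> f1 i q = 0" if "i \<in> I \<union> J" "q \<in> V'" for i q
    using g(6)[OF that] by (simp add: inner_commute)
  let ?f = "f1(k := g)"
  have "smooth_on V' (?f i)" if "i \<in> I \<union> insert k J" for i
    using that smooth_on_subset[OF 1(5)[of i] g(3)] g(4) by (cases "i = k") auto
  moreover have "?f i q \<bullet> ?f j q = (if i = j then 1 else 0)"
    if "i \<in> I \<union> insert k J" "j \<in> I \<union> insert k J" "q \<in> V'" for i j q
    using that k g(3) g(5)[of q] g(6)[of _ q] g'[of _ q] 1(6)[of i j q]
    by (cases "i = k"; cases "j = k") (auto simp: subset_iff)
  moreover have "?f i = f i" if "i \<in> I" for i
    using that k 1(4) by auto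
  ultimately show ?case
    using g(1-3) 1(3) by (intro exI[of _ V'] exI[of _ ?f]) auto
qed

context immersed_patch
begin

text \<open>An injective differential carries the independence of the coordinate axes over to the
  coordinate fields.\<close>

lemma partial_notin_span:
  assumes x: "x \<in> U" and "k \<notin> J"
  shows "partial Y k x \<notin> span ((\<lambda>j. partial Y j x) ` J)"
proof -
  let ?D = "frechet_derivative Y (at x)"
  have inj_ax: "inj (\<lambda>i :: 'n. axis i (1::real))"
    by (auto simp: inj_on_def axis_eq_axis)
  have "independent (range (\<lambda>i :: 'n. axis i (1::real)))"
    using independent_Basis[where 'a="real^'n"] by (simp add: Basis_cart_eq_range_axis)
  then have "axis k 1 \<notin> span (range (\<lambda>i. axis i (1::real)) - {axis k 1})"
    unfolding dependent_def by blast
  moreover have "(\<lambda>j. axis j (1::real)) ` J \<subseteq> range (\<lambda>i. axis i (1::real)) - {axis k 1}"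
    using assms(2) injD[OF inj_ax] by auto
  ultimately have 1: "axis k 1 \<notin> span ((\<lambda>j. axis j (1::real)) ` J)"
    using span_mono by blast
  have "span ((\<lambda>j. partial Y j x) ` J) = ?D ` span ((\<lambda>j. axis j 1) ` J)"
    using linear_span_image[OF linear_D[OF x], of "(\<lambda>j. axis j 1) ` J"] by (simp add: image_image)
  then show ?thesis
    using 1 inj[OF x] by (metis (no_types, lifting) imageE injD)
qed

text \<open>Gram-Schmidt on the coordinate fields. The span clause is part of the induction: it
  keeps the next coordinate field outside the span of the vectors already built and finally shows
  that the frame is tangent.\<close>

lemma partial_tangent_frame_exists:
  assumes x: "x \<in> U" and "finite J"
  shows "\<exists>V e. open V \<and> x \<in> V \<and> V \<subseteq> U \<and> (\<forall>i\<in>J. smooth_on V (e i)) \<and>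
    (\<forall>i\<in>J. \<forall>j\<in>J. \<forall>q\<in>V. e i q \<bullet> e j q = (if i = j then 1 else 0)) \<and>
    (\<forall>i\<in>J. \<forall>q\<in>V. e i q \<in> span ((\<lambda>j. partial Y j q) ` J))"
  using assms(2)
proof (induction J rule: finite_induct)
  case empty
  then show ?case using open_U x by auto
next
  case (insert k J)
  from insert.IH obtain V e where H: "open V \<and> x \<in> V \<and> V \<subseteq> U \<and> (\<forall>i\<in>J. smooth_on V (e i)) \<and>
    (\<forall>i\<in>J. \<forall>j\<in>J. \<forall>q\<in>V. e i q \<bullet> e j q = (if i = j then 1 else 0)) \<and>
    (\<forall>i\<in>J. \<forall>q\<in>V. e i q \<in> span ((\<lambda>j. partial Y j q) ` J))"
    by (elim exE) (rule that)
  have 1: "open V" "x \<in> V" "V \<subseteq> U" "\<And>i. i \<in> J \<Longrightarrow> smooth_on V (e i)"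
    "\<And>i j q. i \<in> J \<Longrightarrow> j \<in> J \<Longrightarrow> q \<in> V \<Longrightarrow> e i q \<bullet> e j q = (if i = j then 1 else 0)"
    "\<And>i q. i \<in> J \<Longrightarrow> q \<in> V \<Longrightarrow> e i q \<in> span ((\<lambda>j. partial Y j q) ` J)"
    using H by blast+
  have sv: "smooth_on V (partial Y k)"
    using Ck_on_subset[OF Ck_partial 1(3)] by (simp add: smooth_on_def)
  have sub: "span ((\<lambda>i. e i q) ` J) \<subseteq> span ((\<lambda>j. partial Y j q) ` J)" if "q \<in> V" for q
    using 1(6) that by (intro span_minimal) auto
  then have nin: "partial Y k x \<notin> span ((\<lambda>i. e i x) ` J)"
    using partial_notin_span[OF x, of k J] insert 1(2) by blast
  obtain V' g where g: "open V'" "x \<in> V'" "V' \<subseteq> V" "smooth_on V' g"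
    "\<And>q. q \<in> V' \<Longrightarrow> g q \<bullet> g q = 1" "\<And>i q. i \<in> J \<Longrightarrow> q \<in> V' \<Longrightarrow> e i q \<bullet> g q = 0"
    "\<And>q. q \<in> V' \<Longrightarrow> g q \<in> span (insert (partial Y k q) ((\<lambda>i. e i q) ` J))"
    by (rule gram_schmidt_step[OF insert(1) 1(1,2,4) sv 1(5) nin]) blast+
  have g': "g q \<bullet> e i q = 0" if "i \<in> J" "q \<in> V'" for i q
    using g(6)[OF that] by (simp add: inner_commute)
  let ?e = "e(k := g)"
  have "smooth_on V' (?e i)" if "i \<in> insert k J" for i
    using that smooth_on_subset[OF 1(4)[of i] g(3)] g(4) by (cases "i = k") auto
  moreover have "?e i q \<bullet> ?e j q = (if i = j then 1 else 0)"
    if "i \<in> insert k J" "j \<in> insert k J" "q \<in> V'" for i j q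
    using that insert g(3) g(5)[of q] g(6)[of _ q] g'[of _ q] 1(5)[of i j q]
    by (cases "i = k"; cases "j = k") (auto simp: subset_iff)
  moreover have "?e i q \<in> span ((\<lambda>j. partial Y j q) ` insert k J)" if "i \<in> insert k J" "q \<in> V'" for i q
  proof -
    have mono: "span ((\<lambda>j. partial Y j q) ` J) \<subseteq> span ((\<lambda>j. partial Y j q) ` insert k J)"
      by (intro span_mono) auto
    have "span (insert (partial Y k q) ((\<lambda>i. e i q) ` J)) \<subseteq> span ((\<lambda>j. partial Y j q) ` insert k J)"
    proof (rule span_minimal)
      show "insert (partial Y k q) ((\<lambda>i. e i q) ` J) \<subseteq> span ((\<lambda>j. partial Y j q) ` insert k J)"
        using 1(6)[of _ q] that(2) g(3) mono by (auto intro: span_base)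
    qed auto
    then show ?thesis
      using that g(3) g(7)[of q] 1(6)[of i q] mono by (cases "i = k") auto
  qed
  ultimately show ?case
    using g(1-3) 1(3) by (intro exI[of _ V'] exI[of _ ?e]) auto
qed

lemma range_D_eq_span: "x \<in> U \<Longrightarrow> range (frechet_derivative Y (at x)) = span (range (\<lambda>j. partial Y j x))"
proof -
  assume x: "x \<in> U"
  have "span (range (\<lambda>i :: 'n. axis i (1::real))) = UNIV"
    using span_Basis[where 'a="real^'n"] by (simp add: Basis_cart_eq_range_axis)
  then show ?thesis
    using linear_span_image[OF linear_D[OF x], of "range (\<lambda>i. axis i 1)"] by (simp add: image_image)
qed

lemma tangent_frame_spans:
  fixes b :: "'n \<Rightarrow> 'v"
  assumes x: "x \<in> U" and on: "\<And>i j. b i \<bullet> b j = (if i = j then 1 else 0)"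
    and rng: "\<And>i. b i \<in> range (frechet_derivative Y (at x))"
  shows "range (frechet_derivative Y (at x)) \<subseteq> span (range b)"
proof -
  let ?D = "frechet_derivative Y (at x)"
  have "dim (range ?D) \<le> card (range b)"
    using dim_image_le[OF linear_D[OF x], of UNIV] orthonormal_independent(2)[OF on] by simp
  then show ?thesis
    using rng orthonormal_independent(1)[OF on] by (intro card_ge_dim_independent) auto
qed

text \<open>By the dimension count, \<open>b\<close> and \<open>\<nu>\<close> together form an
  orthonormal basis of the ambient space. In the expansion of \<open>W - tpart Y W x\<close> the
  tangential coefficients vanish by the projection property.\<close>

lemma normal_part_eq:
  fixes b :: "'n \<Rightarrow> 'v" and \<nu> :: "'k::finite \<Rightarrow> 'v"
  assumes card: "DIM('v) = CARD('n) + CARD('k)" and x: "x \<in> U"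
    and b: "\<And>i j. b i \<bullet> b j = (if i = j then 1 else 0)" "\<And>i. b i \<in> range (frechet_derivative Y (at x))"
    and \<nu>: "\<And>\<alpha> \<beta>. \<nu> \<alpha> \<bullet> \<nu> \<beta> = (if \<alpha> = \<beta> then 1 else 0)"
      "\<And>\<alpha> v. \<nu> \<alpha> \<bullet> frechet_derivative Y (at x) v = 0"
  shows "W - tpart Y W x = (\<Sum>\<alpha>\<in>UNIV. (\<nu> \<alpha> \<bullet> W) *\<^sub>R \<nu> \<alpha>)"
proof -
  have b\<nu>: "b i \<bullet> \<nu> \<alpha> = 0" "\<nu> \<alpha> \<bullet> b i = 0" for i \<alpha>
    using b(2)[of i] \<nu>(2)[of \<alpha>] by (auto simp: inner_commute)
  let ?f = "case_sum b \<nu>"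
  have "W - tpart Y W x = (\<Sum>i\<in>UNIV. (?f i \<bullet> (W - tpart Y W x)) *\<^sub>R ?f i)"
    by (rule orthonormal_expansion) (auto simp: b \<nu> b\<nu> card split: sum.splits)
  also have "\<dots> = (\<Sum>i\<in>UNIV. (b i \<bullet> (W - tpart Y W x)) *\<^sub>R b i)
      + (\<Sum>\<alpha>\<in>UNIV. (\<nu> \<alpha> \<bullet> (W - tpart Y W x)) *\<^sub>R \<nu> \<alpha>)"
    by (simp add: UNIV_Plus_UNIV[symmetric] sum.Plus del: UNIV_Plus_UNIV)
  also have "(\<Sum>i\<in>UNIV. (b i \<bullet> (W - tpart Y W x)) *\<^sub>R b i) = 0"
  proof (intro sum.neutral ballI)
    fix i
    obtain v where "b i = frechet_derivative Y (at x) v" using b(2)[of i] by auto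
    then show "(b i \<bullet> (W - tpart Y W x)) *\<^sub>R b i = 0"
      by (simp add: inner_diff_right inner_tpart[OF x])
  qed
  also have "(\<Sum>\<alpha>\<in>UNIV. (\<nu> \<alpha> \<bullet> (W - tpart Y W x)) *\<^sub>R \<nu> \<alpha>) = (\<Sum>\<alpha>\<in>UNIV. (\<nu> \<alpha> \<bullet> W) *\<^sub>R \<nu> \<alpha>)"
    by (simp add: inner_diff_right \<nu>(2) tpart_def)
  finally show ?thesis by simp
qed

text \<open>The tangential vectors come from the coordinate fields, the remaining ones from
  extending the frame. The latter are normal for free, since the former already span the tangent
  space.\<close>

lemma adapted_frame_exists:
  assumes card: "DIM('v) = CARD('n) + CARD('k)" and x: "x \<in> U"
  obtains V and F :: "'n + 'k::finite \<Rightarrow> real^'n \<Rightarrow> 'v" where "open V" "x \<in> V" "V \<subseteq> U"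
    "\<And>i. smooth_on V (F i)" "\<And>i j q. q \<in> V \<Longrightarrow> F i q \<bullet> F j q = (if i = j then 1 else 0)"
    "\<And>i q. q \<in> V \<Longrightarrow> F (Inl i) q \<in> range (frechet_derivative Y (at q))"
    "\<And>\<alpha> q v. q \<in> V \<Longrightarrow> F (Inr \<alpha>) q \<bullet> frechet_derivative Y (at q) v = 0"
proof -
  from partial_tangent_frame_exists[OF x finite[of UNIV]]
  obtain V1 and e :: "'n \<Rightarrow> real^'n \<Rightarrow> 'v" where H: "open V1 \<and> x \<in> V1 \<and> V1 \<subseteq> U \<and> (\<forall>i\<in>UNIV. smooth_on V1 (e i)) \<and>
    (\<forall>i\<in>UNIV. \<forall>j\<in>UNIV. \<forall>q\<in>V1. e i q \<bullet> e j q = (if i = j then 1 else 0)) \<and>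
    (\<forall>i\<in>UNIV. \<forall>q\<in>V1. e i q \<in> span (range (\<lambda>j. partial Y j q)))"
    by (elim exE) (rule that)
  have e: "open V1" "x \<in> V1" "V1 \<subseteq> U" "\<And>i. smooth_on V1 (e i)"
    "\<And>i j q. q \<in> V1 \<Longrightarrow> e i q \<bullet> e j q = (if i = j then 1 else 0)"
    "\<And>i q. q \<in> V1 \<Longrightarrow> e i q \<in> span (range (\<lambda>j. partial Y j q))"
    using H by blast+
  \<comment> \<open>The value 0 on \<open>Inr\<close> is a placeholder: only the fields with index
    in \<open>range Inl\<close> are prescribed for the extension.\<close>
  let ?f = "case_sum e (\<lambda>\<alpha> q. 0) :: 'n + 'k \<Rightarrow> real^'n \<Rightarrow> 'v"
  have cI: "card (range Inl :: ('n + 'k) set) = CARD('n)" and cJ: "card (range Inr :: ('n + 'k) set) = CARD('k)"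
    by (simp_all add: card_image)
  have un: "range Inl \<union> range Inr = (UNIV :: ('n + 'k) set)"
    by (simp add: UNIV_sum)
  have "\<exists>V F. open V \<and> x \<in> V \<and> V \<subseteq> V1 \<and> (\<forall>i\<in>range Inl. F i = ?f i) \<and>
      (\<forall>i\<in>range Inl \<union> range Inr. smooth_on V (F i)) \<and>
      (\<forall>i\<in>range Inl \<union> range Inr. \<forall>j\<in>range Inl \<union> range Inr. \<forall>q\<in>V. F i q \<bullet> F j q = (if i = j then 1 else 0))"
    by (rule extend_orthonormal_frame[OF _ _ _ _ e(1,2)]) (auto simp: cI cJ card e(4,5) split: if_splits)
  then obtain V F where HF: "open V \<and> x \<in> V \<and> V \<subseteq> V1 \<and> (\<forall>i\<in>range Inl. F i = ?f i) \<and>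
      (\<forall>i\<in>range Inl \<union> range Inr. smooth_on V (F i)) \<and>
      (\<forall>i\<in>range Inl \<union> range Inr. \<forall>j\<in>range Inl \<union> range Inr. \<forall>q\<in>V. F i q \<bullet> F j q = (if i = j then 1 else 0))"
    by (elim exE) (rule that)
  have F: "open V" "x \<in> V" "V \<subseteq> V1"
    "\<And>i. F (Inl i) = e i" "\<And>i. smooth_on V (F i)"
    "\<And>i j q. q \<in> V \<Longrightarrow> F i q \<bullet> F j q = (if i = j then 1 else 0)"
    using HF unfolding un by auto
  have rng: "F (Inl i) q \<in> range (frechet_derivative Y (at q))" if "q \<in> V" for i q
  proof -
    have "q \<in> V1" "q \<in> U" using that F(3) e(3) by auto
    then show ?thesis unfolding F(4) range_D_eq_span[OF \<open>q \<in> U\<close>] by (intro e(6))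
  qed
  have "F (Inr \<alpha>) q \<bullet> frechet_derivative Y (at q) v = 0" if q: "q \<in> V" for \<alpha> q v
  proof -
    have qU: "q \<in> U" using q F(3) e(3) by auto
    have "range (frechet_derivative Y (at q)) \<subseteq> span (range (\<lambda>i. F (Inl i) q))"
      by (rule tangent_frame_spans[OF qU _ rng[OF q]]) (simp add: F(6)[OF q])
    then have "frechet_derivative Y (at q) v \<in> span (range (\<lambda>i. F (Inl i) q))" by blast
    moreover have "orthogonal (F (Inr \<alpha>) q) w" if "w \<in> range (\<lambda>i. F (Inl i) q)" for w
      using that by (auto simp: orthogonal_def F(6)[OF q])
    ultimately have "orthogonal (F (Inr \<alpha>) q) (frechet_derivative Y (at q) v)"
      using orthogonal_to_span by blast
    then show ?thesis by (simp add: orthogonal_def)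
  qed
  moreover have "V \<subseteq> U" using F(3) e(3) by blast
  ultimately show ?thesis
    using F(1,2,5,6) rng by (intro that[of V F]) auto
qed

end

section \<open>Immersed manifolds and translating solitons\<close>

locale atlas =
  fixes A :: "('m::{t2_space, second_countable_topology}, 'n::finite) chart set"
  assumes atlas: "smooth_atlas A"
begin

definition img :: "('m, 'n) chart \<Rightarrow> (real^'n) set" where
  "img c = snd c ` fst c"

lemma open_dom: "c \<in> A \<Longrightarrow> open (fst c)"
  and open_img: "c \<in> A \<Longrightarrow> open (img c)"
  and homeo: "c \<in> A \<Longrightarrow> homeomorphism (fst c) (img c) (snd c) (chart_inv c)"
  using atlas unfolding smooth_atlas_def img_def by auto

lemma chart_at: obtains c where "c \<in> A" "p \<in> fst c"
  using atlas unfolding smooth_atlas_def by blast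

lemma inv_left: "c \<in> A \<Longrightarrow> p \<in> fst c \<Longrightarrow> chart_inv c (snd c p) = p"
  and inv_right: "c \<in> A \<Longrightarrow> x \<in> img c \<Longrightarrow> snd c (chart_inv c x) = x"
  and inv_dom: "c \<in> A \<Longrightarrow> x \<in> img c \<Longrightarrow> chart_inv c x \<in> fst c"
  and chart_img: "p \<in> fst c \<Longrightarrow> snd c p \<in> img c"
  and cont_chart: "c \<in> A \<Longrightarrow> continuous_on (fst c) (snd c)"
  and cont_inv: "c \<in> A \<Longrightarrow> continuous_on (img c) (chart_inv c)"
  using homeo unfolding homeomorphism_def img_def by blast+

lemma chart_image_eq:
  assumes "c \<in> A" "N \<subseteq> fst c"
  shows "snd c ` N = img c \<inter> chart_inv c -` N"
proof (intro set_eqI iffI)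
  fix x assume "x \<in> snd c ` N"
  then obtain p where p: "p \<in> N" "x = snd c p" by auto
  with assms(2) have "p \<in> fst c" by auto
  with p show "x \<in> img c \<inter> chart_inv c -` N"
    using inv_left[OF assms(1)] chart_img by simp
next
  fix x assume x: "x \<in> img c \<inter> chart_inv c -` N"
  then show "x \<in> snd c ` N"
    using inv_right[OF assms(1), of x] by (intro image_eqI[of _ _ "chart_inv c x"]) auto
qed

lemma inv_image_eq:
  assumes "c \<in> A" "V \<subseteq> img c"
  shows "chart_inv c ` V = fst c \<inter> snd c -` V"
proof (intro set_eqI iffI)
  fix p assume "p \<in> chart_inv c ` V"
  then obtain x where x: "x \<in> V" "p = chart_inv c x" by auto
  with assms(2) have "x \<in> img c" by auto
  with x show "p \<in> fst c \<inter> snd c -` V"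
    using inv_right[OF assms(1)] inv_dom[OF assms(1)] by simp
next
  fix p assume p: "p \<in> fst c \<inter> snd c -` V"
  then show "p \<in> chart_inv c ` V"
    using inv_left[OF assms(1), of p] by (intro image_eqI[of _ _ "snd c p"]) auto
qed

lemma open_chart_image: "c \<in> A \<Longrightarrow> open N \<Longrightarrow> N \<subseteq> fst c \<Longrightarrow> open (snd c ` N)"
  by (simp add: chart_image_eq continuous_open_preimage cont_inv open_img)

lemma open_inv_image: "c \<in> A \<Longrightarrow> open V \<Longrightarrow> V \<subseteq> img c \<Longrightarrow> open (chart_inv c ` V)"
  by (simp add: inv_image_eq continuous_open_preimage cont_chart open_dom)

lemma transition_smooth: "c \<in> A \<Longrightarrow> d \<in> A \<Longrightarrow> smooth_on (snd c ` (fst c \<inter> fst d)) (snd d \<circ> chart_inv c)"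
  using atlas unfolding smooth_atlas_def by blast

lemma open_overlap: "c \<in> A \<Longrightarrow> d \<in> A \<Longrightarrow> open (snd c ` (fst c \<inter> fst d))"
  by (intro open_chart_image open_Int open_dom) auto

lemma transition_has_derivative:
  assumes "c \<in> A" "d \<in> A" "p \<in> fst c" "p \<in> fst d"
  shows "((snd d \<circ> chart_inv c) has_derivative chart_diff c (snd d) p) (at (snd c p))"
  unfolding chart_diff_def
  using Ck_on_Suc_has_derivative[OF smooth_onD[OF transition_smooth[OF assms(1,2)], of "Suc 0"]] assms(3,4)
  by blast

lemma chart_diff_change:
  fixes f :: "'m \<Rightarrow> 'v::real_normed_vector"
  assumes c: "c \<in> A" "p \<in> fst c" and d: "d \<in> A" "p \<in> fst d"
    and f: "(f \<circ> chart_inv d) differentiable (at (snd d p))"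
  shows "((f \<circ> chart_inv c) has_derivative (\<lambda>v. chart_diff d f p (chart_diff c (snd d) p v))) (at (snd c p))"
proof -
  have 1: "((f \<circ> chart_inv d) has_derivative chart_diff d f p) (at ((snd d \<circ> chart_inv c) (snd c p)))"
    using f inv_left[OF c] by (simp add: chart_diff_def frechet_derivative_works[symmetric])
  have "((\<lambda>x. (f \<circ> chart_inv d) ((snd d \<circ> chart_inv c) x)) has_derivative
      (\<lambda>v. chart_diff d f p (chart_diff c (snd d) p v))) (at (snd c p))"
    by (rule has_derivative_compose[OF transition_has_derivative[OF c(1) d(1) c(2) d(2)] 1])
  then show ?thesis
  proof (rule has_derivative_transform_within_open)
    show "open (snd c ` (fst c \<inter> fst d))" by (rule open_overlap[OF c(1) d(1)])
    show "snd c p \<in> snd c ` (fst c \<inter> fst d)" using c d by auto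
    show "(f \<circ> chart_inv d) ((snd d \<circ> chart_inv c) x) = (f \<circ> chart_inv c) x"
      if "x \<in> snd c ` (fst c \<inter> fst d)" for x
      using that inv_left[OF c(1)] inv_left[OF d(1)] by auto
  qed
qed

lemma chart_diff_change_eq:
  fixes f :: "'m \<Rightarrow> 'v::real_normed_vector"
  assumes "c \<in> A" "p \<in> fst c" "d \<in> A" "p \<in> fst d" "(f \<circ> chart_inv d) differentiable (at (snd d p))"
  shows "chart_diff c f p v = chart_diff d f p (chart_diff c (snd d) p v)"
  using frechet_derivative_at[OF chart_diff_change[OF assms], symmetric] by (simp add: chart_diff_def)

text \<open>The version of \<open>smooth_map_on\<close> with finite order; the cutoff and bump
  functions below are only C^1.\<close>

definition Ck_map :: "nat \<Rightarrow> 'm set \<Rightarrow> ('m \<Rightarrow> 'v::real_normed_vector) \<Rightarrow> bool" where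
  "Ck_map r N f \<longleftrightarrow> (\<forall>c\<in>A. Ck_on r (snd c ` (fst c \<inter> N)) (f \<circ> chart_inv c))"

lemma smooth_map_on_iff_Ck_map: "smooth_map_on A N f \<longleftrightarrow> (\<forall>r. Ck_map r N f)"
  by (auto simp: smooth_map_on_def smooth_on_def Ck_map_def)

text \<open>Regularity seen in one chart passes to all others, because the coordinate expressions
  differ by a smooth transition map.\<close>

lemma Ck_map_chart:
  assumes c: "c \<in> A" and N: "open N" "N \<subseteq> fst c" and E: "open V" "Ck_on r V E"
    and f: "\<And>p. p \<in> N \<Longrightarrow> snd c p \<in> V \<and> f p = E (snd c p)"
  shows "Ck_map r N f"
  unfolding Ck_map_def
proof
  fix d assume d: "d \<in> A"
  let ?S = "snd d ` (fst d \<inter> N)"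
  have S: "open ?S" by (intro open_chart_image d open_Int open_dom N) auto
  have "Ck_on r ?S (snd c \<circ> chart_inv d)"
    by (rule Ck_on_subset[OF smooth_onD[OF transition_smooth[OF d c]]]) (use N in auto)
  then have "Ck_on r ?S (\<lambda>x. E ((snd c \<circ> chart_inv d) x))"
    using E(2) by (rule Ck_on_compose[OF S E(1), rotated]) (use inv_left[OF d] f in auto)
  then show "Ck_on r ?S (f \<circ> chart_inv d)"
    by (subst Ck_on_cong[OF S, of _ "\<lambda>x. E ((snd c \<circ> chart_inv d) x)"]) (use inv_left[OF d] f in auto)
qed

lemma Ck_map_at_chart: "Ck_map r UNIV f \<Longrightarrow> c \<in> A \<Longrightarrow> Ck_on r (img c) (f \<circ> chart_inv c)"
  by (auto simp: Ck_map_def img_def)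

lemma Ck_map_local:
  assumes "\<And>p. \<exists>N. open N \<and> p \<in> N \<and> Ck_map r N f"
  shows "Ck_map r UNIV f"
  unfolding Ck_map_def
proof (intro ballI Ck_on_local)
  fix c x assume c: "c \<in> A" "x \<in> snd c ` (fst c \<inter> UNIV)"
  then obtain p where p: "p \<in> fst c" "x = snd c p" by auto
  obtain N where N: "open N" "p \<in> N" "Ck_map r N f" using assms by blast
  have "open (snd c ` (fst c \<inter> N))" by (intro open_chart_image c open_Int open_dom N) auto
  then show "\<exists>T. open T \<and> x \<in> T \<and> Ck_on r T (f \<circ> chart_inv c)"
    using N p c(1) unfolding Ck_map_def by blast
qed

lemma Ck_map_cong:
  assumes "open N" "\<And>p. p \<in> N \<Longrightarrow> f p = g p" "Ck_map r N f"
  shows "Ck_map r N g"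
  unfolding Ck_map_def
proof
  fix c assume c: "c \<in> A"
  have "open (snd c ` (fst c \<inter> N))" by (intro open_chart_image c open_Int open_dom assms) auto
  moreover have "(f \<circ> chart_inv c) x = (g \<circ> chart_inv c) x" if "x \<in> snd c ` (fst c \<inter> N)" for x
    using that assms(2) inv_left[OF c] by auto
  ultimately show "Ck_on r (snd c ` (fst c \<inter> N)) (g \<circ> chart_inv c)"
    using assms(3) c Ck_on_cong unfolding Ck_map_def by blast
qed

lemma Ck_map_imp_continuous_on:
  fixes f :: "'m \<Rightarrow> 'v::real_normed_vector"
  assumes "Ck_map r UNIV f"
  shows "continuous_on UNIV f"
proof (intro continuous_at_imp_continuous_on ballI)
  fix p
  obtain c where c: "c \<in> A" "p \<in> fst c" by (rule chart_at)
  have "continuous_on (img c) (f \<circ> chart_inv c)"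
    by (rule Ck_on_imp_continuous_on[OF Ck_map_at_chart[OF assms c(1)]])
  then have "continuous_on (fst c) (\<lambda>q. (f \<circ> chart_inv c) (snd c q))"
    by (rule continuous_on_compose2[OF _ cont_chart[OF c(1)]]) (auto simp: img_def)
  then have "continuous_on (fst c) f"
    by (rule continuous_on_eq) (simp add: inv_left[OF c(1)])
  then show "isCont f p" using c open_dom continuous_on_eq_continuous_at by blast
qed

end

locale immersed = atlas A for A :: "('m::{t2_space, second_countable_topology}, 'n::finite) chart set" +
  fixes X :: "'m \<Rightarrow> 'v::euclidean_space"
  assumes immersion: "immersion A X"
begin

lemma Ck_map_X: "Ck_map r UNIV X"
  using immersion unfolding immersion_def smooth_map_on_iff_Ck_map by blast

lemma continuous_X: "continuous_on UNIV X"
  using Ck_map_X by (rule Ck_map_imp_continuous_on)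

lemma patch: "c \<in> A \<Longrightarrow> immersed_patch (X \<circ> chart_inv c) (img c)"
proof
  assume c: "c \<in> A"
  show "open (img c)" using c by (rule open_img)
  show "smooth_on (img c) (X \<circ> chart_inv c)"
    unfolding smooth_on_def using Ck_map_at_chart[OF Ck_map_X c] by blast
  show "inj (frechet_derivative (X \<circ> chart_inv c) (at x))" if "x \<in> img c" for x
    using immersion c that unfolding immersion_def chart_diff_def img_def by auto
qed

lemma X_differentiable: "c \<in> A \<Longrightarrow> p \<in> fst c \<Longrightarrow> (X \<circ> chart_inv c) differentiable (at (snd c p))"
  by (rule differentiableI[OF immersed_patch.has_derivative_Y[OF patch chart_img]])

lemma inj_chart_diff: "c \<in> A \<Longrightarrow> p \<in> fst c \<Longrightarrow> inj (chart_diff c X p)"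
  unfolding chart_diff_def by (rule immersed_patch.inj[OF patch chart_img])

text \<open>By the chain rule the range belonging to any other chart at \<open>p\<close> lies in
  that of \<open>c\<close>, so the union in the definition collapses.\<close>

lemma tangent_space_eq:
  assumes c: "c \<in> A" "p \<in> fst c"
  shows "tangent_space A X p = range (chart_diff c X p)"
proof -
  have "range (chart_diff d X p) \<subseteq> range (chart_diff c X p)" if d: "d \<in> A" "p \<in> fst d" for d
    using chart_diff_change_eq[OF d c X_differentiable[OF c]] by auto
  then show ?thesis unfolding tangent_space_def using c by blast
qed

text \<open>The description inside \<open>dir_deriv\<close> is unique: injectivity of the
  differential determines the coordinate vector from its tangent vector, and the chain rule handles
  a change of chart.\<close>

lemma dir_deriv_eq:
  assumes c: "c \<in> A" "p \<in> fst c" and f: "(f \<circ> chart_inv c) differentiable (at (snd c p))"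
  shows "dir_deriv A X f p (chart_diff c X p v) = chart_diff c f p v"
  unfolding dir_deriv_def
proof (rule the_equality)
  show "\<exists>d\<in>A. p \<in> fst d \<and> (\<exists>v'. chart_diff d X p v' = chart_diff c X p v \<and> chart_diff d f p v' = chart_diff c f p v)"
    using c by blast
next
  fix z assume "\<exists>d\<in>A. p \<in> fst d \<and> (\<exists>v'. chart_diff d X p v' = chart_diff c X p v \<and> chart_diff d f p v' = z)"
  then obtain d v' where d: "d \<in> A" "p \<in> fst d" and v': "chart_diff d X p v' = chart_diff c X p v" "chart_diff d f p v' = z"
    by blast
  have "chart_diff c X p (chart_diff d (snd c) p v') = chart_diff c X p v"
    using v'(1) chart_diff_change_eq[OF d c X_differentiable[OF c]] by simp
  then have "chart_diff d (snd c) p v' = v"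
    using inj_chart_diff[OF c] by (metis injD)
  then show "z = chart_diff c f p v"
    using v'(2) chart_diff_change_eq[OF d c f] by simp
qed

definition tang :: "'v \<Rightarrow> 'm \<Rightarrow> 'v" where
  "tang W p = (let c = (SOME c. c \<in> A \<and> p \<in> fst c) in tpart (X \<circ> chart_inv c) W (snd c p))"

text \<open>The projections computed in two charts both lie in the tangent space and have the same
  inner product as \<open>W\<close> with every tangent vector. Their difference is therefore
  orthogonal to itself, and the arbitrary choice in \<open>tang\<close> is harmless.\<close>

lemma tang_eq:
  assumes c: "c \<in> A" "p \<in> fst c"
  shows "tang W p = tpart (X \<circ> chart_inv c) W (snd c p)"
proof -
  define d where "d = (SOME c. c \<in> A \<and> p \<in> fst c)"
  have d: "d \<in> A" "p \<in> fst d"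
    using someI[of "\<lambda>c. c \<in> A \<and> p \<in> fst c" c] c by (auto simp: d_def)
  let ?tc = "tpart (X \<circ> chart_inv c) W (snd c p)" and ?td = "tpart (X \<circ> chart_inv d) W (snd d p)"
  have tc: "w \<bullet> ?tc = w \<bullet> W" "?tc \<in> tangent_space A X p" if "w \<in> tangent_space A X p" for w
    using that immersed_patch.inner_tpart[OF patch[OF c(1)] chart_img[OF c(2)], of _ W]
    by (auto simp: tangent_space_eq[OF c] chart_diff_def tpart_def)
  have td: "w \<bullet> ?td = w \<bullet> W" "?td \<in> tangent_space A X p" if "w \<in> tangent_space A X p" for w
    using that immersed_patch.inner_tpart[OF patch[OF d(1)] chart_img[OF d(2)], of _ W]
    by (auto simp: tangent_space_eq[OF d] chart_diff_def tpart_def)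
  have ts: "?tc \<in> tangent_space A X p" "?td \<in> tangent_space A X p"
    using tangent_space_eq[OF c] tangent_space_eq[OF d] by (auto simp: tpart_def chart_diff_def)
  have "?tc \<bullet> ?tc = ?tc \<bullet> W" "?tc \<bullet> ?td = ?tc \<bullet> W" "?td \<bullet> ?td = ?td \<bullet> W" "?td \<bullet> ?tc = ?td \<bullet> W"
    using tc(1) td(1) ts by blast+
  then have "(?td - ?tc) \<bullet> (?td - ?tc) = 0"
    by (simp add: inner_diff_left inner_diff_right inner_commute)
  then show ?thesis
    by (simp add: tang_def d_def[symmetric])
qed

end

locale soliton = immersed A X
  for A :: "('m::{t2_space, second_countable_topology}, 'n::finite) chart set"
    and X :: "'m \<Rightarrow> real^('n + 'k::finite)" +
  fixes W :: "real^('n + 'k)"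
  assumes W: "norm W = 1" and soliton: "translating_soliton A X W"
begin

lemma frame_normal_part:
  assumes F: "local_frames A X N e \<nu>" and p: "p \<in> N"
  shows "W - tang W p = (\<Sum>\<alpha>\<in>UNIV. (\<nu> \<alpha> p \<bullet> W) *\<^sub>R \<nu> \<alpha> p)"
proof -
  obtain c where c: "c \<in> A" "p \<in> fst c" by (rule chart_at)
  interpret immersed_patch "X \<circ> chart_inv c" "img c" by (rule patch[OF c(1)])
  have ts: "tangent_space A X p = range (frechet_derivative (X \<circ> chart_inv c) (at (snd c p)))"
    using tangent_space_eq[OF c] by (simp add: chart_diff_def)
  have e: "\<And>i j. e i p \<bullet> e j p = (if i = j then 1 else 0)" "\<And>i. e i p \<in> tangent_space A X p"
    and \<nu>: "\<And>\<alpha> \<beta>. \<nu> \<alpha> p \<bullet> \<nu> \<beta> p = (if \<alpha> = \<beta> then 1 else 0)" "\<And>\<alpha>. \<nu> \<alpha> p \<in> normal_space A X p"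
    using F p unfolding local_frames_def tangent_frame_def normal_frame_def by blast+
  have "\<nu> \<alpha> p \<bullet> frechet_derivative (X \<circ> chart_inv c) (at (snd c p)) v = 0" for \<alpha> v
    using \<nu>(2)[of \<alpha>] by (auto simp: normal_space_def orthogonal_comp_def ts orthogonal_def inner_commute)
  then show ?thesis
    unfolding tang_eq[OF c]
    using e \<nu>(1) chart_img[OF c(2)] by (intro normal_part_eq[of _ "\<lambda>i. e i p"]) (auto simp: ts)
qed

lemma frame_mean_curvature:
  "local_frames A X N e \<nu> \<Longrightarrow> p \<in> N \<Longrightarrow> mean_curvature A X e \<nu> \<alpha> p = \<nu> \<alpha> p \<bullet> W"
  using soliton unfolding translating_soliton_def by blast

text \<open>This supplies actual instances for the quantifier over frames in
  \<open>translating_soliton\<close> and \<open>mean_curvature_vector\<close>, and keeps their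
  coordinate expressions \<open>F\<close> at hand for differentiation.\<close>

lemma adapted_chart_frame:
  assumes c: "c \<in> A" and x: "x \<in> img c"
  obtains V F where "open V" "x \<in> V" "V \<subseteq> img c" "\<And>i. smooth_on V (F i)"
    "local_frames A X (chart_inv c ` V) (\<lambda>i p. F (Inl i) (snd c p)) (\<lambda>\<alpha> p. F (Inr \<alpha>) (snd c p))"
proof -
  interpret immersed_patch "X \<circ> chart_inv c" "img c" by (rule patch[OF c(1)])
  obtain V and F :: "'n + 'k \<Rightarrow> real^'n \<Rightarrow> real^('n + 'k)" where F: "open V" "x \<in> V" "V \<subseteq> img c"
    "\<And>i. smooth_on V (F i)" "\<And>i j q. q \<in> V \<Longrightarrow> F i q \<bullet> F j q = (if i = j then 1 else 0)"
    "\<And>i q. q \<in> V \<Longrightarrow> F (Inl i) q \<in> range (frechet_derivative (X \<circ> chart_inv c) (at q))"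
    "\<And>\<alpha> q v. q \<in> V \<Longrightarrow> F (Inr \<alpha>) q \<bullet> frechet_derivative (X \<circ> chart_inv c) (at q) v = 0"
    by (rule adapted_frame_exists[where 'k='k, OF _ x]) auto
  let ?N = "chart_inv c ` V"
  have N: "open ?N" "?N \<subseteq> fst c" "\<And>p. p \<in> ?N \<Longrightarrow> snd c p \<in> V"
    using open_inv_image[OF c F(1,3)] inv_image_eq[OF c F(3)] by auto
  have sm: "smooth_map_on A ?N (\<lambda>p. F i (snd c p))" for i
    unfolding smooth_map_on_iff_Ck_map
    using F(4)[of i] N(3) by (intro allI Ck_map_chart[OF c N(1,2) F(1), of _ "F i"]) (auto simp: smooth_on_def)
  have ts: "tangent_space A X p = range (frechet_derivative (X \<circ> chart_inv c) (at (snd c p)))" if "p \<in> ?N" for p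
    using tangent_space_eq[OF c, of p] N(2) that by (auto simp: chart_diff_def)
  have "local_frames A X ?N (\<lambda>i p. F (Inl i) (snd c p)) (\<lambda>\<alpha> p. F (Inr \<alpha>) (snd c p))"
    unfolding local_frames_def tangent_frame_def normal_frame_def
    using N sm F(5-7) by (auto simp: ts normal_space_def orthogonal_comp_def orthogonal_def inner_commute)
  with F show ?thesis by (intro that[of V F])
qed

text \<open>In an adapted frame the surface divergence is minus the sum of the products of
  \<open>\<nu> \<alpha> \<bullet> W\<close> with the mean curvatures. The soliton equation turns
  each mean curvature into \<open>\<nu> \<alpha> \<bullet> W\<close>, and the squares add up to the
  squared length of the normal part.\<close>

lemma surface_div_tpart_soliton:
  assumes c: "c \<in> A" and x: "x \<in> img c"
  shows "surface_div (X \<circ> chart_inv c) (tpart (X \<circ> chart_inv c) W) x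
      = - (norm (W - tpart (X \<circ> chart_inv c) W x))\<^sup>2"
proof -
  interpret immersed_patch "X \<circ> chart_inv c" "img c" by (rule patch[OF c(1)])
  let ?Y = "X \<circ> chart_inv c"
  obtain V F where V: "open V" "x \<in> V" "V \<subseteq> img c" and sF: "\<And>i. smooth_on V (F i)"
    and fr: "local_frames A X (chart_inv c ` V) (\<lambda>i p. F (Inl i) (snd c p)) (\<lambda>\<alpha> p. F (Inr \<alpha>) (snd c p))"
    by (rule adapted_chart_frame[OF c x]) (rule that)
  let ?e = "\<lambda>i p. F (Inl i) (snd c p)" and ?\<nu> = "\<lambda>\<alpha> p. F (Inr \<alpha>) (snd c p)"
  define p where "p = chart_inv c x"
  have p: "p \<in> chart_inv c ` V" "p \<in> fst c" "snd c p = x"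
    using V x c by (auto simp: p_def inv_dom inv_right)
  have D: "F i differentiable (at x)" for i
    using smooth_onD[OF sF, of "Suc 0" i] V(2) by auto
  have on: "\<And>i j. F (Inl i) x \<bullet> F (Inl j) x = (if i = j then 1 else 0)" "\<And>i. F (Inl i) x \<in> tangent_space A X p"
    and \<nu>: "\<And>\<alpha> \<beta>. F (Inr \<alpha>) x \<bullet> F (Inr \<beta>) x = (if \<alpha> = \<beta> then 1 else 0)"
      "\<And>\<alpha>. F (Inr \<alpha>) x \<in> normal_space A X p"
    using fr p unfolding local_frames_def tangent_frame_def normal_frame_def by blast+
  have "\<forall>i. \<exists>v. F (Inl i) x = chart_diff c X p v"
    using on(2) unfolding tangent_space_eq[OF c p(2)] by blast
  then have "\<exists>a. \<forall>i. F (Inl i) x = chart_diff c X p (a i)" by (rule choice)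
  then obtain a where a: "\<And>i. F (Inl i) x = frechet_derivative ?Y (at x) (a i)"
    by (auto simp: chart_diff_def p(3))
  have perp: "F (Inr \<alpha>) x \<bullet> partial ?Y i x = 0" for \<alpha> i
    using \<nu>(2)[of \<alpha>]
    by (auto simp: normal_space_def orthogonal_comp_def tangent_space_eq[OF c p(2)] chart_diff_def p(3)
        orthogonal_def inner_commute)
  have dec: "W - tpart ?Y W y = (\<Sum>\<alpha>\<in>UNIV. (F (Inr \<alpha>) y \<bullet> W) *\<^sub>R F (Inr \<alpha>) y)" if y: "y \<in> V" for y
  proof -
    have "chart_inv c y \<in> chart_inv c ` V" "chart_inv c y \<in> fst c" "snd c (chart_inv c y) = y"
      using y V c by (auto simp: inv_dom inv_right subset_iff)
    then show ?thesis
      using frame_normal_part[OF fr, of "chart_inv c y"] tang_eq[OF c, of "chart_inv c y" W] by simp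
  qed
  have \<nu>D: "frechet_derivative (?\<nu> \<alpha> \<circ> chart_inv c) (at x) = frechet_derivative (F (Inr \<alpha>)) (at x)"
    and \<nu>diff: "(?\<nu> \<alpha> \<circ> chart_inv c) differentiable (at x)" for \<alpha>
  proof -
    have "(F (Inr \<alpha>) has_derivative frechet_derivative (F (Inr \<alpha>)) (at x)) (at x)"
      using D by (simp add: frechet_derivative_works[symmetric])
    then have "((?\<nu> \<alpha> \<circ> chart_inv c) has_derivative frechet_derivative (F (Inr \<alpha>)) (at x)) (at x)"
      by (rule has_derivative_transform_within_open[OF _ V(1,2)]) (use V(3) inv_right[OF c] in auto)
    then show "frechet_derivative (?\<nu> \<alpha> \<circ> chart_inv c) (at x) = frechet_derivative (F (Inr \<alpha>)) (at x)"
      "(?\<nu> \<alpha> \<circ> chart_inv c) differentiable (at x)"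
      by (auto simp: differentiable_def dest: frechet_derivative_at)
  qed
  have "dir_deriv A X (?\<nu> \<alpha>) p (?e i p) = frechet_derivative (F (Inr \<alpha>)) (at x) (a i)" for \<alpha> i
    using dir_deriv_eq[OF c p(2), of "?\<nu> \<alpha>" "a i"] \<nu>diff a[of i] by (simp add: chart_diff_def p(3) \<nu>D)
  then have mc: "(\<Sum>i\<in>UNIV. frechet_derivative (F (Inr \<alpha>)) (at x) (a i) \<bullet> frechet_derivative ?Y (at x) (a i))
      = F (Inr \<alpha>) x \<bullet> W" for \<alpha>
    using frame_mean_curvature[OF fr p(1), of \<alpha>] by (simp add: mean_curvature_def second_ff_def p(3) a)
  have "surface_div ?Y (tpart ?Y W) x = - (\<Sum>\<alpha>\<in>UNIV. (F (Inr \<alpha>) x \<bullet> W) * (F (Inr \<alpha>) x \<bullet> W))"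
    using surface_div_tpart[OF V, of a "\<lambda>\<alpha>. F (Inr \<alpha>)" W] on(1) D perp dec by (simp add: a mc)
  also have "(\<Sum>\<alpha>\<in>UNIV. (F (Inr \<alpha>) x \<bullet> W) * (F (Inr \<alpha>) x \<bullet> W)) = (norm (W - tpart ?Y W x))\<^sup>2"
    unfolding dec[OF V(2)] power2_norm_eq_inner
    by (simp add: inner_sum_left inner_sum_right \<nu>(1) if_distrib cong: if_cong)
  finally show ?thesis .
qed

text \<open>Every frame gives the same value, since the soliton equation makes the sum the expansion
  of the normal part of \<open>W\<close>; uniqueness of the described vector needs the existence of
  one frame at \<open>p\<close>.\<close>

lemma mean_curvature_vector_eq: "mean_curvature_vector A X p = - (W - tang W p)"
  unfolding mean_curvature_vector_def
proof (rule the_equality)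
  show "\<forall>N e \<nu>. local_frames A X N e \<nu> \<and> p \<in> N \<longrightarrow>
      - (W - tang W p) = - (\<Sum>\<alpha>\<in>UNIV. mean_curvature A X e \<nu> \<alpha> p *\<^sub>R \<nu> \<alpha> p)"
  proof (intro allI impI)
    fix N e \<nu> assume "local_frames A X N e \<nu> \<and> p \<in> N"
    then have "local_frames A X N e \<nu>" "p \<in> N" by auto
    then show "- (W - tang W p) = - (\<Sum>\<alpha>\<in>UNIV. mean_curvature A X e \<nu> \<alpha> p *\<^sub>R \<nu> \<alpha> p)"
      by (simp only: frame_normal_part frame_mean_curvature)
  qed
next
  fix v assume v: "\<forall>N e \<nu>. local_frames A X N e \<nu> \<and> p \<in> N \<longrightarrow>
      v = - (\<Sum>\<alpha>\<in>UNIV. mean_curvature A X e \<nu> \<alpha> p *\<^sub>R \<nu> \<alpha> p)"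
  obtain c where c: "c \<in> A" "p \<in> fst c" by (rule chart_at)
  obtain V F where V: "snd c p \<in> V"
    and fr: "local_frames A X (chart_inv c ` V) (\<lambda>i p. F (Inl i) (snd c p)) (\<lambda>\<alpha> p. F (Inr \<alpha>) (snd c p))"
    by (rule adapted_chart_frame[OF c(1) chart_img[OF c(2)]]) (rule that)
  have "p \<in> chart_inv c ` V"
    using V inv_left[OF c] by (metis imageI)
  with v fr frame_normal_part[OF fr] frame_mean_curvature[OF fr] show "v = - (W - tang W p)"
    by simp
qed

lemma norm_tang:
  "(norm (tang W p))\<^sup>2 + (norm (W - tang W p))\<^sup>2 = 1" "tang W p \<bullet> W = (norm (tang W p))\<^sup>2"
proof -
  obtain c where c: "c \<in> A" "p \<in> fst c" by (rule chart_at)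
  have "tang W p \<bullet> tang W p = tang W p \<bullet> W"
    using immersed_patch.inner_tpart[OF patch[OF c(1)] chart_img[OF c(2)], of _ W]
    unfolding tang_eq[OF c] tpart_def by blast
  moreover have "W \<bullet> W = 1" using W by (simp add: dot_square_norm)
  ultimately show "(norm (tang W p))\<^sup>2 + (norm (W - tang W p))\<^sup>2 = 1" "tang W p \<bullet> W = (norm (tang W p))\<^sup>2"
    by (simp_all add: power2_norm_eq_inner inner_diff_left inner_diff_right inner_commute)
qed

end

section \<open>Riemannian volume\<close>

lemma nn_integral_change_of_variables:
  fixes T :: "real^'n::finite \<Rightarrow> real^'n" and f :: "real^'n \<Rightarrow> ennreal"
  assumes S: "S \<in> sets borel" and TS: "T ` S \<in> sets borel"
    and T: "T \<in> borel_measurable borel"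
    and T': "\<And>x. x \<in> S \<Longrightarrow> (T has_derivative T' x) (at x)"
    and inj: "inj_on T S"
    and J: "(\<lambda>x. indicator S x * \<bar>det (matrix (T' x))\<bar>) \<in> borel_measurable borel"
    and f: "f \<in> borel_measurable borel"
  shows "(\<integral>\<^sup>+y. f y * indicator (T ` S) y \<partial>lborel)
    = (\<integral>\<^sup>+x. ennreal (indicator S x * \<bar>det (matrix (T' x))\<bar>) * f (T x) \<partial>lborel)"
proof -
  let ?j = "\<lambda>x. ennreal (indicator S x * \<bar>det (matrix (T' x))\<bar>)"
  have Tl: "T \<in> lborel \<rightarrow>\<^sub>M borel" using T by simp
  have jm: "?j \<in> borel_measurable lborel" using J by simp
  have eq: "distr (density lborel ?j) borel T = density lborel (indicator (T ` S))"
  proof (rule measure_eqI)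
    fix E assume "E \<in> sets (distr (density lborel ?j) borel T)"
    then have E: "E \<in> sets borel" by simp
    have TE: "T -` E \<in> sets borel" using measurable_sets[OF T E] by simp
    have im: "T ` (S \<inter> T -` E) = T ` S \<inter> E" by auto
    have ind: "indicator (S \<inter> T -` E) x * \<bar>det (matrix (T' x))\<bar>
        = indicator (T -` E) x * (indicator S x * \<bar>det (matrix (T' x))\<bar>)" for x
      by (simp add: indicator_inter_arith)
    have "emeasure (distr (density lborel ?j) borel T) E = emeasure (density lborel ?j) (T -` E)"
      using T E by (subst emeasure_distr) auto
    also have "\<dots> = (\<integral>\<^sup>+x. ?j x * indicator (T -` E) x \<partial>lborel)"
      using jm TE by (subst emeasure_density) auto
    also have "\<dots> = (\<integral>\<^sup>+x. ennreal (indicator (S \<inter> T -` E) x * \<bar>det (matrix (T' x))\<bar>) \<partial>lborel)"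
      by (intro nn_integral_cong) (simp add: indicator_def)
    also have "\<dots> = emeasure lborel (T ` (S \<inter> T -` E))"
    proof (rule emeasure_image_eq_nn_integral_det[symmetric])
      show "S \<inter> T -` E \<in> sets borel" using S TE by auto
      show "T ` (S \<inter> T -` E) \<in> sets borel" unfolding im using TS E by auto
      show "(\<lambda>x. indicator (S \<inter> T -` E) x * \<bar>det (matrix (T' x))\<bar>) \<in> borel_measurable borel"
        unfolding ind using TE by (intro borel_measurable_times[OF borel_measurable_indicator J])
      show "inj_on T (S \<inter> T -` E)" using inj by (rule inj_on_subset) auto
    qed (use T' in auto)
    also have "\<dots> = emeasure (density lborel (indicator (T ` S))) E"
      unfolding im using TS E by (subst emeasure_density) (auto simp: nn_integral_indicator indicator_inter_arith[symmetric])
    finally show "emeasure (distr (density lborel ?j) borel T) E = emeasure (density lborel (indicator (T ` S))) E" .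
  qed simp
  have "(\<integral>\<^sup>+y. f y * indicator (T ` S) y \<partial>lborel) = (\<integral>\<^sup>+y. f y \<partial>density lborel (indicator (T ` S)))"
    using f TS by (subst nn_integral_density) (auto simp: mult.commute)
  also have "\<dots> = (\<integral>\<^sup>+y. f y \<partial>distr (density lborel ?j) borel T)"
    by (simp add: eq)
  also have "\<dots> = (\<integral>\<^sup>+x. f (T x) \<partial>density lborel ?j)"
    using f T by (subst nn_integral_distr) auto
  also have "\<dots> = (\<integral>\<^sup>+x. ?j x * f (T x) \<partial>lborel)"
    using f T jm by (subst nn_integral_density) auto
  finally show ?thesis .
qed

text \<open>With \<open>J = matrix T'\<close> the chain rule makes the new Gram matrix the product
  of \<open>transpose J\<close>, the old one and \<open>J\<close>. This is the transformation law
  that lets the Jacobian cancel between charts.\<close>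

lemma gram_reparametrize:
  fixes Y :: "real^'n::finite \<Rightarrow> 'v::euclidean_space" and Z :: "real^'n \<Rightarrow> 'v"
  assumes Z: "\<And>v. frechet_derivative Z (at x) v = frechet_derivative Y (at y) (T' v)"
    and Y: "linear (frechet_derivative Y (at y))"
  shows "sqrt (det (gram Z x)) = \<bar>det (matrix T')\<bar> * sqrt (det (gram Y y))"
proof -
  have "gram Z x $ i $ j = (transpose (matrix T') ** (gram Y y ** matrix T')) $ i $ j" for i j
  proof -
    have "gram Z x $ i $ j = frechet_derivative Y (at y) (T' (axis i 1)) \<bullet> frechet_derivative Y (at y) (T' (axis j 1))"
      by (simp add: gram_def Z)
    also have "\<dots> = (\<Sum>l\<in>UNIV. \<Sum>k\<in>UNIV. T' (axis j 1) $ l * (T' (axis i 1) $ k * (partial Y k y \<bullet> partial Y l y)))"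
      by (subst (1 2) linear_eq_sum_axis[OF Y])
        (simp add: inner_sum_left inner_sum_right sum_distrib_left)
    also have "\<dots> = (\<Sum>k\<in>UNIV. \<Sum>l\<in>UNIV. T' (axis i 1) $ k * (T' (axis j 1) $ l * (partial Y k y \<bullet> partial Y l y)))"
      by (subst sum.swap) (simp add: mult_ac)
    finally show ?thesis
      by (simp add: matrix_matrix_mult_def transpose_def matrix_def gram_def sum_distrib_left mult_ac)
  qed
  then have "gram Z x = transpose (matrix T') ** (gram Y y ** matrix T')"
    by (simp add: vec_eq_iff)
  then have "det (gram Z x) = (det (matrix T'))\<^sup>2 * det (gram Y y)"
    by (simp add: det_mul power2_eq_square mult_ac)
  then show ?thesis by (simp add: real_sqrt_mult)
qed

lemma borel_measurable_indicator_times_continuous: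
  fixes f :: "'a::topological_space \<Rightarrow> real"
  assumes "open U" "continuous_on U f"
  shows "(\<lambda>x. indicator U x * f x) \<in> borel_measurable borel"
  using borel_measurable_continuous_on_indicator[of U f] assms by auto

section \<open>Volume in one chart, and gluing over all charts\<close>

context immersed
begin

definition vol_density :: "('m, 'n) chart \<Rightarrow> real^'n \<Rightarrow> real" where
  "vol_density c x = indicator (img c) x * sqrt (det (gram (X \<circ> chart_inv c) x))"

lemma vol_density_nonneg: "c \<in> A \<Longrightarrow> 0 \<le> vol_density c x"
  using immersed_patch.det_gram_pos[OF patch, of c x]
  by (cases "x \<in> img c") (auto simp: vol_density_def intro: less_imp_le)

lemma vol_density_measurable: "c \<in> A \<Longrightarrow> vol_density c \<in> borel_measurable borel"
proof -
  assume c: "c \<in> A"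
  have "continuous_on (img c) (\<lambda>x. sqrt (det (gram (X \<circ> chart_inv c) x)))"
    using immersed_patch.Ck_sqrt_det_gram[OF patch[OF c]] by (rule Ck_on_imp_continuous_on)
  then show ?thesis
    unfolding vol_density_def[abs_def] by (intro borel_measurable_indicator_times_continuous open_img c)
qed

text \<open>The constant value outside the image makes this a Borel map on all of R^n, while
  continuity of \<open>chart_inv\<close> is known on the image only. \<open>vol_density\<close>
  vanishes outside, so the constant carries no mass.\<close>

definition chart_param :: "('m, 'n) chart \<Rightarrow> real^'n \<Rightarrow> 'm" where
  "chart_param c x = (if x \<in> img c then chart_inv c x else undefined)"

lemma chart_param_measurable: "c \<in> A \<Longrightarrow> chart_param c \<in> borel_measurable borel"
proof -
  assume c: "c \<in> A"
  have "chart_inv c \<in> borel_measurable (restrict_space borel (img c))"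
    using cont_inv[OF c] by (rule borel_measurable_continuous_on_restrict)
  then have "(\<lambda>x. if x \<in> img c then chart_inv c x else undefined) \<in> borel_measurable borel"
    using open_img[OF c] by (subst measurable_If_restrict_space_iff) auto
  then show ?thesis unfolding chart_param_def[abs_def] .
qed

lemma chart_image_borel:
  assumes c: "c \<in> A" and B: "B \<in> sets borel" "B \<subseteq> fst c"
  shows "snd c ` B \<in> sets borel"
proof -
  have "snd c ` B = img c \<inter> chart_param c -` B"
    unfolding chart_image_eq[OF c B(2)] by (auto simp: chart_param_def)
  moreover have "chart_param c -` B \<in> sets borel"
    using measurable_sets[OF chart_param_measurable[OF c] B(1)] by simp
  ultimately show ?thesis using open_img[OF c] by auto
qed

definition chart_vol :: "('m, 'n) chart \<Rightarrow> 'm measure" where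
  "chart_vol c = distr (density lborel (\<lambda>x. ennreal (vol_density c x))) borel (chart_param c)"

lemma sets_chart_vol [simp]: "sets (chart_vol c) = sets borel"
  by (simp add: chart_vol_def)

lemma emeasure_chart_vol:
  assumes c: "c \<in> A" and B: "B \<in> sets borel"
  shows "emeasure (chart_vol c) B = (\<integral>\<^sup>+x. ennreal (vol_density c x) * indicator (snd c ` (B \<inter> fst c)) x \<partial>lborel)"
proof -
  have pB: "chart_param c -` B \<in> sets borel"
    using measurable_sets[OF chart_param_measurable[OF c] B] by simp
  have "emeasure (chart_vol c) B = (\<integral>\<^sup>+x. ennreal (vol_density c x) * indicator (chart_param c -` B) x \<partial>lborel)"
    unfolding chart_vol_def using chart_param_measurable[OF c] vol_density_measurable[OF c] B pB
    by (subst emeasure_distr) (auto simp: emeasure_density)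
  also have "\<dots> = (\<integral>\<^sup>+x. ennreal (vol_density c x) * indicator (snd c ` (B \<inter> fst c)) x \<partial>lborel)"
  proof (intro nn_integral_cong)
    fix x
    have "x \<in> chart_param c -` B \<longleftrightarrow> x \<in> snd c ` (B \<inter> fst c)" if "x \<in> img c"
      using that inv_dom[OF c] by (subst chart_image_eq[OF c]) (auto simp: chart_param_def)
    then show "ennreal (vol_density c x) * indicator (chart_param c -` B) x
        = ennreal (vol_density c x) * indicator (snd c ` (B \<inter> fst c)) x"
      by (cases "x \<in> img c") (simp_all add: vol_density_def indicator_def)
  qed
  finally show ?thesis .
qed

text \<open>Changing variables by the transition map produces its Jacobian, which is exactly the
  factor by which the two densities \<open>sqrt (det g)\<close> differ.\<close>

lemma chart_vol_compatible:
  assumes c: "c \<in> A" and d: "d \<in> A" and B: "B \<in> sets borel" "B \<subseteq> fst c" "B \<subseteq> fst d"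
  shows "emeasure (chart_vol c) B = emeasure (chart_vol d) B"
proof -
  define Ov where "Ov = snd c ` (fst c \<inter> fst d)"
  have Ov: "open Ov" unfolding Ov_def by (rule open_overlap[OF c d])
  let ?t = "snd d \<circ> chart_inv c"
  have Ct: "Ck_on r Ov ?t" for r
    using smooth_onD[OF transition_smooth[OF c d]] by (simp add: Ov_def)
  \<comment> \<open>The transition map is extended by zero off the overlap, so that it is Borel
    measurable on the whole space.\<close>
  define T where "T = (\<lambda>x. indicator Ov x *\<^sub>R ?t x)"
  let ?S = "snd c ` B"
  have SO: "?S \<subseteq> Ov" using B by (auto simp: Ov_def)
  have S: "?S \<in> sets borel" by (rule chart_image_borel[OF c B(1,2)])
  have TB: "T (snd c p) = snd d p" if "p \<in> B" for p
  proof -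
    have "snd c p \<in> Ov" "p \<in> fst c" using that B SO by auto
    then show ?thesis using inv_left[OF c] by (simp add: T_def)
  qed
  then have TS_eq: "T ` ?S = snd d ` B" by (force simp: image_image)
  let ?T' = "\<lambda>x. frechet_derivative ?t (at x)"
  have T': "(T has_derivative ?T' x) (at x)" if "x \<in> ?S" for x
  proof (rule has_derivative_transform_within_open[OF _ Ov])
    show "(?t has_derivative ?T' x) (at x)"
      using Ck_on_Suc_has_derivative[OF Ct[of "Suc 0"]] that SO by blast
  qed (use that SO in \<open>auto simp: T_def\<close>)
  have inj: "inj_on T ?S"
  proof (rule inj_onI)
    fix x y assume "x \<in> ?S" "y \<in> ?S" "T x = T y"
    then obtain p q where "p \<in> B" "x = snd c p" "q \<in> B" "y = snd c q" by auto
    then show "x = y" using \<open>T x = T y\<close> TB inv_left[OF d] B(3) by (metis subsetD)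
  qed
  have "Ck_on 0 Ov (\<lambda>x. det (\<chi> i j. partial ?t j x $ i))"
  proof (rule Ck_on_det[OF Ov])
    show "Ck_on 0 Ov (\<lambda>x. partial ?t j x $ i)" for i j
      using Ck_on_partial[OF Ct[of "Suc 0"], of "axis j 1"]
      by (rule Ck_on_bounded_linear[OF bounded_linear_vec_nth Ov])
  qed
  then have "continuous_on Ov (\<lambda>x. \<bar>det (matrix (?T' x))\<bar>)"
    by (auto simp: matrix_def intro: continuous_on_rabs)
  note detm = borel_measurable_indicator_times_continuous[OF Ov this]
  have "(\<lambda>x. indicator ?S x * (indicator Ov x * \<bar>det (matrix (?T' x))\<bar>)) \<in> borel_measurable borel"
    using S by (intro borel_measurable_times[OF borel_measurable_indicator detm])
  also have "(\<lambda>x. indicator ?S x * (indicator Ov x * \<bar>det (matrix (?T' x))\<bar>))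
      = (\<lambda>x. indicator ?S x * \<bar>det (matrix (?T' x))\<bar>)"
    using SO by (auto simp: fun_eq_iff indicator_def)
  finally have J: "(\<lambda>x. indicator ?S x * \<bar>det (matrix (?T' x))\<bar>) \<in> borel_measurable borel" .
  have "continuous_on Ov ?t" using Ct by (rule Ck_on_imp_continuous_on)
  then have Tm: "T \<in> borel_measurable borel"
    unfolding T_def using Ov by (intro borel_measurable_continuous_on_indicator) auto
  have TS: "T ` ?S \<in> sets borel"
    unfolding TS_eq by (rule chart_image_borel[OF d B(1,3)])
  have "emeasure (chart_vol d) B = (\<integral>\<^sup>+y. ennreal (vol_density d y) * indicator (T ` ?S) y \<partial>lborel)"
    using B(3) by (simp add: emeasure_chart_vol[OF d B(1)] TS_eq Int_absorb2)
  also have "\<dots> = (\<integral>\<^sup>+x. ennreal (indicator ?S x * \<bar>det (matrix (?T' x))\<bar>) * ennreal (vol_density d (T x)) \<partial>lborel)"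
    using vol_density_measurable[OF d]
    by (intro nn_integral_change_of_variables[OF S TS Tm T' inj J]) auto
  also have "\<dots> = (\<integral>\<^sup>+x. ennreal (vol_density c x) * indicator ?S x \<partial>lborel)"
  proof (intro nn_integral_cong)
    fix x
    show "ennreal (indicator ?S x * \<bar>det (matrix (?T' x))\<bar>) * ennreal (vol_density d (T x))
        = ennreal (vol_density c x) * indicator ?S x"
    proof (cases "x \<in> ?S")
      case True
      then obtain p where p: "p \<in> B" "x = snd c p" by auto
      then have pc: "p \<in> fst c" "p \<in> fst d" using B by auto
      have "sqrt (det (gram (X \<circ> chart_inv c) x)) = \<bar>det (matrix (?T' x))\<bar> * sqrt (det (gram (X \<circ> chart_inv d) (snd d p)))"
      proof (rule gram_reparametrize)
        show "frechet_derivative (X \<circ> chart_inv c) (at x) v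
            = frechet_derivative (X \<circ> chart_inv d) (at (snd d p)) (?T' x v)" for v
          using chart_diff_change_eq[OF c pc(1) d pc(2) X_differentiable[OF d pc(2)], of v]
          by (simp add: chart_diff_def p(2))
        show "linear (frechet_derivative (X \<circ> chart_inv d) (at (snd d p)))"
          by (rule linear_frechet_derivative[OF X_differentiable[OF d pc(2)]])
      qed
      then have "vol_density c x = \<bar>det (matrix (?T' x))\<bar> * vol_density d (T x)"
        using pc chart_img TB[OF p(1)] by (simp add: vol_density_def p(2))
      then show ?thesis
        using True vol_density_nonneg[OF d] by (simp add: ennreal_mult')
    qed simp
  qed
  also have "\<dots> = emeasure (chart_vol c) B"
    using B(2) by (simp add: emeasure_chart_vol[OF c B(1)] Int_absorb2)
  finally show ?thesis by simp
qed

text \<open>Second countability gives a countable subcover by chart domains, which is then made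
  disjoint.\<close>

lemma countable_chart_partition:
  obtains c :: "nat \<Rightarrow> ('m, 'n) chart" and D :: "nat \<Rightarrow> 'm set" where
    "\<And>n. c n \<in> A" "\<And>n. D n \<in> sets borel" "\<And>n. D n \<subseteq> fst (c n)" "disjoint_family D" "(\<Union>n. D n) = UNIV"
proof -
  obtain F where F: "F \<subseteq> fst ` A" "countable F" "\<Union>F = \<Union>(fst ` A)"
    using Lindelof[of "fst ` A"] open_dom by (metis (no_types, lifting) imageE)
  have cov: "\<Union>F = UNIV" using F(3) atlas unfolding smooth_atlas_def by simp
  then have "F \<noteq> {}" by auto
  define E where "E = from_nat_into F"
  have E: "range E = F" unfolding E_def using \<open>F \<noteq> {}\<close> F(2) by (rule range_from_nat_into)
  have "\<forall>n. \<exists>c. c \<in> A \<and> E n = fst c" using E F(1) by blast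
  then obtain c where c: "\<And>n. c n \<in> A" "\<And>n. E n = fst (c n)" by metis
  show ?thesis
  proof (rule that[of c "disjointed E"])
    have "range E \<subseteq> sets borel" using borel_open[OF open_dom[OF c(1)]] c(2) by auto
    then show "disjointed E n \<in> sets borel" for n
      using sets.range_disjointed_sets by blast
    show "disjointed E n \<subseteq> fst (c n)" for n
      using disjointed_subset[of E n] c by simp
    show "(\<Union>n. disjointed E n) = UNIV"
      using cov E by (simp add: UN_disjointed_eq)
  qed (use c disjoint_family_disjointed in auto)
qed

text \<open>The property that characterises \<open>riem_volume\<close>, with the coordinate integral
  replaced by the measure \<open>chart_vol\<close>.\<close>

definition is_volume :: "'m measure \<Rightarrow> bool" where
  "is_volume \<mu> \<longleftrightarrow> sets \<mu> = sets borel \<and>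
     (\<forall>c\<in>A. \<forall>B\<in>sets borel. B \<subseteq> fst c \<longrightarrow> emeasure \<mu> B = emeasure (chart_vol c) B)"

lemma suminf_swap_ennreal:
  fixes f :: "nat \<Rightarrow> nat \<Rightarrow> ennreal"
  shows "(\<Sum>i. \<Sum>n. f i n) = (\<Sum>n. \<Sum>i. f i n)"
proof -
  have "(\<Sum>n. \<Sum>i. f i n) = (\<Sum>n. \<integral>\<^sup>+i. f i n \<partial>count_space UNIV)"
    by (simp add: nn_integral_count_space_nat)
  also have "\<dots> = (\<integral>\<^sup>+i. (\<Sum>n. f i n) \<partial>count_space UNIV)"
    by (rule nn_integral_suminf[symmetric]) simp
  finally show ?thesis by (simp add: nn_integral_count_space_nat)
qed

text \<open>The chart measures are summed over a countable partition into Borel pieces. On a set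
  inside one chart \<open>d\<close>, compatibility replaces every summand by the measure of
  \<open>d\<close>, and countable additivity reassembles the set.\<close>

lemma is_volume_exists: "\<exists>\<mu>. is_volume \<mu>"
proof -
  obtain c and D :: "nat \<Rightarrow> 'm set" where c: "\<And>n. c n \<in> A"
    and D: "\<And>n. D n \<in> sets borel" "\<And>n. D n \<subseteq> fst (c n)" "disjoint_family D" "(\<Union>n. D n) = UNIV"
    by (rule countable_chart_partition) blast
  define m where "m = (\<lambda>B. \<Sum>n. emeasure (chart_vol (c n)) (B \<inter> D n))"
  define \<mu> where "\<mu> = measure_of UNIV (sets borel) m"
  have sets: "sets \<mu> = sets borel"
    using sets.sigma_sets_eq[of "borel :: 'm measure"] by (simp add: \<mu>_def)
  have em: "emeasure \<mu> B = m B" if B: "B \<in> sets borel" for B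
  proof (rule emeasure_measure_of[OF \<mu>_def])
    show "positive (sets \<mu>) m" by (simp add: positive_def m_def)
    show "countably_additive (sets \<mu>) m"
    proof (rule countably_additiveI)
      fix E :: "nat \<Rightarrow> 'm set" assume E: "range E \<subseteq> sets \<mu>" "disjoint_family E"
      have "(\<Sum>i. m (E i)) = (\<Sum>n. \<Sum>i. emeasure (chart_vol (c n)) (E i \<inter> D n))"
        unfolding m_def by (rule suminf_swap_ennreal)
      also have "\<dots> = (\<Sum>n. emeasure (chart_vol (c n)) (\<Union>(range E) \<inter> D n))"
      proof (rule arg_cong[where f=suminf], rule ext)
        fix n
        have "(\<Sum>i. emeasure (chart_vol (c n)) (E i \<inter> D n)) = emeasure (chart_vol (c n)) (\<Union>i. E i \<inter> D n)"
        proof (rule suminf_emeasure)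
          show "disjoint_family (\<lambda>i. E i \<inter> D n)" using E(2) unfolding disjoint_family_on_def by blast
        qed (use E(1) D(1) sets in auto)
        then show "(\<Sum>i. emeasure (chart_vol (c n)) (E i \<inter> D n)) = emeasure (chart_vol (c n)) (\<Union>(range E) \<inter> D n)"
          by (simp add: Int_UN_distrib2)
      qed
      finally show "(\<Sum>i. m (E i)) = m (\<Union>(range E))" by (simp add: m_def)
    qed
  qed (use B sets in auto)
  have "emeasure \<mu> B = emeasure (chart_vol d) B" if d: "d \<in> A" and B: "B \<in> sets borel" "B \<subseteq> fst d" for d B
  proof -
    have "emeasure \<mu> B = (\<Sum>n. emeasure (chart_vol d) (B \<inter> D n))"
      unfolding em[OF B(1)] m_def
      using B D(1,2) by (intro arg_cong[where f=suminf] ext chart_vol_compatible c d) auto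
    also have "\<dots> = emeasure (chart_vol d) (\<Union>n. B \<inter> D n)"
    proof (rule suminf_emeasure)
      show "disjoint_family (\<lambda>n. B \<inter> D n)" using D(3) unfolding disjoint_family_on_def by blast
    qed (use B D(1) in auto)
    also have "(\<Union>n. B \<inter> D n) = B" using D(4) by auto
    finally show ?thesis .
  qed
  then show ?thesis using sets unfolding is_volume_def by blast
qed

text \<open>A measure is determined by its values on Borel subsets of the pieces of a countable
  partition, and each piece lies in a chart, where the value is prescribed.\<close>

lemma is_volume_unique:
  assumes "is_volume \<mu>" "is_volume \<mu>'"
  shows "\<mu> = \<mu>'"
proof (rule measure_eqI)
  obtain c and D :: "nat \<Rightarrow> 'm set" where c: "\<And>n. c n \<in> A"
    and D: "\<And>n. D n \<in> sets borel" "\<And>n. D n \<subseteq> fst (c n)" "disjoint_family D" "(\<Union>n. D n) = UNIV"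
    by (rule countable_chart_partition) blast
  fix B assume "B \<in> sets \<mu>"
  then have B: "B \<in> sets borel" using assms by (simp add: is_volume_def)
  have BD: "B \<inter> D n \<in> sets borel" "B \<inter> D n \<subseteq> fst (c n)" for n using B D by auto
  have "emeasure \<nu> B = (\<Sum>n. emeasure (chart_vol (c n)) (B \<inter> D n))" if \<nu>: "is_volume \<nu>" for \<nu>
  proof -
    have "emeasure \<nu> (\<Union>n. B \<inter> D n) = (\<Sum>n. emeasure \<nu> (B \<inter> D n))"
    proof (rule suminf_emeasure[symmetric])
      show "disjoint_family (\<lambda>n. B \<inter> D n)" using D(3) unfolding disjoint_family_on_def by blast
    qed (use \<nu> BD(1) in \<open>auto simp: is_volume_def\<close>)
    also have "\<dots> = (\<Sum>n. emeasure (chart_vol (c n)) (B \<inter> D n))"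
    proof -
      have "emeasure \<nu> (B \<inter> D n) = emeasure (chart_vol (c n)) (B \<inter> D n)" for n
        using \<nu> BD[of n] c[of n] unfolding is_volume_def by blast
      then show ?thesis by simp
    qed
    also have "(\<Union>n. B \<inter> D n) = B" using D(4) by auto
    finally show ?thesis .
  qed
  then show "emeasure \<mu> B = emeasure \<mu>' B" using assms by simp
qed (use assms in \<open>simp add: is_volume_def\<close>)

lemma vol_density_eq:
  assumes c: "c \<in> A" and x: "x \<in> img c"
  shows "sqrt (det (metric_matrix X c (chart_inv c x))) = vol_density c x"
  using x inv_right[OF c x] by (simp add: metric_matrix_def chart_diff_def vol_density_def gram_def)

lemma riem_volume_is_volume: "is_volume (riem_volume A X)"
proof -
  have "emeasure (chart_vol c) B =
      (\<integral>\<^sup>+x\<in>snd c ` B. ennreal (sqrt (det (metric_matrix X c (chart_inv c x)))) \<partial>lborel)"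
    if c: "c \<in> A" and B: "B \<in> sets borel" "B \<subseteq> fst c" for c B
  proof -
    have "snd c ` B \<subseteq> img c" using B by (auto simp: img_def)
    then show ?thesis
      using B(2) unfolding emeasure_chart_vol[OF c B(1)]
      by (intro nn_integral_cong) (auto simp: indicator_def vol_density_eq[OF c] Int_absorb2)
  qed
  then have "riem_volume A X = (THE \<mu>. is_volume \<mu>)"
    unfolding riem_volume_def is_volume_def by (intro arg_cong[where f=The] ext) auto
  moreover have "\<exists>!\<mu>. is_volume \<mu>"
    using is_volume_exists is_volume_unique by blast
  ultimately show ?thesis by (simp add: theI')
qed

lemma sets_riem_volume [simp, measurable_cong]: "sets (riem_volume A X) = sets borel"
  using riem_volume_is_volume by (simp add: is_volume_def)

lemma space_riem_volume [simp]: "space (riem_volume A X) = UNIV"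
  using sets_eq_imp_space_eq[OF sets_riem_volume] by simp

lemma density_riem_volume_chart:
  assumes c: "c \<in> A"
  shows "density (riem_volume A X) (indicator (fst c)) = chart_vol c"
proof (rule measure_eqI)
  fix B assume "B \<in> sets (density (riem_volume A X) (indicator (fst c)))"
  then have B: "B \<in> sets borel" by simp
  have Bc: "B \<inter> fst c \<in> sets borel" using B open_dom[OF c] by auto
  have "(indicator (fst c) :: 'm \<Rightarrow> ennreal) \<in> borel_measurable (riem_volume A X)"
    by (rule borel_measurable_indicator) (simp add: open_dom[OF c])
  then have "emeasure (density (riem_volume A X) (indicator (fst c))) B = emeasure (riem_volume A X) (B \<inter> fst c)"
    using B Bc
    by (subst emeasure_density) (auto simp: nn_integral_indicator indicator_inter_arith[symmetric] Int_commute)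
  also have "\<dots> = emeasure (chart_vol c) (B \<inter> fst c)"
    using riem_volume_is_volume c Bc by (simp add: is_volume_def)
  also have "\<dots> = emeasure (chart_vol c) B"
    by (simp add: emeasure_chart_vol[OF c] B Bc)
  finally show "emeasure (density (riem_volume A X) (indicator (fst c))) B = emeasure (chart_vol c) B" .
qed simp

text \<open>For integrands that vanish off one chart, this turns integration on the manifold into
  Lebesgue integration, including the question of integrability.\<close>

lemma integral_chart:
  fixes f :: "'m \<Rightarrow> real"
  assumes c: "c \<in> A" and f: "f \<in> borel_measurable borel" and supp: "\<And>p. p \<notin> fst c \<Longrightarrow> f p = 0"
  shows "integrable (riem_volume A X) f \<longleftrightarrow> integrable lborel (\<lambda>x. vol_density c x * f (chart_param c x))" (is ?I)
    and "integral\<^sup>L (riem_volume A X) f = integral\<^sup>L lborel (\<lambda>x. vol_density c x * f (chart_param c x))" (is ?E)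
proof -
  have ind: "(\<lambda>p. indicator (fst c) p *\<^sub>R f p) = f"
    using supp by (auto simp: fun_eq_iff indicator_def)
  have d: "density (riem_volume A X) (\<lambda>p. ennreal (indicator (fst c) p)) = chart_vol c"
    using density_riem_volume_chart[OF c] by (simp add: ennreal_indicator)
  have fm: "f \<in> borel_measurable (riem_volume A X)" using f by simp
  have im: "(\<lambda>p. indicator (fst c) p :: real) \<in> borel_measurable (riem_volume A X)"
    using open_dom[OF c] by (intro borel_measurable_indicator) auto
  have gm: "(\<lambda>x. f (chart_param c x)) \<in> borel_measurable lborel"
    using f chart_param_measurable[OF c] by simp
  have pm: "chart_param c \<in> density lborel (\<lambda>x. ennreal (vol_density c x)) \<rightarrow>\<^sub>M borel"
    using chart_param_measurable[OF c] by simp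
  have nn: "AE p in riem_volume A X. 0 \<le> (indicator (fst c) p :: real)" by simp
  have nn': "AE x in lborel. 0 \<le> vol_density c x" using vol_density_nonneg[OF c] by simp
  have vm: "vol_density c \<in> borel_measurable lborel" using vol_density_measurable[OF c] by simp
  have "integrable (riem_volume A X) f \<longleftrightarrow> integrable (chart_vol c) f"
    using integrable_density[OF fm im nn] unfolding d ind ..
  also have "\<dots> \<longleftrightarrow> integrable lborel (\<lambda>x. vol_density c x * f (chart_param c x))"
    unfolding chart_vol_def integrable_distr_eq[OF pm f]
    using integrable_density[OF gm vm nn'] by simp
  finally show ?I .
  have "integral\<^sup>L (riem_volume A X) f = integral\<^sup>L (chart_vol c) f"
    using integral_density[OF fm im nn] unfolding d ind ..
  also have "\<dots> = integral\<^sup>L lborel (\<lambda>x. vol_density c x * f (chart_param c x))"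
    unfolding chart_vol_def integral_distr[OF pm f]
    using integral_density[OF gm vm nn'] by simp
  finally show ?E .
qed

lemma emeasure_riem_volume_chart_compact:
  assumes c: "c \<in> A" and K: "compact K" "K \<subseteq> img c"
  shows "emeasure (riem_volume A X) (chart_inv c ` K) < \<infinity>"
proof -
  have cp: "compact (chart_inv c ` K)"
    by (rule compact_continuous_image[OF continuous_on_subset[OF cont_inv[OF c] K(2)] K(1)])
  then have B: "chart_inv c ` K \<in> sets borel" by (intro borel_closed compact_imp_closed)
  have Bc: "chart_inv c ` K \<subseteq> fst c" using K(2) inv_dom[OF c] by auto
  have im: "snd c ` (chart_inv c ` K) = K"
    using K(2) inv_right[OF c] by (force simp: image_image)
  have "continuous_on (img c) (\<lambda>x. sqrt (det (gram (X \<circ> chart_inv c) x)))"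
    using immersed_patch.Ck_sqrt_det_gram[OF patch[OF c]] by (rule Ck_on_imp_continuous_on)
  then have "bounded ((\<lambda>x. sqrt (det (gram (X \<circ> chart_inv c) x))) ` K)"
    using K by (intro compact_imp_bounded compact_continuous_image) (auto intro: continuous_on_subset)
  then obtain C where C: "\<And>x. x \<in> K \<Longrightarrow> \<bar>sqrt (det (gram (X \<circ> chart_inv c) x))\<bar> \<le> C"
    by (auto simp: bounded_iff)
  have "emeasure (riem_volume A X) (chart_inv c ` K)
      = (\<integral>\<^sup>+x. ennreal (vol_density c x) * indicator K x \<partial>lborel)"
    using riem_volume_is_volume c B Bc by (simp add: is_volume_def emeasure_chart_vol Int_absorb2 im)
  also have "\<dots> \<le> (\<integral>\<^sup>+x. ennreal C * indicator K x \<partial>lborel)"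
  proof (rule nn_integral_mono)
    fix x
    show "ennreal (vol_density c x) * indicator K x \<le> ennreal C * indicator K x"
      using C[of x] K(2) by (cases "x \<in> K") (auto simp: vol_density_def intro!: ennreal_leI)
  qed
  also have "\<dots> = ennreal C * emeasure lborel K"
    using K by (intro nn_integral_cmult_indicator) (auto intro: borel_closed compact_imp_closed)
  also have "\<dots> < \<infinity>"
    using emeasure_compact_finite[OF K(1)] by (simp add: ennreal_mult_less_top)
  finally show ?thesis .
qed

lemma chart_ball:
  obtains c r where "c \<in> A" "p \<in> fst c" "r > 0" "cball (snd c p) r \<subseteq> img c"
proof -
  obtain c where c: "c \<in> A" "p \<in> fst c" by (rule chart_at)
  obtain r where "r > 0" "cball (snd c p) r \<subseteq> img c"
    using open_contains_cball[of "img c"] open_img[OF c(1)] chart_img[OF c(2)] by auto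
  with c show ?thesis by (rule that)
qed

text \<open>Each point has a neighbourhood of finite volume, the preimage of a ball whose closure
  lies in the chart image; finitely many of them cover \<open>K\<close>.\<close>

lemma emeasure_riem_volume_compact:
  assumes "compact K"
  shows "emeasure (riem_volume A X) K < \<infinity>"
proof -
  have "\<forall>p. \<exists>B. open B \<and> p \<in> B \<and> emeasure (riem_volume A X) B < \<infinity>"
  proof
    fix p
    obtain c r where c: "c \<in> A" "p \<in> fst c" and r: "r > 0" "cball (snd c p) r \<subseteq> img c" by (rule chart_ball)
    have "ball (snd c p) r \<subseteq> img c" using r(2) ball_subset_cball by blast
    then have o: "open (chart_inv c ` ball (snd c p) r)" by (rule open_inv_image[OF c(1) open_ball])
    have cp: "compact (chart_inv c ` cball (snd c p) r)"
      by (rule compact_continuous_image[OF continuous_on_subset[OF cont_inv[OF c(1)] r(2)]]) simp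
    have "emeasure (riem_volume A X) (chart_inv c ` ball (snd c p) r)
        \<le> emeasure (riem_volume A X) (chart_inv c ` cball (snd c p) r)"
      using cp by (intro emeasure_mono) (auto intro: borel_closed compact_imp_closed)
    also have "\<dots> < \<infinity>"
      by (rule emeasure_riem_volume_chart_compact[OF c(1) _ r(2)]) simp
    finally have fin: "emeasure (riem_volume A X) (chart_inv c ` ball (snd c p) r) < \<infinity>" .
    have "p \<in> chart_inv c ` ball (snd c p) r"
      using inv_left[OF c] r(1) by (intro image_eqI[of _ _ "snd c p"]) auto
    with o fin show "\<exists>B. open B \<and> p \<in> B \<and> emeasure (riem_volume A X) B < \<infinity>" by blast
  qed
  from choice[OF this] obtain B where
    "\<forall>p. open (B p) \<and> p \<in> B p \<and> emeasure (riem_volume A X) (B p) < \<infinity>" by (elim exE) (rule that)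
  then have B: "\<And>p. open (B p)" "\<And>p. p \<in> B p" "\<And>p. emeasure (riem_volume A X) (B p) < \<infinity>"
    by blast+
  obtain Q where Q: "finite Q" "K \<subseteq> (\<Union>p\<in>Q. B p)"
  proof (rule compactE_image[OF assms, of UNIV B])
    show "K \<subseteq> (\<Union>p\<in>UNIV. B p)" using B(2) by auto
  qed (use B(1) in auto)
  have "emeasure (riem_volume A X) K \<le> emeasure (riem_volume A X) (\<Union>p\<in>Q. B p)"
    using Q B(1) by (intro emeasure_mono) auto
  also have "\<dots> \<le> (\<Sum>p\<in>Q. emeasure (riem_volume A X) (B p))"
    using Q B(1) by (intro emeasure_subadditive_finite) auto
  also have "\<dots> < \<infinity>"
    using Q(1) B(3) by simp
  finally show ?thesis .
qed

end

section \<open>Divergence theorem on the soliton\<close>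

text \<open>The building block of all C^1 bumps and splines here. The only delicate point is 0,
  where the difference quotient is bounded by \<open>\<bar>h\<bar>\<close>.\<close>

lemma has_real_derivative_pos_part_squared:
  "((\<lambda>t::real. (max 0 t)\<^sup>2) has_real_derivative 2 * max 0 t) (at t)"
proof (cases t "0::real" rule: linorder_cases)
  case less
  have "((\<lambda>t::real. 0) has_real_derivative 2 * max 0 t) (at t)"
    using less by (auto intro!: derivative_eq_intros)
  then show ?thesis
    by (rule has_field_derivative_transform_within_open[of _ _ _ "{..<0}"]) (use less in auto)
next
  case greater
  have "((\<lambda>t::real. t\<^sup>2) has_real_derivative 2 * max 0 t) (at t)"
    using greater by (auto intro!: derivative_eq_intros)
  then show ?thesis
    by (rule has_field_derivative_transform_within_open[of _ _ _ "{0<..}"]) (use greater in auto)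
next
  case equal
  have "((\<lambda>h. (max 0 (0 + h))\<^sup>2 / h) \<longlongrightarrow> (0::real)) (at 0)"
  proof (rule tendsto_rabs_zero_cancel, rule tendsto_sandwich)
    show "\<forall>\<^sub>F h in at 0. 0 \<le> \<bar>(max 0 (0 + h))\<^sup>2 / (h::real)\<bar>" by simp
    show "\<forall>\<^sub>F h in at 0. \<bar>(max 0 (0 + h))\<^sup>2 / (h::real)\<bar> \<le> \<bar>h\<bar>"
      by (rule always_eventually) (auto simp: max_def power2_eq_square)
    show "((\<lambda>h::real. \<bar>h\<bar>) \<longlongrightarrow> 0) (at 0)"
      by (rule tendsto_rabs_zero) (rule tendsto_ident_at)
  qed simp
  with equal show ?thesis by (simp add: DERIV_def)
qed

lemma Ck_on_pos_part_squared: "Ck_on 1 UNIV (\<lambda>t::real. (max 0 t)\<^sup>2)"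
  unfolding One_nat_def
  by (rule Ck_on_SucI_real[OF _ has_real_derivative_pos_part_squared])
    (auto intro!: continuous_intros)

section \<open>C^1 functions on the manifold and bump functions\<close>

context atlas
begin

lemma open_chart_part: "c \<in> A \<Longrightarrow> open N \<Longrightarrow> open (snd c ` (fst c \<inter> N))"
  by (intro open_chart_image open_Int open_dom) auto

lemma Ck_map_iff: "Ck_map r N f \<longleftrightarrow> (\<forall>c\<in>A. Ck_on r (snd c ` (fst c \<inter> N)) (\<lambda>x. f (chart_inv c x)))"
  by (simp add: Ck_map_def comp_def)

lemma Ck_map_mult:
  fixes f g :: "'m \<Rightarrow> real"
  assumes "open N" "Ck_map r N f" "Ck_map r N g"
  shows "Ck_map r N (\<lambda>p. f p * g p)"
  unfolding Ck_map_iff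
proof
  fix c assume c: "c \<in> A"
  show "Ck_on r (snd c ` (fst c \<inter> N)) (\<lambda>x. f (chart_inv c x) * g (chart_inv c x))"
    by (rule Ck_on_mult[OF open_chart_part[OF c assms(1)]]) (use assms c Ck_map_iff in blast)+
qed

lemma Ck_map_divide:
  fixes f g :: "'m \<Rightarrow> real"
  assumes N: "open N" and fg: "Ck_map r N f" "Ck_map r N g" and g0: "\<And>p. p \<in> N \<Longrightarrow> g p \<noteq> 0"
  shows "Ck_map r N (\<lambda>p. f p / g p)"
  unfolding Ck_map_iff
proof
  fix c assume c: "c \<in> A"
  have "g (chart_inv c x) \<noteq> 0" if "x \<in> snd c ` (fst c \<inter> N)" for x
    using that g0 inv_left[OF c] by auto
  then show "Ck_on r (snd c ` (fst c \<inter> N)) (\<lambda>x. f (chart_inv c x) / g (chart_inv c x))"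
    by (rule Ck_on_divide[OF open_chart_part[OF c N], rotated 2]) (use fg c Ck_map_iff in blast)+
qed

lemma Ck_map_sum:
  assumes "open N" "\<And>i. i \<in> I \<Longrightarrow> Ck_map r N (f i)"
  shows "Ck_map r N (\<lambda>p. \<Sum>i\<in>I. f i p)"
  unfolding Ck_map_iff
proof
  fix c assume c: "c \<in> A"
  show "Ck_on r (snd c ` (fst c \<inter> N)) (\<lambda>x. \<Sum>i\<in>I. f i (chart_inv c x))"
    by (rule Ck_on_sum[OF open_chart_part[OF c assms(1)]]) (use assms c Ck_map_iff in blast)
qed

lemma Ck_map_subset: "Ck_map r N f \<Longrightarrow> N' \<subseteq> N \<Longrightarrow> Ck_map r N' f"
  unfolding Ck_map_def by (blast intro: Ck_on_subset)

lemma Ck_map_const: "Ck_map r N (\<lambda>p. k)"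
  unfolding Ck_map_def comp_def by simp

lemma Ck_map_compose:
  fixes f :: "'m \<Rightarrow> 'a::euclidean_space" and F :: "'a \<Rightarrow> 'b::real_normed_vector"
  assumes "Ck_map r UNIV f" "Ck_on r UNIV F"
  shows "Ck_map r UNIV (\<lambda>p. F (f p))"
  unfolding Ck_map_iff
proof
  fix c assume c: "c \<in> A"
  show "Ck_on r (snd c ` (fst c \<inter> UNIV)) (\<lambda>x. F (f (chart_inv c x)))"
    by (rule Ck_on_compose[OF open_chart_part[OF c open_UNIV] open_UNIV UNIV_I _ assms(2)])
      (use assms(1) c Ck_map_iff in blast)
qed

text \<open>In coordinates the bump is the squared positive part of \<open>r\<^sup>2\<close> minus
  the squared distance. The image of the closed ball is compact, hence closed in the Hausdorff
  space, so the extension by zero beyond the chart stays C^1.\<close>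

lemma bump_exists:
  assumes c: "c \<in> A" "p \<in> fst c" and r: "r > 0" "cball (snd c p) r \<subseteq> img c"
  obtains b :: "'m \<Rightarrow> real" where "Ck_map 1 UNIV b" "\<And>q. 0 \<le> b q"
    "\<And>q. q \<in> chart_inv c ` ball (snd c p) r \<Longrightarrow> 0 < b q"
    "\<And>q. q \<notin> chart_inv c ` cball (snd c p) r \<Longrightarrow> b q = 0"
proof -
  let ?x = "snd c p"
  define E where "E = (\<lambda>x. (max 0 (r\<^sup>2 - (x - ?x) \<bullet> (x - ?x)))\<^sup>2)"
  define b where "b = (\<lambda>q. if q \<in> fst c then E (snd c q) else 0)"
  have E: "Ck_on 1 UNIV E"
    unfolding E_def
    by (rule Ck_on_compose[OF open_UNIV open_UNIV UNIV_I _ Ck_on_pos_part_squared])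
      (intro Ck_on_diff Ck_on_inner Ck_on_const Ck_on_ident open_UNIV)
  have Epos: "E x > 0" if "x \<in> ball ?x r" for x
  proof -
    have "(x - ?x) \<bullet> (x - ?x) < r\<^sup>2"
      using that r(1) by (simp add: dist_norm norm_minus_commute power2_norm_eq_inner[symmetric] power_strict_mono)
    then show ?thesis by (simp add: E_def)
  qed
  have E0: "E x = 0" if "x \<notin> cball ?x r" for x
  proof -
    have "(x - ?x) \<bullet> (x - ?x) \<ge> r\<^sup>2"
      using that r(1) by (simp add: dist_norm norm_minus_commute power2_norm_eq_inner[symmetric] power_mono)
    then show ?thesis by (simp add: E_def)
  qed
  let ?K = "chart_inv c ` cball ?x r"
  have "compact ?K"
    by (rule compact_continuous_image[OF continuous_on_subset[OF cont_inv[OF c(1)] r(2)]]) simp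
  then have clK: "open (- ?K)" using compact_imp_closed by blast
  have Kdom: "?K = fst c \<inter> snd c -` cball ?x r" by (rule inv_image_eq[OF c(1) r(2)])
  have b0: "b q = 0" if "q \<notin> ?K" for q
    using that E0 unfolding Kdom b_def by auto
  have b1: "Ck_map 1 UNIV b"
  proof (rule Ck_map_local)
    fix q
    show "\<exists>N. open N \<and> q \<in> N \<and> Ck_map 1 N b"
    proof (cases "q \<in> fst c")
      case True
      have "Ck_map 1 (fst c) b"
        by (rule Ck_map_chart[OF c(1) open_dom[OF c(1)] subset_refl open_UNIV E]) (auto simp: b_def)
      then show ?thesis using True open_dom[OF c(1)] by blast
    next
      case False
      then have "q \<in> - ?K" unfolding Kdom by auto
      moreover have "Ck_map 1 (- ?K) b"
        by (rule Ck_map_cong[OF clK _ Ck_map_const[of _ _ 0]]) (simp add: b0)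
      ultimately show ?thesis using clK by blast
    qed
  qed
  have "b q > 0" if "q \<in> chart_inv c ` ball ?x r" for q
  proof -
    have "ball ?x r \<subseteq> img c" using r(2) ball_subset_cball by blast
    then show ?thesis using that Epos inv_image_eq[OF c(1), of "ball ?x r"] by (auto simp: b_def)
  qed
  moreover have "0 \<le> b q" for q by (simp add: b_def E_def)
  ultimately show ?thesis using b0 b1 by (intro that[of b]) auto
qed

end

section \<open>Differentiation along the tangential part of a fixed vector\<close>

context immersed
begin

text \<open>The derivative of \<open>f\<close> in the direction \<open>tang W\<close>, that is, the
  inner product of the gradients of \<open>f\<close> and of the height function in direction
  \<open>W\<close>.\<close>

definition tderiv :: "'v \<Rightarrow> ('m \<Rightarrow> real) \<Rightarrow> 'm \<Rightarrow> real" where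
  "tderiv W f p = (let c = (SOME c. c \<in> A \<and> p \<in> fst c) in
     chart_diff c f p (tcoord (X \<circ> chart_inv c) W (snd c p)))"

lemma Ck_map_differentiable:
  "Ck_map 1 UNIV f \<Longrightarrow> c \<in> A \<Longrightarrow> p \<in> fst c \<Longrightarrow> (f \<circ> chart_inv c) differentiable (at (snd c p))"
  using Ck_map_at_chart[of 1 f c] chart_img[of p c] by (simp add: One_nat_def)

text \<open>The vector \<open>tang W p\<close> does not depend on the chart, so injectivity of the
  differential forces the coordinate vectors of two charts to correspond under the transition
  map.\<close>

lemma tderiv_eq:
  assumes f: "Ck_map 1 UNIV f" and c: "c \<in> A" "p \<in> fst c"
  shows "tderiv W f p = chart_diff c f p (tcoord (X \<circ> chart_inv c) W (snd c p))"
proof -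
  define d where "d = (SOME c. c \<in> A \<and> p \<in> fst c)"
  have d: "d \<in> A" "p \<in> fst d"
    using someI[of "\<lambda>c. c \<in> A \<and> p \<in> fst c" c] c by (auto simp: d_def)
  let ?u = "tcoord (X \<circ> chart_inv d) W (snd d p)"
  have "chart_diff c X p (chart_diff d (snd c) p ?u) = chart_diff d X p ?u"
    using chart_diff_change_eq[OF d c X_differentiable[OF c]] by simp
  also have "\<dots> = chart_diff c X p (tcoord (X \<circ> chart_inv c) W (snd c p))"
    using tang_eq[OF c, of W] tang_eq[OF d, of W] by (simp add: tpart_def chart_diff_def)
  finally have "chart_diff d (snd c) p ?u = tcoord (X \<circ> chart_inv c) W (snd c p)"
    using inj_chart_diff[OF c] by (metis injD)
  moreover have "chart_diff d f p ?u = chart_diff c f p (chart_diff d (snd c) p ?u)"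
    by (rule chart_diff_change_eq[OF d c Ck_map_differentiable[OF f c]])
  ultimately show ?thesis by (simp add: tderiv_def d_def[symmetric])
qed

lemma tderiv_sum:
  assumes "\<And>i. i \<in> I \<Longrightarrow> Ck_map 1 UNIV (f i)"
  shows "tderiv W (\<lambda>p. \<Sum>i\<in>I. f i p) p = (\<Sum>i\<in>I. tderiv W (f i) p)"
proof -
  obtain c where c: "c \<in> A" "p \<in> fst c" by (rule chart_at)
  have "((\<lambda>x. \<Sum>i\<in>I. (f i \<circ> chart_inv c) x) has_derivative (\<lambda>v. \<Sum>i\<in>I. chart_diff c (f i) p v)) (at (snd c p))"
    unfolding chart_diff_def
    by (intro has_derivative_sum frechet_derivative_works[THEN iffD1] Ck_map_differentiable[OF assms c])
  then have "chart_diff c (\<lambda>p. \<Sum>i\<in>I. f i p) p = (\<lambda>v. \<Sum>i\<in>I. chart_diff c (f i) p v)"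
    using frechet_derivative_at by (force simp: chart_diff_def comp_def)
  then show ?thesis
    using assms by (simp add: tderiv_eq[OF _ c] Ck_map_sum)
qed

lemma tderiv_eq_0:
  assumes f: "Ck_map 1 UNIV f" and N: "open N" "p \<in> N" "\<And>q. q \<in> N \<Longrightarrow> f q = 0"
  shows "tderiv W f p = 0"
proof -
  obtain c where c: "c \<in> A" "p \<in> fst c" by (rule chart_at)
  have "frechet_derivative (\<lambda>x. 0::real) (at (snd c p)) = frechet_derivative (f \<circ> chart_inv c) (at (snd c p))"
  proof (rule frechet_derivative_transform_within_open)
    show "open (snd c ` (fst c \<inter> N))" by (rule open_chart_part[OF c(1) N(1)])
    show "snd c p \<in> snd c ` (fst c \<inter> N)" using c N by auto
    show "0 = (f \<circ> chart_inv c) x" if "x \<in> snd c ` (fst c \<inter> N)" for x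
      using that N(3) inv_left[OF c(1)] by auto
  qed simp
  then show ?thesis by (simp add: tderiv_eq[OF f c] chart_diff_def fun_eq_iff)
qed

lemma tderiv_compose_X:
  assumes F: "Ck_on 1 UNIV F"
  shows "tderiv W (\<lambda>p. F (X p)) p = frechet_derivative F (at (X p)) (tang W p)"
proof -
  obtain c where c: "c \<in> A" "p \<in> fst c" by (rule chart_at)
  have 1: "((X \<circ> chart_inv c) has_derivative chart_diff c X p) (at (snd c p))"
    using X_differentiable[OF c] by (simp add: chart_diff_def frechet_derivative_works[symmetric])
  have 2: "(F has_derivative frechet_derivative F (at (X p))) (at ((X \<circ> chart_inv c) (snd c p)))"
    using F inv_left[OF c] by (simp add: frechet_derivative_works[symmetric])
  have "((\<lambda>x. F ((X \<circ> chart_inv c) x)) has_derivative (\<lambda>v. frechet_derivative F (at (X p)) (chart_diff c X p v))) (at (snd c p))"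
    by (rule has_derivative_compose[OF 1 2])
  then have "chart_diff c (\<lambda>p. F (X p)) p = (\<lambda>v. frechet_derivative F (at (X p)) (chart_diff c X p v))"
    using frechet_derivative_at by (force simp: chart_diff_def comp_def)
  then show ?thesis
    using tang_eq[OF c, of W]
    by (simp add: tderiv_eq[OF Ck_map_compose[OF Ck_map_X F] c] tpart_def chart_diff_def)
qed

end

context soliton
begin

text \<open>
  Integrates to \<open>0\<close> for compactly supported \<^term>\<open>f\<close>: it is the divergence of \<^term>\<open>f\<close> times the
  tangential part of \<^term>\<open>W\<close>.
\<close>

definition weak_div :: "('m \<Rightarrow> real) \<Rightarrow> 'm \<Rightarrow> real" where
  "weak_div f p = tderiv W f p - f p * (norm (W - tang W p))\<^sup>2"

text \<open>In coordinates, the density times \<open>weak_div f\<close> is the divergence of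
  \<open>f\<close> times density times \<open>tcoord\<close>: one part of the product rule gives
  \<open>tderiv\<close>, the other the soliton term for the divergence of the tangential part. Each
  component has compact support, so its derivative integrates to zero.\<close>

lemma weak_div_chart:
  assumes f: "Ck_map 1 UNIV f" and c: "c \<in> A" and K: "compact K" "K \<subseteq> img c"
    and supp: "\<And>p. p \<notin> chart_inv c ` K \<Longrightarrow> f p = 0"
  shows "integrable (riem_volume A X) (weak_div f)" "integral\<^sup>L (riem_volume A X) (weak_div f) = 0"
proof -
  interpret immersed_patch "X \<circ> chart_inv c" "img c" by (rule patch[OF c])
  let ?Y = "X \<circ> chart_inv c"
  let ?w = "f \<circ> chart_inv c" and ?V = "tcoord ?Y W" and ?\<rho> = "\<lambda>x. sqrt (det (gram ?Y x))"
  have w: "Ck_on 1 (img c) ?w" by (rule Ck_map_at_chart[OF f c])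
  have w': "(?w has_derivative frechet_derivative ?w (at x)) (at x)" if "x \<in> img c" for x
    using w that by (simp add: One_nat_def frechet_derivative_works[symmetric])
  have Kdom: "chart_inv c ` K \<subseteq> fst c" using K(2) inv_dom[OF c] by auto
  have "compact (chart_inv c ` K)"
    by (rule compact_continuous_image[OF continuous_on_subset[OF cont_inv[OF c] K(2)] K(1)])
  then have opK: "open (- chart_inv c ` K)" using compact_imp_closed by blast
  have w0: "?w x = 0" if "x \<in> img c" "x \<notin> K" for x
  proof -
    have "chart_inv c x \<notin> chart_inv c ` K"
    proof
      assume "chart_inv c x \<in> chart_inv c ` K"
      then obtain y where y: "y \<in> K" "chart_inv c x = chart_inv c y" by auto
      then have "y \<in> img c" using K(2) by auto
      from arg_cong[OF y(2), of "snd c"] have "x = y"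
        unfolding inv_right[OF c that(1)] inv_right[OF c \<open>y \<in> img c\<close>] .
      then show False using y(1) that(2) by simp
    qed
    then show ?thesis using supp by simp
  qed
  define G where "G = (\<lambda>x. (\<Sum>k\<in>UNIV. ?V x $ k * partial ?w k x) - ?w x * (norm (W - tpart ?Y W x))\<^sup>2)"
  have LG: "weak_div f p = G (snd c p)" if p: "p \<in> fst c" for p
  proof -
    have "chart_diff c f p (?V (snd c p)) = (\<Sum>k\<in>UNIV. ?V (snd c p) $ k * partial ?w k (snd c p))"
      unfolding chart_diff_def
      by (rule linear_eq_sum_axis[OF has_derivative_linear[OF w'[OF chart_img[OF p]]], unfolded real_scaleR_def])
    then show ?thesis
      by (simp add: weak_div_def tderiv_eq[OF f c p] tang_eq[OF c p] G_def inv_left[OF c p])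
  qed
  have L0: "weak_div f p = 0" if "p \<notin> chart_inv c ` K" for p
    using tderiv_eq_0[OF f opK, of p W] that supp by (simp add: weak_div_def)
  have L0': "weak_div f p = 0" if "p \<notin> fst c" for p
    using L0 Kdom that by blast
  have "continuous_on (img c) (partial ?w k)" for k
    using w by (simp add: One_nat_def)
  moreover have "continuous_on (img c) (\<lambda>x. ?V x $ k)" for k
    by (rule Ck_on_imp_continuous_on[OF Ck_tcoord])
  ultimately have "continuous_on (img c) G"
    unfolding G_def
    by (intro continuous_on_diff continuous_on_sum continuous_on_mult continuous_on_power
        continuous_on_norm continuous_on_const Ck_on_imp_continuous_on[OF w]
        Ck_on_imp_continuous_on[OF Ck_tpart])
  then have "continuous_on (fst c) (\<lambda>p. G (snd c p))"
    by (rule continuous_on_compose2[OF _ cont_chart[OF c]]) (auto simp: img_def)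
  then have "(\<lambda>p. indicator (fst c) p * G (snd c p)) \<in> borel_measurable borel"
    by (rule borel_measurable_indicator_times_continuous[OF open_dom[OF c]])
  also have "(\<lambda>p. indicator (fst c) p * G (snd c p)) = weak_div f"
    using LG L0' by (auto simp: fun_eq_iff indicator_def)
  finally have meas: "weak_div f \<in> borel_measurable borel" .
  \<comment> \<open>The component fields are extended by zero to R^n. Off \<open>K\<close> they
    vanish identically, so no regularity is lost at the boundary of the chart image.\<close>
  define Z where "Z = (\<lambda>k x. if x \<in> img c then ?w x * (?V x $ k * ?\<rho> x) else 0)"
  have Vr: "Ck_on r (img c) (\<lambda>x. ?V x $ k * ?\<rho> x)" for k r
    by (intro Ck_on_mult open_img c Ck_tcoord Ck_sqrt_det_gram)
  have Z0: "Z k x = 0" if "x \<notin> K" for k x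
    using w0 that by (simp add: Z_def)
  have Z: "Ck_on 1 UNIV (Z k)" for k
  proof (rule Ck_on_local)
    fix x :: "real^'n"
    show "\<exists>T. open T \<and> x \<in> T \<and> Ck_on 1 T (Z k)"
    proof (cases "x \<in> img c")
      case True
      have "Ck_on 1 (img c) (\<lambda>x. ?w x * (?V x $ k * ?\<rho> x))"
        by (intro Ck_on_mult open_img c w Vr)
      then have "Ck_on 1 (img c) (Z k)"
        using Ck_on_cong[OF open_img[OF c], of "Z k" "\<lambda>x. ?w x * (?V x $ k * ?\<rho> x)"] by (simp add: Z_def)
      then show ?thesis using True open_img[OF c] by blast
    next
      case False
      have o: "open (- K)" using compact_imp_closed[OF K(1)] by blast
      have "Ck_on 1 (- K) (Z k)"
        using Ck_on_cong[OF o, of "Z k" "\<lambda>x. 0" 1] Z0 Ck_on_const by auto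
      then show ?thesis using False K(2) o by blast
    qed
  qed
  have pZ0: "partial (Z k) k x = 0" if "x \<notin> K" for k x
    by (rule frechet_derivative_eq_0_outside[OF compact_imp_closed[OF K(1)] _ that]) (rule Z0)
  have Zint: "integrable lborel (partial (Z k) k)" for k
  proof (rule integrable_compact_support[OF _ K(1)])
    show "continuous_on UNIV (partial (Z k) k)" using Z[of k] by (simp add: One_nat_def)
    show "partial (Z k) k x = 0" if "x \<notin> K" for x using that by (rule pZ0)
  qed
  have eq: "vol_density c x * weak_div f (chart_param c x) = (\<Sum>k\<in>UNIV. partial (Z k) k x)" for x
  proof (cases "x \<in> img c")
    case x: True
    have "(Z k has_derivative (\<lambda>v. ?w x * frechet_derivative (\<lambda>x. ?V x $ k * ?\<rho> x) (at x) v
        + frechet_derivative ?w (at x) v * (?V x $ k * ?\<rho> x))) (at x)" for k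
      using has_derivative_mult[OF w'[OF x] Ck_on_Suc_has_derivative[OF Vr[of "Suc 0" k] x]]
      by (rule has_derivative_transform_within_open[OF _ open_img[OF c] x]) (simp add: Z_def)
    from frechet_derivative_at[OF this, symmetric]
    have "partial (Z k) k x = ?w x * partial (\<lambda>x. ?V x $ k * ?\<rho> x) k x + partial ?w k x * (?V x $ k * ?\<rho> x)" for k
      by (rule fun_cong)
    then have "(\<Sum>k\<in>UNIV. partial (Z k) k x) = ?w x * (\<Sum>k\<in>UNIV. partial (\<lambda>x. ?V x $ k * ?\<rho> x) k x)
        + ?\<rho> x * (\<Sum>k\<in>UNIV. ?V x $ k * partial ?w k x)"
      by (simp add: sum.distrib sum_distrib_left mult_ac)
    also have "\<dots> = ?\<rho> x * G x"
      unfolding divergence_tangential[OF x] surface_div_tpart_soliton[OF c x] by (simp add: G_def algebra_simps)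
    also have "\<dots> = vol_density c x * weak_div f (chart_param c x)"
      using x LG[OF inv_dom[OF c x]] inv_right[OF c x] by (simp add: vol_density_def chart_param_def)
    finally show ?thesis by simp
  next
    case False
    then have "x \<notin> K" using K(2) by auto
    then have "partial (Z k) k x = 0" for k by (rule pZ0)
    with False show ?thesis by (simp add: vol_density_def)
  qed
  have "integrable (riem_volume A X) (weak_div f) \<longleftrightarrow>
      integrable lborel (\<lambda>x. vol_density c x * weak_div f (chart_param c x))"
    by (rule integral_chart(1)[OF c meas]) (rule L0')
  then show "integrable (riem_volume A X) (weak_div f)"
    unfolding eq by (simp add: Zint)
  have "integral\<^sup>L (riem_volume A X) (weak_div f) =
      integral\<^sup>L lborel (\<lambda>x. vol_density c x * weak_div f (chart_param c x))"
    by (rule integral_chart(2)[OF c meas]) (rule L0')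
  then   have "integral\<^sup>L (riem_volume A X) (weak_div f) = (\<Sum>k\<in>UNIV. integral\<^sup>L lborel (partial (Z k) k))"
    unfolding eq by (simp add: Bochner_Integration.integral_sum Zint)
  also have "\<dots> = 0"
  proof (intro sum.neutral ballI)
    show "integral\<^sup>L lborel (partial (Z k) k) = 0" for k
      by (rule integral_directional_derivative_eq_0[OF Z K(1)]) (rule Z0)
  qed
  finally show "integral\<^sup>L (riem_volume A X) (weak_div f) = 0" .
qed

text \<open>Finitely many bumps, positive on neighbourhoods covering \<open>K\<close>, have a
  positive sum \<open>\<sigma>\<close> on \<open>K\<close>. Dividing by it splits \<open>f\<close>
  into C^1 pieces that are each supported in one chart, and \<open>weak_div\<close> is
  additive.\<close>

theorem integral_weak_div:
  assumes f: "Ck_map 1 UNIV f" and K: "compact K" and supp: "\<And>p. p \<notin> K \<Longrightarrow> f p = 0"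
  shows "integrable (riem_volume A X) (weak_div f)" "integral\<^sup>L (riem_volume A X) (weak_div f) = 0"
proof -
  let ?P = "\<lambda>p (b :: 'm \<Rightarrow> real, c, L). Ck_map 1 UNIV b \<and> (\<forall>q. 0 \<le> b q) \<and> c \<in> A \<and> compact L \<and> L \<subseteq> img c \<and>
    (\<forall>q. q \<notin> chart_inv c ` L \<longrightarrow> b q = 0) \<and> (\<exists>N. open N \<and> p \<in> N \<and> (\<forall>q\<in>N. 0 < b q))"
  have "\<forall>p. \<exists>t. ?P p t"
  proof
    fix p
    obtain c r where c: "c \<in> A" "p \<in> fst c" and r: "r > 0" "cball (snd c p) r \<subseteq> img c" by (rule chart_ball)
    obtain b :: "'m \<Rightarrow> real" where b: "Ck_map 1 UNIV b" "\<And>q. 0 \<le> b q"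
      "\<And>q. q \<in> chart_inv c ` ball (snd c p) r \<Longrightarrow> 0 < b q"
      "\<And>q. q \<notin> chart_inv c ` cball (snd c p) r \<Longrightarrow> b q = 0"
      by (rule bump_exists[OF c r]) (rule that)
    have "ball (snd c p) r \<subseteq> img c" using r(2) ball_subset_cball by blast
    then have o: "open (chart_inv c ` ball (snd c p) r)" by (rule open_inv_image[OF c(1) open_ball])
    have "p \<in> chart_inv c ` ball (snd c p) r"
      using inv_left[OF c] r(1) by (intro image_eqI[of _ _ "snd c p"]) auto
    then have "\<exists>N. open N \<and> p \<in> N \<and> (\<forall>q\<in>N. 0 < b q)" using o b(3) by blast
    then have "?P p (b, c, cball (snd c p) r)" using b c r by simp
    then show "\<exists>t. ?P p t" by blast
  qed
  from choice[OF this] obtain t where t: "\<And>p. ?P p (t p)" by (elim exE) blast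
  define b where "b = (\<lambda>p. fst (t p))"
  define c where "c = (\<lambda>p. fst (snd (t p)))"
  define L where "L = (\<lambda>p. snd (snd (t p)))"
  have tb: "t p = (b p, c p, L p)" for p by (simp add: b_def c_def L_def)
  have b: "\<And>p. Ck_map 1 UNIV (b p)" "\<And>p q. 0 \<le> b p q" "\<And>p. c p \<in> A" "\<And>p. compact (L p)" "\<And>p. L p \<subseteq> img (c p)"
    "\<And>p q. q \<notin> chart_inv (c p) ` L p \<Longrightarrow> b p q = 0"
    "\<And>p. \<exists>N. open N \<and> p \<in> N \<and> (\<forall>q\<in>N. 0 < b p q)"
    using t[unfolded tb] by (simp_all split: prod.splits)
  from b(7) obtain N where N: "\<And>p. open (N p)" "\<And>p. p \<in> N p" "\<And>p q. q \<in> N p \<Longrightarrow> 0 < b p q"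
    by metis
  obtain Q where Q: "finite Q" "K \<subseteq> (\<Union>p\<in>Q. N p)"
  proof (rule compactE_image[OF K, of UNIV N])
    show "K \<subseteq> (\<Union>p\<in>UNIV. N p)" using N(2) by auto
  qed (use N(1) in auto)
  define \<sigma> where "\<sigma> = (\<lambda>q. \<Sum>p\<in>Q. b p q)"
  have \<sigma>C: "Ck_map 1 UNIV \<sigma>" unfolding \<sigma>_def by (intro Ck_map_sum b) auto
  have \<sigma>pos: "\<sigma> q > 0" if q: "q \<in> K" for q
  proof -
    obtain p where "p \<in> Q" "q \<in> N p" using Q(2) q by auto
    then show ?thesis
      unfolding \<sigma>_def using Q(1) b(2) N(3) by (intro sum_pos2[of Q p]) auto
  qed
  \<comment> \<open>The sum \<open>\<sigma>\<close> may vanish off \<open>K\<close>, but there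
    \<open>f\<close> is zero and so is the quotient. Near a point of \<open>K\<close> the
    denominator is positive, so \<open>h p\<close> is C^1 everywhere.\<close>
  define h where "h = (\<lambda>p q. f q * b p q / \<sigma> q)"
  have hC: "Ck_map 1 UNIV (h p)" for p
  proof (rule Ck_map_local)
    fix q
    show "\<exists>T. open T \<and> q \<in> T \<and> Ck_map 1 T (h p)"
    proof (cases "q \<in> K")
      case True
      let ?T = "\<sigma> -` {0<..}"
      have o: "open ?T"
        using Ck_map_imp_continuous_on[OF \<sigma>C] by (intro open_vimage) auto
      have "Ck_map 1 ?T (h p)"
        unfolding h_def
        by (intro Ck_map_divide Ck_map_mult o Ck_map_subset[OF f] Ck_map_subset[OF b(1)] Ck_map_subset[OF \<sigma>C]) auto
      then show ?thesis using o \<sigma>pos[OF True] by blast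
    next
      case False
      have o: "open (- K)" using compact_imp_closed[OF K] by blast
      have "Ck_map 1 (- K) (h p)"
        by (rule Ck_map_cong[OF o _ Ck_map_const[of _ _ 0]]) (simp add: h_def supp)
      then show ?thesis using False o by blast
    qed
  qed
  have fh: "f q = (\<Sum>p\<in>Q. h p q)" for q
  proof (cases "q \<in> K")
    case True
    have "(\<Sum>p\<in>Q. h p q) = f q * \<sigma> q / \<sigma> q"
      by (simp add: h_def \<sigma>_def sum_divide_distrib sum_distrib_left)
    then show ?thesis using \<sigma>pos[OF True] by simp
  qed (simp add: h_def supp)
  have f_eq: "f = (\<lambda>q. \<Sum>p\<in>Q. h p q)" by (rule ext) (rule fh)
  have eq: "weak_div f = (\<lambda>q. \<Sum>p\<in>Q. weak_div (h p) q)"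
  proof
    fix q
    have "tderiv W f q = (\<Sum>p\<in>Q. tderiv W (h p) q)"
      unfolding f_eq by (rule tderiv_sum[OF hC])
    then show "weak_div f q = (\<Sum>p\<in>Q. weak_div (h p) q)"
      unfolding weak_div_def fh by (simp add: sum_subtractf sum_distrib_right)
  qed
  have h0: "h p q = 0" if "q \<notin> chart_inv (c p) ` L p" for p q
    using b(6)[OF that] by (simp add: h_def)
  note loc = weak_div_chart[OF hC b(3) b(4) b(5) h0]
  show "integrable (riem_volume A X) (weak_div f)"
    unfolding eq by (intro Bochner_Integration.integrable_sum loc(1))
  show "integral\<^sup>L (riem_volume A X) (weak_div f) = 0"
    unfolding eq by (subst Bochner_Integration.integral_sum) (simp_all add: loc)
qed

end

section \<open>Exponential growth\<close>

text \<open>A quadratic spline rising from \<open>0\<close> to \<open>1\<close> on the unit interval.\<close>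

definition spline :: "real \<Rightarrow> real" where
  "spline t = 2 * ((max 0 t)\<^sup>2 - 2 * (max 0 (t - 1 / 2))\<^sup>2 + (max 0 (t - 1))\<^sup>2)"

text \<open>A tent over the unit interval with slopes 4 and -4 and peak 2 at 1 / 2; its area is 1,
  hence the normalisation of \<open>spline\<close>.\<close>

definition spline' :: "real \<Rightarrow> real" where
  "spline' t = 4 * (max 0 t - 2 * max 0 (t - 1 / 2) + max 0 (t - 1))"

lemma has_real_derivative_spline: "(spline has_real_derivative spline' t) (at t)"
proof -
  have sh: "((\<lambda>t. (max 0 (t - k))\<^sup>2) has_real_derivative 2 * max 0 (t - k)) (at t)" for k :: real
  proof -
    have "((\<lambda>t. t - k) has_real_derivative 1) (at t)" by (auto intro!: derivative_eq_intros)
    from DERIV_chain2[where f = "\<lambda>t. (max 0 t)\<^sup>2", OF has_real_derivative_pos_part_squared this]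
    show ?thesis by simp
  qed
  have "(spline has_real_derivative
      2 * (2 * max 0 t - 2 * (2 * max 0 (t - 1 / 2)) + 2 * max 0 (t - 1))) (at t)"
    unfolding spline_def[abs_def]
    by (intro DERIV_cmult DERIV_add DERIV_diff has_real_derivative_pos_part_squared sh)
  then show ?thesis by (simp add: spline'_def algebra_simps)
qed

lemma spline_eq_0: "t \<le> 0 \<Longrightarrow> spline t = 0"
  by (simp add: spline_def)

lemma spline_eq_1: "1 \<le> t \<Longrightarrow> spline t = 1"
  by (simp add: spline_def power2_eq_square algebra_simps)

lemma spline_le_1: "spline t \<le> 1"
proof -
  consider "t \<le> 0" | "0 \<le> t" "t \<le> 1 / 2" | "1 / 2 \<le> t" "t \<le> 1" | "1 \<le> t" by linarith
  then show ?thesis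
  proof cases
    case 2
    then have "t * t \<le> 1 / 2 * (1 / 2)" by (intro mult_mono) auto
    with 2 show ?thesis by (simp add: spline_def power2_eq_square)
  next
    case 3
    then have "spline t = 1 - 2 * (1 - t)\<^sup>2"
      by (simp add: spline_def power2_eq_square algebra_simps)
    then show ?thesis by simp
  qed (simp_all add: spline_eq_0 spline_eq_1)
qed

lemma spline'_bounds: "0 \<le> spline' t" "spline' t \<le> 2"
  by (auto simp: spline'_def max_def)

lemma spline'_eq_0: "t \<le> 0 \<or> 1 \<le> t \<Longrightarrow> spline' t = 0"
  by (auto simp: spline'_def max_def)

lemma Ck_on_spline: "Ck_on 1 UNIV spline"
  unfolding One_nat_def
  by (rule Ck_on_SucI_real[OF _ has_real_derivative_spline])
    (auto simp: spline'_def[abs_def] intro!: continuous_intros)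

text \<open>The argument is affine in the squared norm, which is smooth also at the origin, and is
  scaled to be 0 at radius \<open>s\<close> and 1 at radius \<open>s + h\<close>.\<close>

definition cutoff :: "real \<Rightarrow> real \<Rightarrow> 'v::euclidean_space \<Rightarrow> real" where
  "cutoff s h x = 1 - spline ((x \<bullet> x - s\<^sup>2) / ((s + h)\<^sup>2 - s\<^sup>2))"

lemma Ck_on_cutoff: "Ck_on 1 UNIV (cutoff s h)"
proof -
  have "Ck_on 1 UNIV (\<lambda>x. (x \<bullet> x - s\<^sup>2) * (1 / ((s + h)\<^sup>2 - s\<^sup>2)))"
    by (intro Ck_on_mult Ck_on_diff Ck_on_inner Ck_on_const Ck_on_ident open_UNIV)
  then have "Ck_on 1 UNIV (\<lambda>x. spline ((x \<bullet> x - s\<^sup>2) / ((s + h)\<^sup>2 - s\<^sup>2)))"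
    by (intro Ck_on_compose[OF open_UNIV open_UNIV UNIV_I _ Ck_on_spline]) simp
  then show ?thesis
    unfolding cutoff_def[abs_def] by (intro Ck_on_diff Ck_on_const open_UNIV)
qed

definition cutoff' :: "real \<Rightarrow> real \<Rightarrow> 'v::euclidean_space \<Rightarrow> 'v \<Rightarrow> real" where
  "cutoff' s h x v = - (spline' ((x \<bullet> x - s\<^sup>2) / ((s + h)\<^sup>2 - s\<^sup>2)) * (2 * (x \<bullet> v) / ((s + h)\<^sup>2 - s\<^sup>2)))"

lemma has_derivative_cutoff: "(cutoff s h has_derivative cutoff' s h x) (at x)"
proof -
  let ?L = "(s + h)\<^sup>2 - s\<^sup>2"
  have 1: "((\<lambda>x. (x \<bullet> x - s\<^sup>2) / ?L) has_derivative (\<lambda>v. 2 * (x \<bullet> v) / ?L)) (at x)"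
    by (auto intro!: derivative_eq_intros simp: inner_commute divide_inverse)
  have "((\<lambda>x. 1 - spline ((x \<bullet> x - s\<^sup>2) / ?L)) has_derivative
      (\<lambda>v. 0 - spline' ((x \<bullet> x - s\<^sup>2) / ?L) * (2 * (x \<bullet> v) / ?L))) (at x)"
    by (intro has_derivative_diff has_derivative_const
        has_derivative_compose[OF 1 has_real_derivative_spline[unfolded has_field_derivative_def]])
  then show ?thesis by (simp add: cutoff_def[abs_def] cutoff'_def[abs_def])
qed

section \<open>Values and gradient of the cutoff\<close>

context
  fixes s h :: real
  assumes s: "0 < s" and h: "0 < h"
begin

lemma cutoff_denominator: "0 < (s + h)\<^sup>2 - s\<^sup>2"
  using s h by (simp add: power2_eq_square algebra_simps add_pos_pos)

lemma cutoff_nonneg: "0 \<le> cutoff s h x"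
  using spline_le_1 by (simp add: cutoff_def)

lemma cutoff_inside: "norm x \<le> s \<Longrightarrow> cutoff s h x = 1" "norm x \<le> s \<Longrightarrow> cutoff' s h x v = 0"
proof -
  assume "norm x \<le> s"
  then have "x \<bullet> x \<le> s\<^sup>2"
    unfolding power2_norm_eq_inner[symmetric] by (simp add: power_mono)
  then have le: "(x \<bullet> x - s\<^sup>2) / ((s + h)\<^sup>2 - s\<^sup>2) \<le> 0"
    using cutoff_denominator by (simp add: divide_nonpos_pos)
  show "cutoff s h x = 1" "cutoff' s h x v = 0"
    using le by (simp_all add: cutoff_def cutoff'_def spline_eq_0 spline'_eq_0)
qed

lemma cutoff_outside: "s + h \<le> norm x \<Longrightarrow> cutoff s h x = 0" "s + h \<le> norm x \<Longrightarrow> cutoff' s h x v = 0"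
proof -
  assume "s + h \<le> norm x"
  then have "(s + h)\<^sup>2 \<le> x \<bullet> x"
    unfolding power2_norm_eq_inner[symmetric] using s h by (simp add: power_mono)
  then have ge: "1 \<le> (x \<bullet> x - s\<^sup>2) / ((s + h)\<^sup>2 - s\<^sup>2)"
    using cutoff_denominator by simp
  show "cutoff s h x = 0" "cutoff' s h x v = 0"
    using ge by (simp_all add: cutoff_def cutoff'_def spline_eq_1 spline'_eq_0)
qed

text \<open>The spline has slope at most 2, and inside radius \<open>s + h\<close> the inner product
  is at most \<open>s + h\<close>. Since the denominator factors as \<open>h * (2 * s + h)\<close>,
  the growing factor \<open>s + h\<close> is absorbed and the bound does not depend on
  \<open>s\<close>.\<close>

lemma cutoff'_bound:
  assumes v: "norm v \<le> 1"
  shows "\<bar>cutoff' s h x v\<bar> \<le> 4 / h"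
proof (cases "norm x < s + h")
  case True
  let ?L = "(s + h)\<^sup>2 - s\<^sup>2"
  have "\<bar>x \<bullet> v\<bar> \<le> norm x * norm v" by (rule Cauchy_Schwarz_ineq2)
  also have "\<dots> \<le> (s + h) * 1" using True v s h by (intro mult_mono) auto
  finally have xv: "\<bar>x \<bullet> v\<bar> \<le> s + h" by simp
  have "\<bar>cutoff' s h x v\<bar> = spline' ((x \<bullet> x - s\<^sup>2) / ?L) * (2 * \<bar>x \<bullet> v\<bar> / ?L)"
    using cutoff_denominator spline'_bounds(1) by (simp add: cutoff'_def abs_mult)
  also have "\<dots> \<le> 2 * (2 * (s + h) / ?L)"
    using spline'_bounds xv cutoff_denominator s h
    by (intro mult_mono divide_right_mono) auto
  also have "\<dots> \<le> 4 / h"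
  proof -
    have "?L = h * (2 * s + h)" by (simp add: power2_eq_square algebra_simps)
    then have "2 * (2 * (s + h) / ?L) = 4 / h * ((s + h) / (2 * s + h))" by simp
    also have "\<dots> \<le> 4 / h * 1"
      using s h by (intro mult_left_mono) auto
    finally show ?thesis by simp
  qed
  finally show ?thesis .
next
  case False
  then show ?thesis using cutoff_outside(2)[of x v] h by simp
qed

end

section \<open>Growth of the weighted volume of balls\<close>

context soliton
begin

text \<open>The integral of u dm over the part of M in the ball: \<open>a - 1\<close> combines the
  exponent of u with that of the density of dm. As a real number it admits the subtraction needed in
  the growth step.\<close>

definition weight :: "real \<Rightarrow> real \<Rightarrow> real" where
  "weight a R = (\<integral>p. exp ((a - 1) * (X p \<bullet> W)) * indicator (X -` ball 0 R) p \<partial>riem_volume A X)"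

lemma X_measurable: "X \<in> borel_measurable borel"
  using continuous_X by (rule borel_measurable_continuous_onI)

text \<open>Properness bounds the set by a compact one, the preimage of the closed ball, which has
  finite volume; on it the exponent is at most \<open>\<bar>a - 1\<bar> * \<bar>R\<bar>\<close>
  because \<open>W\<close> is a unit vector.\<close>

lemma integrable_weight:
  assumes "proper X"
  shows "integrable (riem_volume A X) (\<lambda>p. exp ((a - 1) * (X p \<bullet> W)) * indicator (X -` ball 0 R) p)"
proof -
  have B: "X -` ball 0 R \<in> sets borel"
    using measurable_sets[OF X_measurable, of "ball 0 R"] by simp
  have "compact (X -` cball 0 R)" using assms by (simp add: proper_def)
  then have K: "emeasure (riem_volume A X) (X -` cball 0 R) < \<infinity>" "X -` cball 0 R \<in> sets borel"
    by (intro emeasure_riem_volume_compact borel_closed compact_imp_closed; assumption)+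
  have "integrable (riem_volume A X) (\<lambda>p. exp (\<bar>a - 1\<bar> * \<bar>R\<bar>) * indicator (X -` cball 0 R) p)"
    using K by (intro integrable_mult_right integrable_real_indicator) auto
  then show ?thesis
  proof (rule Bochner_Integration.integrable_bound)
    show "(\<lambda>p. exp ((a - 1) * (X p \<bullet> W)) * indicator (X -` ball 0 R) p) \<in> borel_measurable (riem_volume A X)"
      using B X_measurable by simp
    have "norm (exp ((a - 1) * (X p \<bullet> W)) * indicator (X -` ball 0 R) p)
        \<le> norm (exp (\<bar>a - 1\<bar> * \<bar>R\<bar>) * indicator (X -` cball 0 R) p :: real)" for p
    proof (cases "X p \<in> ball 0 R")
      case True
      have "\<bar>X p \<bullet> W\<bar> \<le> norm (X p) * norm W" by (rule Cauchy_Schwarz_ineq2)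
      also have "\<dots> \<le> \<bar>R\<bar>" using True W by simp
      finally have "\<bar>(a - 1) * (X p \<bullet> W)\<bar> \<le> \<bar>a - 1\<bar> * \<bar>R\<bar>"
        unfolding abs_mult by (rule mult_left_mono) simp
      then have "(a - 1) * (X p \<bullet> W) \<le> \<bar>a - 1\<bar> * \<bar>R\<bar>" by linarith
      with True show ?thesis by simp
    qed (simp add: indicator_def)
    then show "AE p in riem_volume A X. norm (exp ((a - 1) * (X p \<bullet> W)) * indicator (X -` ball 0 R) p)
        \<le> norm (exp (\<bar>a - 1\<bar> * \<bar>R\<bar>) * indicator (X -` cball 0 R) p :: real)"
      by simp
  qed
qed

lemma weight_nonneg: "0 \<le> weight a R"
  unfolding weight_def by (intro Bochner_Integration.integral_nonneg) simp

lemma nn_integral_soliton_measure: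
  assumes "proper X"
  shows "(\<integral>\<^sup>+p\<in>X -` ball 0 R. ennreal (exp (a * (X p \<bullet> W))) \<partial>soliton_measure A X W) = ennreal (weight a R)"
proof -
  have B: "X -` ball 0 R \<in> sets borel"
    using measurable_sets[OF X_measurable, of "ball 0 R"] by simp
  have "(\<integral>\<^sup>+p\<in>X -` ball 0 R. ennreal (exp (a * (X p \<bullet> W))) \<partial>soliton_measure A X W)
      = (\<integral>\<^sup>+p. ennreal (exp (- (X p \<bullet> W))) * (ennreal (exp (a * (X p \<bullet> W))) * indicator (X -` ball 0 R) p) \<partial>riem_volume A X)"
    unfolding soliton_measure_def using B X_measurable by (subst nn_integral_density) auto
  also have "\<dots> = (\<integral>\<^sup>+p. ennreal (exp ((a - 1) * (X p \<bullet> W)) * indicator (X -` ball 0 R) p) \<partial>riem_volume A X)"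
  proof (intro nn_integral_cong)
    fix p
    have "exp (- (X p \<bullet> W)) * exp (a * (X p \<bullet> W)) = exp ((a - 1) * (X p \<bullet> W))"
      by (simp add: algebra_simps flip: exp_add)
    then show "ennreal (exp (- (X p \<bullet> W))) * (ennreal (exp (a * (X p \<bullet> W))) * indicator (X -` ball 0 R) p)
        = ennreal (exp ((a - 1) * (X p \<bullet> W)) * indicator (X -` ball 0 R) p)"
      by (simp add: indicator_def flip: ennreal_mult)
  qed
  also have "\<dots> = ennreal (weight a R)"
    unfolding weight_def by (intro nn_integral_eq_integral integrable_weight assms) simp
  finally show ?thesis .
qed

text \<open>The pointwise bound \<open>lower\<close> is integrated against the vanishing total of
  \<open>weak_div\<close>. The hypothesis \<open>5 \<le> a * \<delta>\<close> provides the factor 4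
  on the ball that matches the 4 in the gradient bound of the cutoff.\<close>

lemma weight_growth_step:
  assumes proper: "proper X" and T: "\<And>p. \<delta> \<le> (norm (tang W p))\<^sup>2" and a: "0 \<le> a" "5 \<le> a * \<delta>"
    and s: "0 < s" and h: "0 < h"
  shows "(1 + h) * weight a s \<le> weight a (s + h)"
proof -
  let ?E = "\<lambda>x. exp ((a - 1) * (x \<bullet> W))"
  define F where "F = (\<lambda>x. cutoff s h x * ?E x)"
  have FC: "Ck_on 1 UNIV F"
  proof -
    have "Ck_on 1 UNIV (\<lambda>x. (a - 1) * (x \<bullet> W))"
      by (intro Ck_on_mult Ck_on_inner Ck_on_const Ck_on_ident open_UNIV)
    then have "Ck_on 1 UNIV ?E"
      by (rule Ck_on_compose[OF open_UNIV open_UNIV UNIV_I _ Ck_on_exp])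
    then show ?thesis unfolding F_def by (intro Ck_on_mult Ck_on_cutoff open_UNIV)
  qed
  have F': "(F has_derivative (\<lambda>v. cutoff s h x * (?E x * ((a - 1) * (v \<bullet> W))) + cutoff' s h x v * ?E x)) (at x)" for x
    unfolding F_def
    by (rule has_derivative_mult[OF has_derivative_cutoff]) (auto intro!: derivative_eq_intros)
  let ?f = "\<lambda>p. F (X p)"
  have fC: "Ck_map 1 UNIV ?f" by (rule Ck_map_compose[OF Ck_map_X FC])
  have K: "compact (X -` cball 0 (s + h))" using proper by (simp add: proper_def)
  have supp: "?f p = 0" if "p \<notin> X -` cball 0 (s + h)" for p
    using that cutoff_outside(1)[OF s h, of "X p"] by (simp add: F_def)
  note int = integral_weak_div[OF fC K supp]
  have T1: "norm (tang W p) \<le> 1" for p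
  proof -
    have "(norm (tang W p))\<^sup>2 \<le> 1\<^sup>2"
      using norm_tang(1)[of p] zero_le_power2[of "norm (W - tang W p)"] unfolding one_power2 by linarith
    then show ?thesis by (rule power2_le_imp_le) simp
  qed
  have div: "weak_div ?f p = ?E (X p) * (cutoff' s h (X p) (tang W p) + cutoff s h (X p) * (a * (norm (tang W p))\<^sup>2 - 1))" for p
  proof -
    have "tderiv W ?f p = cutoff s h (X p) * (?E (X p) * ((a - 1) * (norm (tang W p))\<^sup>2)) + cutoff' s h (X p) (tang W p) * ?E (X p)"
      unfolding tderiv_compose_X[OF FC] frechet_derivative_at[OF F', symmetric] norm_tang(2) ..
    moreover have "(norm (W - tang W p))\<^sup>2 = 1 - (norm (tang W p))\<^sup>2"
      using norm_tang(1)[of p] by simp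
    ultimately have "weak_div ?f p = cutoff s h (X p) * (?E (X p) * ((a - 1) * (norm (tang W p))\<^sup>2))
        + cutoff' s h (X p) (tang W p) * ?E (X p) - cutoff s h (X p) * ?E (X p) * (1 - (norm (tang W p))\<^sup>2)"
      unfolding weak_div_def F_def by simp
    then show ?thesis by algebra
  qed
  let ?e = "\<lambda>R p. ?E (X p) * indicator (X -` ball 0 R) p"
  \<comment> \<open>There are three regions. In the inner ball the cutoff is constantly 1 and
    \<open>a * (norm (tang W p))\<^sup>2 - 1\<close> is at least 4; in the shell this term is
    nonnegative and the cutoff costs at most 4 / h; outside everything vanishes.\<close>
  have lower: "4 * ?e s p - 4 / h * (?e (s + h) p - ?e s p) \<le> weak_div ?f p" for p
  proof -
    have "5 \<le> a * (norm (tang W p))\<^sup>2"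
      using a T[of p] by (meson mult_left_mono order_trans)
    then have c: "4 \<le> a * (norm (tang W p))\<^sup>2 - 1" by simp
    have c': "- (4 / h) \<le> cutoff' s h (X p) (tang W p)"
      using cutoff'_bound[OF s h T1[of p], of "X p"] by linarith
    have E0: "0 < ?E (X p)" by simp
    consider "norm (X p) < s" | "s \<le> norm (X p)" "norm (X p) < s + h" | "s + h \<le> norm (X p)" by linarith
    then show ?thesis
    proof cases
      case 1
      then have "weak_div ?f p = ?E (X p) * (a * (norm (tang W p))\<^sup>2 - 1)"
        using cutoff_inside[OF s h, of "X p"] by (simp add: div)
      moreover have "?e s p = ?E (X p)" "?e (s + h) p = ?E (X p)" using 1 h by simp_all
      moreover have "?E (X p) * 4 \<le> ?E (X p) * (a * (norm (tang W p))\<^sup>2 - 1)"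
        using c by (intro mult_left_mono) auto
      ultimately show ?thesis by simp
    next
      case 2
      have "- (4 / h) \<le> cutoff' s h (X p) (tang W p) + cutoff s h (X p) * (a * (norm (tang W p))\<^sup>2 - 1)"
        using c' cutoff_nonneg[of s h "X p"] c s h by (intro order_trans[OF c']) (simp add: mult_nonneg_nonneg)
      then have "?E (X p) * - (4 / h) \<le> weak_div ?f p"
        unfolding div by (intro mult_left_mono) auto
      moreover have "?e s p = 0" "?e (s + h) p = ?E (X p)" using 2 by simp_all
      ultimately show ?thesis by (simp add: mult.commute)
    next
      case 3
      then have "weak_div ?f p = 0"
        using cutoff_outside[OF s h, of "X p"] by (simp add: div)
      moreover have "?e s p = 0" "?e (s + h) p = 0" using 3 h by simp_all
      ultimately show ?thesis by simp
    qed
  qed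
  have ie: "integrable (riem_volume A X) (?e R)" for R by (rule integrable_weight[OF proper])
  have "4 * weight a s - 4 / h * (weight a (s + h) - weight a s)
      = (\<integral>p. 4 * ?e s p - 4 / h * (?e (s + h) p - ?e s p) \<partial>riem_volume A X)"
    unfolding weight_def using ie by simp
  also have "\<dots> \<le> integral\<^sup>L (riem_volume A X) (weak_div ?f)"
    by (intro integral_mono Bochner_Integration.integrable_diff integrable_mult_right ie int(1) lower)
  finally have "4 * weight a s \<le> 4 / h * (weight a (s + h) - weight a s)"
    using int(2) by simp
  then have "h * weight a s \<le> weight a (s + h) - weight a s"
    using h by (simp add: field_simps)
  then show ?thesis by (simp add: algebra_simps)
qed

lemma weight_growth:
  assumes proper: "proper X" and T: "\<And>p. \<delta> \<le> (norm (tang W p))\<^sup>2" and a: "0 \<le> a" "5 \<le> a * \<delta>"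
    and s: "0 < s" "s \<le> R"
  shows "exp (R - s) * weight a s \<le> weight a R"
proof (cases "s = R")
  case False
  then have sR: "s < R" using s by simp
  have step: "(1 + h) ^ n * weight a s \<le> weight a (s + real n * h)" if h: "0 < h" for h n
  proof (induction n)
    case (Suc n)
    have "(1 + h) ^ Suc n * weight a s = (1 + h) * ((1 + h) ^ n * weight a s)" by simp
    also have "\<dots> \<le> (1 + h) * weight a (s + real n * h)"
      using Suc h by (intro mult_left_mono) auto
    also have "\<dots> \<le> weight a (s + real n * h + h)"
      using h s by (intro weight_growth_step[OF proper T a]) (auto intro: add_pos_nonneg)
    finally show ?case by (simp add: algebra_simps)
  qed simp
  \<comment> \<open>With step size \<open>(R - s) / real n\<close> the iteration lands on
    \<open>R\<close> after exactly \<open>n\<close> steps; \<open>n = 0\<close> is left out because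
    of the division.\<close>
  have "(\<lambda>n. (1 + (R - s) / real n) ^ n * weight a s) \<longlonglongrightarrow> exp (R - s) * weight a s"
    by (intro tendsto_mult_right tendsto_exp_limit_sequentially)
  moreover have "(1 + (R - s) / real n) ^ n * weight a s \<le> weight a R" if "n > 0" for n
    using step[of "(R - s) / real n" n] sR that by simp
  ultimately show ?thesis
    by (intro LIMSEQ_le_const2) (auto intro!: exI[of _ 1])
qed simp

end

theorem theorem3:
  fixes A :: "('m::{t2_space, second_countable_topology}, 'n::finite) chart set"
    and X :: "'m \<Rightarrow> real^('n + 'k::finite)"
    and W :: "real^('n + 'k)"
  assumes "norm W = 1"
    and "smooth_atlas A"
    and "immersion A X"
    and "proper X"
    and "riem_complete A X"
    and "translating_soliton A X W"
    and "(SUP p. ereal ((norm (mean_curvature_vector A X p))\<^sup>2)) < 1"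
  shows "\<exists>a\<^sub>0>1. \<exists>\<epsilon>>0. \<forall>a>a\<^sub>0. \<forall>R\<^sub>0>0. \<forall>R\<ge>R\<^sub>0.
           (\<integral>\<^sup>+p\<in>X -` ball 0 R. ennreal (exp (a * (X p \<bullet> W))) \<partial>soliton_measure A X W)
           \<ge> ennreal (exp (\<epsilon> * (R - R\<^sub>0))) *
             (\<integral>\<^sup>+p\<in>X -` ball 0 R\<^sub>0. ennreal (exp (a * (X p \<bullet> W))) \<partial>soliton_measure A X W)"
proof -
  interpret soliton A X W
    by unfold_locales (use assms in auto)
  \<comment> \<open>A real number strictly between the supremum and 1 leaves a gap
    \<open>1 - r\<close> that is uniform in the point.\<close>
  obtain r where r: "(SUP p. ereal ((norm (mean_curvature_vector A X p))\<^sup>2)) < ereal r" "ereal r < 1"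
    using ereal_dense2[OF assms(7)] by blast
  define \<delta> where "\<delta> = 1 - r"
  have \<delta>: "\<delta> > 0" using r(2) by (simp add: \<delta>_def one_ereal_def)
  have T: "\<delta> \<le> (norm (tang W p))\<^sup>2" for p
  proof -
    have "ereal ((norm (mean_curvature_vector A X p))\<^sup>2) < ereal r"
      using r(1) by (rule le_less_trans[OF SUP_upper[OF UNIV_I]])
    then have "(norm (W - tang W p))\<^sup>2 < r"
      by (simp add: mean_curvature_vector_eq norm_minus_commute)
    then show ?thesis using norm_tang(1)[of p] by (simp add: \<delta>_def)
  qed
  have "ennreal (exp (1 * (R - R0))) * ennreal (weight a R0) \<le> ennreal (weight a R)"
    if a: "max 2 (5 / \<delta>) < a" and R: "0 < R0" "R0 \<le> R" for a R R0
  proof -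
    have "5 \<le> a * \<delta>" using a \<delta> by (simp add: field_simps)
    then have "exp (R - R0) * weight a R0 \<le> weight a R"
      using a R by (intro weight_growth[OF assms(4) T]) auto
    then show ?thesis
      using weight_nonneg by (simp add: ennreal_leI flip: ennreal_mult)
  qed
  then show ?thesis
    unfolding nn_integral_soliton_measure[OF assms(4)]
    \<comment> \<open>The entry 2 makes the threshold exceed 1, the entry
      \<open>5 / \<delta>\<close> ensures \<open>5 \<le> a * \<delta>\<close>, and 1 is the growth
      rate obtained from \<open>weight_growth\<close>.\<close>
    by (intro exI[of _ "max 2 (5 / \<delta>)"] exI[of _ 1] conjI allI impI) auto
qed

end
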